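(* Let $n\ge3$ and write $n=k+4m$ with $k\in\{3,4,5,6\}$ and $m\in\mathbb{Z}_{\ge0}$. The general polyomino chains with $n$ squares that maximize the index $R_{-1}$ are as follows: (a) if $n=3+4m$: the general polyomino chain $C_3^{m+1}$; (b) if $n=4+4m$: the family $C_{3,4}^{m,1}$, which has $m+1$ members; (c) if $n=5+4m$: the families $\bar{C}_3^{m+1}$, $C_{3,5}^{m,1}$ and $C_{3,4}^{m-1,2}$, giving in total $\frac{(m+1)(m+4)}{2}$ maximal general polyomino chains; (d) if $n=6+4m$: the families $C_{3,6}^{m,1}$, $\bar{C}_{3,4}^{m,1}$, $\underline{C}_{3,4}^{m,1}$, $C_{3,4,5}^{m-1,1,1}$ and $C_{3,4}^{m-2,3}$, giving in total $\frac{(m+1)(m+2)(2m+18)}{12}$ maximal general polyomino chains. Moreover, the maximum value of $R_{-1}$ over general polyomino chains with $k+4m$ squares ($k\in\{3,4,5,6\}$) is $\frac{11}{18}+\frac{k}{3}+\frac{143}{144}m$.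
   Context: For a graph $G$, $R_{-1}(G)=\sum_{uv\in E(G)}\frac{1}{d_ud_v}$. A polyomino system is a finite 2-connected planar graph whose interior faces (cells) are unit squares; a general polyomino chain is one whose inner dual graph (cells adjacent iff sharing an edge) is a path, built by gluing unit squares $1,\dots,n$ one at a time, square $i+1$ along a side of square $i$. Square 2 is attached to the right of square 1; square $i\ge2$ is horizontal or vertical according as it is attached left/right or above/below square $i-1$, with orientation in $\{R,L,U,D\}$. Links: $L_1=L_2=1$; for $i\ge2$, $L_{i+1}=1$ if square $i+1$ has the same direction as square $i$; otherwise, with $j=\max\{1<\ell<i:$ direction of square $\ell\ne$ direction of square $i\}$, $L_{i+1}=2$ if $j$ does not exist or the orientation of square $i+1$ equals that of square $j$, and $L_{i+1}=3$ otherwise. A square is terminal if it has exactly one adjacent square, medial if it has two adjacent squares and no vertex of degree 2, and a kink if it has two adjacent squares and contains a vertex of degree 2. A linear chain is one with all links of type 1. A segment is a maximal linear chain together with an adjacent kink or terminal square; its length is its number of squares. A segment is "generated by" a link of type 2 or 3 when the change of direction starting it is made by such a link. Families: $C_{\ell_1,\dots,\ell_r}^{\alpha_1,\dots,\alpha_r}$ is the family of general polyomino chains in which all vertical segments have length three and the total of $\sum_i\alpha_i$ horizontal segments, each generated by a type-3 link (excluding the first one), consists of $\alpha_j$ segments of length $\ell_j$, $j=1,\dots,r$. $\bar{C}_3^{m+1}$: chains with $m+1$ horizontal and $m+1$ vertical segments, all of length three, such that for some $0\le i\le m$ the first $i+1$ pairs of consecutive horizontal and vertical segments are generated by a type-3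 link and a type-2 link respectively (excluding the first segment), and the last $m-i$ pairs by a type-2 link and a type-3 link respectively. $\bar{C}_{3,4}^{m,1}$: chains with $m+1$ horizontal and $m+1$ vertical segments, for some $0\le i\le m$ the first $i+1$ pairs of consecutive horizontal and vertical segments generated by a type-3 and a type-2 link respectively (excluding the first pair) and the remaining $m-i$ pairs by a type-2 and a type-3 link respectively; all segments have length three except one horizontal segment of length four, which is either the first segment or a horizontal segment generated by a type-3 link. $\underline{C}_{3,4}^{m,1}$: same as $\bar{C}_{3,4}^{m,1}$ except that the single segment of length four is vertical, and is either the last vertical segment generated by a type-2 link or a vertical segment generated by a type-3 link. Chains are counted up to isomorphism.
   Formalization: The coefficient 143/144 of m in the maximum value is corrected to 193/144 (the linear chain already exceeds the printed value for m ≥ 1), and chains are counted up to isomorphisms preserving the numbering of the squares, since the printed counts fail for bare graph isomorphism. *)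

theory Defs
  imports "HOL-Analysis.Analysis"
begin

section \<open>Graphs and the index \<open>R\<^sub>-\<^sub>1\<close>\<close>

text \<open>
  A graph is given by its set of edges, each edge being a two-element set of vertices; its vertex
  set is the union of the edges (none of the graphs below has isolated vertices).
\<close>

definition vertex_degree :: "'v set set \<Rightarrow> 'v \<Rightarrow> nat" where
  "vertex_degree E v = card {e \<in> E. v \<in> e}"

definition R_minus_1 :: "'v set set \<Rightarrow> real" where
  "R_minus_1 E = (\<Sum>e\<in>E. 1 / (\<Prod>v\<in>e. real (vertex_degree E v)))"

definition connected_within :: "'v set set \<Rightarrow> 'v set \<Rightarrow> bool" where
  "connected_within E W \<longleftrightarrow>
     (\<forall>u\<in>W. \<forall>v\<in>W. (u, v) \<in> {(x, y). x \<in> W \<and> y \<in> W \<and> {x, y} \<in> E}\<^sup>*)"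

definition two_connected :: "'v set set \<Rightarrow> bool" where
  "two_connected E \<longleftrightarrow> card (\<Union>E) \<ge> 3 \<and> connected_within E (\<Union>E) \<and>
     (\<forall>x\<in>\<Union>E. connected_within E (\<Union>E - {x}))"


section \<open>Plane graphs and polyomino systems\<close>

text \<open>
  The vertices are points of the plane and an edge \<open>{u, v}\<close> is drawn as the straight segment
  \<open>convex hull {u, v}\<close>.
\<close>

definition plane_graph :: "complex set set \<Rightarrow> bool" where
  "plane_graph E \<longleftrightarrow> finite E \<and> (\<forall>e\<in>E. card e = 2) \<and>
     (\<forall>e\<in>E. \<forall>f\<in>E. e \<noteq> f \<longrightarrow> convex hull e \<inter> convex hull f \<subseteq> e \<inter> f)"

definition drawing :: "complex set set \<Rightarrow> complex set" where
  "drawing E = (\<Union>e\<in>E. convex hull e)"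

definition interior_faces :: "complex set set \<Rightarrow> complex set set" where
  "interior_faces E = {F \<in> components (- drawing E). bounded F}"

text \<open>The open square with corner \<open>z\<close> and sides \<open>u\<close> and \<open>\<i> * u\<close>.\<close>

definition open_square :: "complex \<Rightarrow> complex \<Rightarrow> complex set" where
  "open_square z u =
     {z + of_real s * u + of_real t * (\<i> * u) | s t. 0 < s \<and> s < 1 \<and> 0 < t \<and> t < 1}"

definition polyomino_system :: "complex set set \<Rightarrow> bool" where
  "polyomino_system E \<longleftrightarrow> plane_graph E \<and> two_connected E \<and>
     (\<forall>F\<in>interior_faces E. \<exists>z u. cmod u = 1 \<and> F = open_square z u)"

definition inner_dual_adj :: "complex set set \<Rightarrow> complex set \<Rightarrow> complex set \<Rightarrow> bool" where
  "inner_dual_adj E F F' \<longleftrightarrow>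
     F \<noteq> F' \<and> (\<exists>e\<in>E. convex hull e \<subseteq> frontier F \<inter> frontier F')"


section \<open>General polyomino chains\<close>

datatype orientation = Rightwards | Leftwards | Upwards | Downwards

fun step :: "orientation \<Rightarrow> complex" where
  "step Rightwards = 1"
| "step Leftwards = -1"
| "step Upwards = \<i>"
| "step Downwards = - \<i>"

definition horizontal :: "orientation \<Rightarrow> bool" where
  "horizontal d \<longleftrightarrow> d = Rightwards \<or> d = Leftwards"

text \<open>
  A chain is built by gluing the squares \<open>1, \<dots>, n\<close> one at a time. It is recorded as the word
  \<open>w\<close> of the orientations of the squares \<open>2, \<dots>, n\<close>, with square 1 placed at the origin. Thus
  \<open>n = length w + 1\<close>, and the orientation of square \<open>i \<ge> 2\<close> is \<open>w ! (i - 2)\<close>.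
\<close>

type_synonym chain_word = "orientation list"

definition num_squares :: "chain_word \<Rightarrow> nat" where
  "num_squares w = length w + 1"

definition orient :: "chain_word \<Rightarrow> nat \<Rightarrow> orientation" where
  "orient w i = w ! (i - 2)"

text \<open>Lower left corner of square \<open>i \<ge> 1\<close>.\<close>

definition square_pos :: "chain_word \<Rightarrow> nat \<Rightarrow> complex" where
  "square_pos w i = (\<Sum>d\<leftarrow>take (i - 1) w. step d)"

definition corners :: "chain_word \<Rightarrow> nat \<Rightarrow> complex set" where
  "corners w i =
     (let z = square_pos w i in {z, z + 1, z + 1 + \<i>, z + \<i>})"

definition sides :: "chain_word \<Rightarrow> nat \<Rightarrow> complex set set" where
  "sides w i =
     (let z = square_pos w i in
      {{z, z + 1}, {z + 1, z + 1 + \<i>}, {z + 1 + \<i>, z + \<i>}, {z + \<i>, z}})"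

definition graph_of :: "chain_word \<Rightarrow> complex set set" where
  "graph_of w = (\<Union>i\<in>{1..num_squares w}. sides w i)"

definition cell :: "chain_word \<Rightarrow> nat \<Rightarrow> complex set" where
  "cell w i = open_square (square_pos w i) 1"

text \<open>
  The requirement that the listed squares are all interior faces of the plane graph excludes words
  along which the squares overlap or enclose a hole. Words describe chains with at least two
  squares.
\<close>

definition general_polyomino_chain :: "chain_word \<Rightarrow> bool" where
  "general_polyomino_chain w \<longleftrightarrow>
     w \<noteq> [] \<and> hd w = Rightwards \<and>
     polyomino_system (graph_of w) \<and>
     bij_betw (cell w) {1..num_squares w} (interior_faces (graph_of w)) \<and>
     (\<forall>i\<in>{1..num_squares w}. \<forall>j\<in>{1..num_squares w}.
        inner_dual_adj (graph_of w) (cell w i) (cell w j) \<longleftrightarrow> i = j + 1 \<or> j = i + 1)"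

definition polyomino_chains :: "nat \<Rightarrow> chain_word set" where
  "polyomino_chains n = {w. general_polyomino_chain w \<and> num_squares w = n}"

definition R_chain :: "chain_word \<Rightarrow> real" where
  "R_chain w = R_minus_1 (graph_of w)"

text \<open>
  The maximum over chains with \<open>k + 4 * m\<close> squares has \<open>193/144\<close> as coefficient of \<open>m\<close>, where the
  source prints \<open>143/144\<close>. The linear chain with \<open>n\<close> squares has value \<open>11/18 + n/3\<close>, which exceeds
  the printed value for all \<open>m \<ge> 1\<close>; for 7 squares the maximum is \<open>425/144\<close>.
\<close>

definition maximal_chains :: "nat \<Rightarrow> chain_word set" where
  "maximal_chains n = {w \<in> polyomino_chains n. \<forall>w'\<in>polyomino_chains n. R_chain w' \<le> R_chain w}"

text \<open>
  A chain comes with the numbering \<open>1, \<dots>, n\<close> of its squares, and an isomorphism of chains is an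
  isomorphism of the graphs that takes square \<open>i\<close> to square \<open>i\<close>. Mirror images are identified, but
  not a chain and the same chain numbered from its other end: horizontal segments of lengths
  \<open>3, 4\<close> and \<open>4, 3\<close>, joined by a vertical segment of length 3, give two chains.
\<close>

definition chain_iso :: "(chain_word \<times> chain_word) set" where
  "chain_iso = {(w, w').
     general_polyomino_chain w \<and> general_polyomino_chain w' \<and> num_squares w = num_squares w' \<and>
     (\<exists>f. bij_betw f (\<Union>(graph_of w)) (\<Union>(graph_of w')) \<and>
          (\<forall>u\<in>\<Union>(graph_of w). \<forall>v\<in>\<Union>(graph_of w).
             {u, v} \<in> graph_of w \<longleftrightarrow> {f u, f v} \<in> graph_of w') \<and>
          (\<forall>i\<in>{1..num_squares w}. f ` corners w i = corners w' i))}"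

definition number_upto_iso :: "chain_word set \<Rightarrow> nat" where
  "number_upto_iso S = card (S // chain_iso)"


section \<open>Links and segments\<close>

text \<open>\<open>link w k\<close> is the type of \<open>L\<^sub>k\<close>; for \<open>k > 2\<close> the index \<open>i\<close> in \<open>L\<^sub>i\<^sub>+\<^sub>1\<close> is \<open>k - 1\<close>.\<close>

definition link :: "chain_word \<Rightarrow> nat \<Rightarrow> nat" where
  "link w k =
     (if k \<le> 2 \<or> horizontal (orient w k) = horizontal (orient w (k - 1)) then 1
      else let J = {l. 1 < l \<and> l < k - 1 \<and>
                       horizontal (orient w l) \<noteq> horizontal (orient w (k - 1))}
           in if J = {} \<or> orient w k = orient w (Max J) then 2 else 3)"

text \<open>
  The squares \<open>a, \<dots>, b\<close> form a linear chain. The first two links of a chain have type 1 by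
  convention, so only the links from \<open>a + 2\<close> on matter.
\<close>

definition linear_part :: "chain_word \<Rightarrow> nat \<Rightarrow> nat \<Rightarrow> bool" where
  "linear_part w a b \<longleftrightarrow>
     1 \<le> a \<and> a < b \<and> b \<le> num_squares w \<and> (\<forall>k\<in>{a + 2..b}. link w k = 1)"

text \<open>
  The segment consisting of the squares \<open>a, \<dots>, b\<close> is represented by the pair \<open>(a, b)\<close>. Both end
  squares (kinks or terminal squares) belong to it, so consecutive segments share a kink.
\<close>

definition segments :: "chain_word \<Rightarrow> (nat \<times> nat) set" where
  "segments w = {(a, b). linear_part w a b \<and>
     \<not> (\<exists>a' b'. linear_part w a' b' \<and> {a..b} \<subset> {a'..b'})}"

definition seg_length :: "nat \<times> nat \<Rightarrow> nat" where
  "seg_length s = card {fst s..snd s}"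

text \<open>Square \<open>fst s\<close> may belong to the preceding segment as well; the square after it does not.\<close>

definition h_segments :: "chain_word \<Rightarrow> (nat \<times> nat) set" where
  "h_segments w = {s \<in> segments w. horizontal (orient w (fst s + 1))}"

definition v_segments :: "chain_word \<Rightarrow> (nat \<times> nat) set" where
  "v_segments w = {s \<in> segments w. \<not> horizontal (orient w (fst s + 1))}"

text \<open>
  The change of direction that starts a segment happens at its first square \<open>a\<close>, with square
  \<open>a + 1\<close>. For the first segment of the chain, which no link generates, \<open>L\<^sub>2 = 1\<close>.
\<close>

definition generated_by :: "chain_word \<Rightarrow> nat \<times> nat \<Rightarrow> nat \<Rightarrow> bool" where
  "generated_by w s t \<longleftrightarrow> fst s > 1 \<and> link w (fst s + 1) = t"

text \<open>The segments in the order in which they occur along the chain.\<close>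

definition segment_list :: "chain_word \<Rightarrow> (nat \<times> nat) list" where
  "segment_list w =
     (THE ss. sorted_wrt (<) (map fst ss) \<and> set ss = segments w)"


section \<open>Families of chains\<close>

text \<open>
  \<open>C_family [(\<ell>\<^sub>1, \<alpha>\<^sub>1), \<dots>, (\<ell>\<^sub>r, \<alpha>\<^sub>r)]\<close> is
  \<open>C\<close> with subscripts \<open>\<ell>\<^sub>1, \<dots>, \<ell>\<^sub>r\<close> and superscripts \<open>\<alpha>\<^sub>1, \<dots>, \<alpha>\<^sub>r\<close>. The multiplicities
  are integers: the family is empty when one of them is negative. The number of vertical segments is
  fixed only once the number of squares is.
\<close>

definition C_family :: "(nat \<times> int) list \<Rightarrow> chain_word set" where
  "C_family ls = {w. general_polyomino_chain w \<and>
     (\<forall>s\<in>v_segments w. seg_length s = 3) \<and>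
     (\<forall>s\<in>h_segments w. fst s \<noteq> 1 \<longrightarrow> generated_by w s 3) \<and>
     int (card (h_segments w)) = sum_list (map snd ls) \<and>
     (\<forall>(l, \<alpha>)\<in>set ls. int (card {s \<in> h_segments w. seg_length s = l}) = \<alpha>)}"

text \<open>
  \<open>m + 1\<close> pairs \<open>(h\<^sub>0, v\<^sub>0), \<dots>, (h\<^sub>m, v\<^sub>m)\<close> of consecutive horizontal and vertical segments: types
  3 and 2 for the first \<open>i + 1\<close> pairs, types 2 and 3 for the others. Only \<open>h\<^sub>0\<close> is exempted, since
  \<open>v\<^sub>0\<close> is generated by a link of type 2 in every chain.
\<close>

definition paired_chain :: "nat \<Rightarrow> nat \<Rightarrow> chain_word \<Rightarrow> bool" where
  "paired_chain m i w \<longleftrightarrow> general_polyomino_chain w \<and>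
     card (h_segments w) = m + 1 \<and> card (v_segments w) = m + 1 \<and>
     (\<forall>j\<le>m. let h = segment_list w ! (2 * j); v = segment_list w ! (2 * j + 1) in
        if j \<le> i then (j = 0 \<or> generated_by w h 3) \<and> generated_by w v 2
        else generated_by w h 2 \<and> generated_by w v 3)"

definition Cbar_3 :: "nat \<Rightarrow> chain_word set" where
  "Cbar_3 m = {w. \<exists>i\<le>m. paired_chain m i w \<and> (\<forall>s\<in>segments w. seg_length s = 3)}"

definition Cbar_34 :: "nat \<Rightarrow> chain_word set" where
  "Cbar_34 m = {w. \<exists>i\<le>m. paired_chain m i w \<and>
     (\<exists>s\<in>h_segments w. seg_length s = 4 \<and> (fst s = 1 \<or> generated_by w s 3) \<and>
        (\<forall>s'\<in>segments w - {s}. seg_length s' = 3))}"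

definition Cunder_34 :: "nat \<Rightarrow> chain_word set" where
  "Cunder_34 m = {w. \<exists>i\<le>m. paired_chain m i w \<and>
     (\<exists>s\<in>v_segments w. seg_length s = 4 \<and>
        ((generated_by w s 2 \<and>
            (\<forall>s'\<in>v_segments w. generated_by w s' 2 \<longrightarrow> fst s' \<le> fst s)) \<or>
         generated_by w s 3) \<and>
        (\<forall>s'\<in>segments w - {s}. seg_length s' = 3))}"

end

theory Submission
  imports Defs "HOL-Library.Sublist"
begin

text \<open>
  By a separation argument in the plane, a word is a general polyomino chain iff squares two places
  apart in it differ and squares further apart are disjoint. Degrees are then local, and for \<open>n\<close> squares
  \<open>144 * (R\<^sub>-\<^sub>1 - n / 3 - 11 / 18)\<close> is the number of U-turns (inner segments of length three whose two
  ends are attached to the same side), minus 3 for each inner and 2 for each outer segment of length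
  two. Two consecutive segments cannot both be U-turns, since the chain would run into itself, so
  \<open>u\<close> U-turns need at least \<open>2 u + 1\<close> segments. This bounds the score by \<open>m\<close>, and in a chain that
  attains it every change of direction at the far end of a segment other than a U-turn is of type 2,
  as there is no room for a wider turn back. Such a chain is a zigzag, or two zigzags joined at a
  right angle. It is determined up to reflection by the position of the joint and the extra squares
  of its segments, of which there are at most three in total.
\<close>

section \<open>Displacements\<close>

text \<open>The period 4 comes from pairing each U-turn with the run after it. Both take at least
  two letters, and the first run of the chain takes two more, so \<open>m\<close> U-turns use at
  least \<open>4 * m + 3\<close> squares and \<open>k - 3 \<le> 3\<close> extra steps remain. A
  further run uses up two of these. Hence two zigzags can be joined only if
  \<open>k \<ge> 5\<close>, and then with at most one extra step, which is too little for them to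
  collide. The index becomes local by shifting \<open>1 / d\<close> by its value
  \<open>1 / 3\<close> at the usual degree 3. The part linear in the shifts sums to a constant by
  double counting. What remains are products over edges whose two ends both have degree 2 or 4;
  these occur only at the ends of the chain and where kinks are close together. A run of a single
  step loses at least 2 and makes room for at most one more U-turn, worth 1, so short runs never
  pay. A chain is defined through the faces of a plane drawing. Janiszewski's theorem leads from
  disjoint squares to faces, its dual leads back.\<close>

fun opp :: "orientation \<Rightarrow> orientation" where
  "opp Rightwards = Leftwards"
| "opp Leftwards = Rightwards"
| "opp Upwards = Downwards"
| "opp Downwards = Upwards"

definition perp :: "orientation \<Rightarrow> orientation \<Rightarrow> bool" where
  "perp a b \<longleftrightarrow> horizontal a \<noteq> horizontal b"

text \<open>The axis is named by an orientation rather than by a coordinate, so that an argument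
  about runs can use the directions of those runs as its frame.\<close>

definition dirc :: "orientation \<Rightarrow> orientation \<Rightarrow> int" where
  "dirc a d = (if d = a then 1 else if d = opp a then - 1 else 0)"

definition disp :: "orientation \<Rightarrow> orientation list \<Rightarrow> int" where
  "disp a v = (\<Sum>d\<leftarrow>v. dirc a d)"

text \<open>Closed unit lattice squares are disjoint exactly if some coordinate of their offset is
  at least 2 in absolute value.\<close>

definition far :: "orientation list \<Rightarrow> bool" where
  "far v \<longleftrightarrow> 2 \<le> \<bar>disp Rightwards v\<bar> \<or> 2 \<le> \<bar>disp Upwards v\<bar>"

text \<open>A factor with \<open>l\<close> letters leads from a square to the \<open>l\<close>-th
  one after it. The squares before and after a kink share a corner, so disjointness can be asked
  only from three letters on.\<close>

definition self_avoiding :: "orientation list \<Rightarrow> bool" where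
  "self_avoiding w \<longleftrightarrow> (\<forall>v. sublist v w \<longrightarrow>
     (length v = 2 \<longrightarrow> disp Rightwards v \<noteq> 0 \<or> disp Upwards v \<noteq> 0) \<and> (3 \<le> length v \<longrightarrow> far v))"

lemma opp_opp [simp]: "opp (opp a) = a"
  by (cases a) auto

lemma opp_neq [simp]: "opp a \<noteq> a" "a \<noteq> opp a"
  by (cases a; simp)+

lemma opp_eq_iff [simp]: "opp a = opp b \<longleftrightarrow> a = b"
  by (cases a; cases b) auto

lemma perp_simps [simp]: "perp a a = False" "perp a (opp b) = perp a b" "perp (opp a) b = perp a b"
  by (cases a; cases b; simp add: perp_def horizontal_def)+

lemma perp_commute: "perp a b = perp b a"
  by (auto simp: perp_def)

lemma not_perp_iff: "\<not> perp a b \<longleftrightarrow> b = a \<or> b = opp a"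
  by (cases a; cases b; simp add: perp_def horizontal_def)

lemma perp_perp: "perp a b \<Longrightarrow> perp b c \<Longrightarrow> c = a \<or> c = opp a"
  by (cases a; cases b; cases c; simp add: perp_def horizontal_def)

lemma dirc_simps [simp]: "dirc a a = 1" "dirc a (opp a) = -1" "dirc (opp a) b = - dirc a b"
  "dirc a (opp b) = - dirc a b"
  by (cases a; cases b; simp add: dirc_def)+

lemma dirc_perp: "perp a b \<Longrightarrow> dirc a b = 0"
  by (cases a; cases b; simp add: dirc_def perp_def horizontal_def)

lemma disp_simps [simp]: "disp a [] = 0" "disp a (d # v) = dirc a d + disp a v"
  "disp a (u @ v) = disp a u + disp a v" "disp a (replicate n d) = int n * dirc a d"
  by (simp_all add: disp_def sum_list_replicate)

lemma disp_opp [simp]: "disp (opp a) v = - disp a v"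
  by (induction v) auto

lemma perp_cases:
  assumes "perp a c"
  obtains "a = Rightwards \<or> a = opp Rightwards" "c = Upwards \<or> c = opp Upwards"
    | "a = Upwards \<or> a = opp Upwards" "c = Rightwards \<or> c = opp Rightwards"
  using assms by (cases a; cases c; simp add: perp_def horizontal_def)

lemma far_perp:
  assumes "perp a c"
  shows "far v \<longleftrightarrow> 2 \<le> \<bar>disp a v\<bar> \<or> 2 \<le> \<bar>disp c v\<bar>"
  using assms by (rule perp_cases) (auto simp: far_def simp del: opp.simps)

lemma nonclosed_perp:
  assumes "perp a c"
  shows "disp Rightwards v \<noteq> 0 \<or> disp Upwards v \<noteq> 0 \<longleftrightarrow> disp a v \<noteq> 0 \<or> disp c v \<noteq> 0"
  using assms by (rule perp_cases) (auto simp del: opp.simps)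

text \<open>Another perpendicular frame only permutes the coordinates and changes signs, so the
  condition may be tested along the directions of two successive runs.\<close>

lemma self_avoiding_perp:
  assumes "perp a c"
  shows "self_avoiding w \<longleftrightarrow> (\<forall>v. sublist v w \<longrightarrow>
     (length v = 2 \<longrightarrow> disp a v \<noteq> 0 \<or> disp c v \<noteq> 0) \<and>
     (3 \<le> length v \<longrightarrow> 2 \<le> \<bar>disp a v\<bar> \<or> 2 \<le> \<bar>disp c v\<bar>))"
  unfolding self_avoiding_def far_perp[OF assms] nonclosed_perp[OF assms] ..

lemma self_avoiding_sublist: "self_avoiding w \<Longrightarrow> sublist v w \<Longrightarrow> self_avoiding v"
  unfolding self_avoiding_def using sublist_order.order_trans by blast

lemma self_avoiding_factor:
  assumes "self_avoiding (p @ v @ q)" "3 \<le> length v" "perp a c"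
  shows "2 \<le> \<bar>disp a v\<bar> \<or> 2 \<le> \<bar>disp c v\<bar>"
  using assms unfolding self_avoiding_perp[OF assms(3)] by auto

section \<open>Positions of the squares in the integer lattice\<close>

definition pos :: "chain_word \<Rightarrow> nat \<Rightarrow> int \<times> int" where
  "pos w i = (disp Rightwards (take (i - 1) w), disp Upwards (take (i - 1) w))"

definition lat :: "int \<times> int \<Rightarrow> complex" where
  "lat p = Complex (of_int (fst p)) (of_int (snd p))"

lemma lat_sel [simp]: "Re (lat p) = of_int (fst p)" "Im (lat p) = of_int (snd p)"
  by (simp_all add: lat_def)

lemma lat_eq_iff [simp]: "lat p = lat q \<longleftrightarrow> p = q"
  by (auto simp: complex_eq_iff prod_eq_iff)

lemma step_lat: "step d = lat (dirc Rightwards d, dirc Upwards d)"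
  by (cases d) (auto simp: complex_eq_iff dirc_def)

lemma lat_add: "lat (x, y) + lat (x', y') = lat (x + x', y + y')"
  by (simp add: complex_eq_iff)

lemma square_pos_eq: "square_pos w i = lat (pos w i)"
proof -
  have "(\<Sum>d\<leftarrow>v. step d) = lat (disp Rightwards v, disp Upwards v)" for v
    by (induction v) (auto simp: step_lat lat_add, simp add: complex_eq_iff)
  thus ?thesis by (simp add: square_pos_def pos_def)
qed

lemma pos_diff:
  assumes "1 \<le> i" "i \<le> j" "j \<le> num_squares w"
  shows "fst (pos w j) - fst (pos w i) = disp Rightwards (take (j - i) (drop (i - 1) w))"
    "snd (pos w j) - snd (pos w i) = disp Upwards (take (j - i) (drop (i - 1) w))"
proof -
  have "take (j - 1) w = take (i - 1) w @ take (j - i) (drop (i - 1) w)"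
    using take_add[of "i - 1" "j - i" w] assms by simp
  thus "fst (pos w j) - fst (pos w i) = disp Rightwards (take (j - i) (drop (i - 1) w))"
    "snd (pos w j) - snd (pos w i) = disp Upwards (take (j - i) (drop (i - 1) w))"
    by (auto simp: pos_def)
qed

lemma pos_Suc:
  assumes "1 \<le> i" "i < num_squares w"
  shows "pos w (Suc i) =
    (fst (pos w i) + dirc Rightwards (w ! (i - 1)), snd (pos w i) + dirc Upwards (w ! (i - 1)))"
proof -
  obtain k where k: "i = Suc k" using assms by (cases i) auto
  show ?thesis using assms by (simp add: k pos_def num_squares_def take_Suc_conv_app_nth)
qed

definition apart :: "int \<times> int \<Rightarrow> int \<times> int \<Rightarrow> bool" where
  "apart p q \<longleftrightarrow> 2 \<le> \<bar>fst q - fst p\<bar> \<or> 2 \<le> \<bar>snd q - snd p\<bar>"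

lemma self_avoiding_iff_pos:
  "self_avoiding w \<longleftrightarrow>
     (\<forall>(i::nat) j. 1 \<le> i \<longrightarrow> j \<le> num_squares w \<longrightarrow> (j = i + 2 \<longrightarrow> pos w i \<noteq> pos w j) \<and>
        (i + 3 \<le> j \<longrightarrow> apart (pos w i) (pos w j)))" (is "_ \<longleftrightarrow> ?R")
proof
  assume sa: "self_avoiding w"
  show ?R
  proof (intro allI impI)
    fix i j :: nat assume ij: "1 \<le> i" "j \<le> num_squares w"
    let ?v = "take (j - i) (drop (i - 1) w)"
    have "sublist ?v w" by (meson sublist_drop sublist_order.order_trans sublist_take)
    hence *: "(length ?v = 2 \<longrightarrow> disp Rightwards ?v \<noteq> 0 \<or> disp Upwards ?v \<noteq> 0) \<and>
        (3 \<le> length ?v \<longrightarrow> far ?v)"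
      using sa unfolding self_avoiding_def by blast
    have len: "length ?v = j - i" using ij by (auto simp: num_squares_def)
    show "(j = i + 2 \<longrightarrow> pos w i \<noteq> pos w j) \<and> (i + 3 \<le> j \<longrightarrow> apart (pos w i) (pos w j))"
    proof (intro conjI impI)
      assume "j = i + 2"
      thus "pos w i \<noteq> pos w j"
        using * len pos_diff[of i j w] ij by auto
    next
      assume "i + 3 \<le> j"
      hence "3 \<le> length ?v" unfolding len by linarith
      hence "far ?v" using * by blast
      thus "apart (pos w i) (pos w j)"
        using pos_diff[of i j w] ij \<open>i + 3 \<le> j\<close> by (auto simp: apart_def far_def)
    qed
  qed
next
  assume R: ?R
  show "self_avoiding w"
    unfolding self_avoiding_def
  proof (intro allI impI)
    fix v assume "sublist v w"
    then obtain p q where w: "w = p @ v @ q" by (auto simp: sublist_def)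
    define i where "i = length p + 1"
    define j where "j = i + length v"
    have v: "v = take (j - i) (drop (i - 1) w)" by (simp add: w i_def j_def)
    have ij: "1 \<le> i" "i \<le> j" "j \<le> num_squares w" by (auto simp: i_def j_def w num_squares_def)
    show "(length v = 2 \<longrightarrow> disp Rightwards v \<noteq> 0 \<or> disp Upwards v \<noteq> 0) \<and> (3 \<le> length v \<longrightarrow> far v)"
      using R[rule_format, OF ij(1,3)] pos_diff[OF ij, folded v]
      by (auto simp: j_def apart_def far_def prod_eq_iff)
  qed
qed

lemma self_avoiding_pos_neq:
  assumes "self_avoiding w" "1 \<le> i" "i < j" "j \<le> num_squares w"
  shows "pos w i \<noteq> pos w j"
proof -
  consider "j = Suc i" | "j = i + 2" | "i + 3 \<le> j" using assms by linarith
  thus ?thesis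
  proof cases
    case 1
    thus ?thesis using pos_Suc[of i w] assms
      by (cases "w ! (i - 1)") (auto simp: dirc_def prod_eq_iff)
  next
    case 2
    thus ?thesis using assms unfolding self_avoiding_iff_pos by blast
  next
    case 3
    hence "apart (pos w i) (pos w j)" using assms unfolding self_avoiding_iff_pos by blast
    thus ?thesis by (auto simp: apart_def)
  qed
qed

section \<open>Unions of lattice squares\<close>

definition hedge :: "int \<times> int \<Rightarrow> complex set" where
  "hedge p = {lat p, lat (fst p + 1, snd p)}"

definition vedge :: "int \<times> int \<Rightarrow> complex set" where
  "vedge p = {lat p, lat (fst p, snd p + 1)}"

definition corners_at :: "int \<times> int \<Rightarrow> complex set" where
  "corners_at p = lat ` ({fst p, fst p + 1} \<times> {snd p, snd p + 1})"

definition sides_at :: "int \<times> int \<Rightarrow> complex set set" where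
  "sides_at p = {hedge p, vedge (fst p + 1, snd p), hedge (fst p, snd p + 1), vedge p}"

definition cell_at :: "int \<times> int \<Rightarrow> complex set" where
  "cell_at p = box (lat p) (lat (fst p + 1, snd p + 1))"

definition region_at :: "int \<times> int \<Rightarrow> complex set" where
  "region_at p = cbox (lat p) (lat (fst p + 1, snd p + 1))"

lemma corners_eq: "corners w i = corners_at (pos w i)"
  by (auto simp: corners_def corners_at_def square_pos_eq Let_def complex_eq_iff image_iff)

lemma sides_eq: "sides w i = sides_at (pos w i)"
proof -
  obtain x y where p: "pos w i = (x, y)" by force
  have *: "lat (x, y) + 1 = lat (x + 1, y)" "lat (x + 1, y) + \<i> = lat (x + 1, y + 1)"
    "lat (x, y) + \<i> = lat (x, y + 1)"
    by (simp_all add: complex_eq_iff)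
  show ?thesis
    by (simp add: sides_def sides_at_def hedge_def vedge_def square_pos_eq p Let_def * insert_commute)
qed

lemma graph_of_eq: "graph_of w = \<Union> (sides_at ` pos w ` {1..num_squares w})"
  by (simp add: graph_of_def sides_eq)

lemma mem_cell_at:
  "z \<in> cell_at p \<longleftrightarrow> of_int (fst p) < Re z \<and> Re z < of_int (fst p) + 1 \<and>
     of_int (snd p) < Im z \<and> Im z < of_int (snd p) + 1"
  by (auto simp: cell_at_def in_box_complex_iff)

lemma mem_region_at:
  "z \<in> region_at p \<longleftrightarrow> of_int (fst p) \<le> Re z \<and> Re z \<le> of_int (fst p) + 1 \<and>
     of_int (snd p) \<le> Im z \<and> Im z \<le> of_int (snd p) + 1"
  by (auto simp: region_at_def in_cbox_complex_iff)

lemma open_square_lat: "open_square (lat p) 1 = cell_at p"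
proof (intro set_eqI iffI)
  fix z assume z: "z \<in> cell_at p"
  show "z \<in> open_square (lat p) 1"
    unfolding open_square_def mem_Collect_eq
    by (rule exI[of _ "Re z - of_int (fst p)"], rule exI[of _ "Im z - of_int (snd p)"])
      (use z in \<open>auto simp: mem_cell_at complex_eq_iff\<close>)
qed (auto simp: open_square_def mem_cell_at)

lemma cell_eq: "cell w i = cell_at (pos w i)"
  by (simp add: cell_def square_pos_eq open_square_lat)

lemma hull_hedge:
  "convex hull (hedge p) =
     {z. of_int (fst p) \<le> Re z \<and> Re z \<le> of_int (fst p) + 1 \<and> Im z = of_int (snd p)}"
  unfolding hedge_def segment_convex_hull[symmetric]
  by (subst closed_segment_same_Im) (auto simp: closed_segment_eq_real_ivl)

lemma hull_vedge:
  "convex hull (vedge p) =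
     {z. Re z = of_int (fst p) \<and> of_int (snd p) \<le> Im z \<and> Im z \<le> of_int (snd p) + 1}"
  unfolding vedge_def segment_convex_hull[symmetric]
  by (subst closed_segment_same_Re) (auto simp: closed_segment_eq_real_ivl)

lemma mem_hedge:
  "z \<in> hedge p \<longleftrightarrow>
     Im z = of_int (snd p) \<and> (Re z = of_int (fst p) \<or> Re z = of_int (fst p) + 1)"
  by (auto simp: hedge_def complex_eq_iff)

lemma mem_vedge:
  "z \<in> vedge p \<longleftrightarrow>
     Re z = of_int (fst p) \<and> (Im z = of_int (snd p) \<or> Im z = of_int (snd p) + 1)"
  by (auto simp: vedge_def complex_eq_iff)

definition unit_edge :: "complex set \<Rightarrow> bool" where
  "unit_edge e \<longleftrightarrow> (\<exists>p. e = hedge p \<or> e = vedge p)"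

lemma unit_edge_sides: "e \<in> sides_at p \<Longrightarrow> unit_edge e"
  unfolding sides_at_def unit_edge_def by blast

lemma card_unit_edge: "unit_edge e \<Longrightarrow> card e = 2"
  by (auto simp: unit_edge_def hedge_def vedge_def prod_eq_iff card_insert_if)

lemma int_between: "real_of_int a \<le> of_int b + 1 \<Longrightarrow> a \<le> b + 1"
  by linarith

lemma hull_unit_edges:
  assumes "unit_edge e" "unit_edge f" "e \<noteq> f"
  shows "convex hull e \<inter> convex hull f \<subseteq> e \<inter> f"
proof
  fix z assume z: "z \<in> convex hull e \<inter> convex hull f"
  have hh: "z \<in> hedge p \<inter> hedge q"
    if "z \<in> convex hull (hedge p) \<inter> convex hull (hedge q)" "hedge p \<noteq> hedge q" for p q
  proof -
    from that have s: "snd p = snd q" by (auto simp: hull_hedge)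
    with that have f: "fst p \<noteq> fst q" by (metis prod_eqI)
    from that have "fst p \<le> fst q + 1" "fst q \<le> fst p + 1"
      by (auto simp: hull_hedge intro!: int_between)
    with f have "fst q = fst p + 1 \<or> fst p = fst q + 1" by linarith
    thus ?thesis using that s by (auto simp: hull_hedge mem_hedge)
  qed
  have vv: "z \<in> vedge p \<inter> vedge q"
    if "z \<in> convex hull (vedge p) \<inter> convex hull (vedge q)" "vedge p \<noteq> vedge q" for p q
  proof -
    from that have s: "fst p = fst q" by (auto simp: hull_vedge)
    with that have f: "snd p \<noteq> snd q" by (metis prod_eqI)
    from that have "snd p \<le> snd q + 1" "snd q \<le> snd p + 1"
      by (auto simp: hull_vedge intro!: int_between)
    with f have "snd q = snd p + 1 \<or> snd p = snd q + 1" by linarith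
    thus ?thesis using that s by (auto simp: hull_vedge mem_vedge)
  qed
  have hv: "z \<in> hedge p \<inter> vedge q"
    if "z \<in> convex hull (hedge p) \<inter> convex hull (vedge q)" for p q
  proof -
    from that have *: "Re z = of_int (fst q)" "Im z = of_int (snd p)"
      "fst p \<le> fst q" "fst q \<le> fst p + 1" "snd q \<le> snd p" "snd p \<le> snd q + 1"
      by (auto simp: hull_hedge hull_vedge)
    hence "fst q = fst p \<or> fst q = fst p + 1" "snd p = snd q \<or> snd p = snd q + 1" by linarith+
    thus ?thesis using * by (auto simp: mem_hedge mem_vedge)
  qed
  show "z \<in> e \<inter> f"
    using assms z hh vv hv unfolding unit_edge_def by blast
qed

lemma cell_hull_disjoint:
  assumes "unit_edge e"
  shows "cell_at p \<inter> convex hull e = {}"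
proof -
  from assms obtain q where "e = hedge q \<or> e = vedge q" by (auto simp: unit_edge_def)
  thus ?thesis by (auto simp: hull_hedge hull_vedge mem_cell_at)
qed

lemma region_diff_cell: "region_at p - cell_at p = (\<Union>e\<in>sides_at p. convex hull e)"
  by (auto simp: sides_at_def hull_hedge hull_vedge mem_region_at mem_cell_at)

lemma frontier_cell: "frontier (cell_at p) = region_at p - cell_at p"
proof -
  have "cell_at p \<noteq> {}"
    unfolding cell_at_def box_ne_empty by (auto simp: Basis_complex_def)
  thus ?thesis unfolding cell_at_def region_at_def by (simp add: frontier_box)
qed

lemma connected_cell: "connected (cell_at p)"
  by (simp add: cell_at_def convex_connected)

lemma lat_mem_region: "lat q \<in> region_at p \<longleftrightarrow> lat q \<in> corners_at p"
proof -
  obtain a b x y where [simp]: "p = (a, b)" "q = (x, y)" by (metis surj_pair)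
  have "x \<le> a + 1 \<longleftrightarrow> real_of_int x \<le> of_int a + 1" "y \<le> b + 1 \<longleftrightarrow> real_of_int y \<le> of_int b + 1"
    by linarith+
  thus ?thesis
    by (auto simp: mem_region_at corners_at_def image_iff mem_Times_iff)
qed

lemma cell_at_nonempty: "cell_at p \<noteq> {}"
  unfolding cell_at_def box_ne_empty by (auto simp: Basis_complex_def)

lemma cell_at_eq_iff: "cell_at p = cell_at q \<longleftrightarrow> p = q"
proof
  assume eq: "cell_at p = cell_at q"
  have "lat p + Complex (1/2) (1/2) \<in> cell_at p" by (simp add: mem_cell_at)
  with eq have "lat p + Complex (1/2) (1/2) \<in> cell_at q" by simp
  hence "fst p = fst q \<and> snd p = snd q" by (simp add: mem_cell_at)
  thus "p = q" by (simp add: prod_eq_iff)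
qed simp

lemma compact_region: "compact (region_at p)"
  by (simp add: region_at_def)

lemma convex_region: "convex (region_at p)"
  by (simp add: region_at_def)

text \<open>The complement of the drawing consists of the open cells, each a component because its
  frontier is drawn, and of \<open>Out\<close>. A bounded set leaves only one unbounded component in
  the plane, so the cells are all the bounded faces precisely if \<open>Out\<close> does not break
  up.\<close>

lemma faces_of_squares:
  fixes Z :: "(int \<times> int) set"
  assumes Z: "finite Z"
  defines "E \<equiv> \<Union> (sides_at ` Z)" and "Out \<equiv> - (\<Union> (region_at ` Z))"
  shows "interior_faces E = cell_at ` Z \<longleftrightarrow> connected Out"
proof -
  have E: "unit_edge e" if "e \<in> E" for e
    using that unit_edge_sides by (auto simp: E_def)
  have draw: "drawing E = (\<Union>p\<in>Z. region_at p - cell_at p)"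
    by (auto simp: drawing_def E_def region_diff_cell)
  have cell_draw: "cell_at p \<inter> drawing E = {}" for p
    using cell_hull_disjoint E unfolding drawing_def by blast
  have cell_region: "cell_at p \<subseteq> region_at p" for p
    by (auto simp: mem_cell_at mem_region_at)
  have out_eq: "Out = - drawing E - \<Union> (cell_at ` Z)"
    using cell_region by (auto simp: Out_def draw)
  have regb: "bounded (\<Union> (region_at ` Z))"
    using Z compact_region compact_imp_bounded by blast
  have "drawing E \<subseteq> \<Union> (region_at ` Z)" by (auto simp: draw)
  hence db: "bounded (- (- drawing E))" using regb bounded_subset by auto
  have out_unbounded: "\<not> bounded Out"
    using regb by (intro cobounded_imp_unbounded) (simp add: Out_def)
  have cell_comp: "cell_at p \<in> components (- drawing E)" if "p \<in> Z" for p
    unfolding in_components_maximal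
  proof (intro conjI allI impI)
    show "cell_at p \<noteq> {}" "connected (cell_at p)" "cell_at p \<subseteq> - drawing E"
      using cell_draw[of p] by (auto simp: cell_at_nonempty connected_cell)
    fix D assume D: "D \<noteq> {} \<and> cell_at p \<subseteq> D \<and> D \<subseteq> - drawing E \<and> connected D"
    have "D \<inter> frontier (cell_at p) = {}"
      using D that by (auto simp: frontier_cell draw)
    \<comment> \<open>A connected set that meets the cell but not its frontier cannot leave the
      cell.\<close>
    hence "D - cell_at p = {}"
      using connected_Int_frontier[of D "cell_at p"] D cell_at_nonempty[of p] by blast
    thus "D = cell_at p" using D by auto
  qed
  have bounded_cell: "bounded (cell_at p)" for p by (simp add: cell_at_def)
  have component_subset_out: "C \<subseteq> Out" if "C \<in> components (- drawing E)" "C \<notin> cell_at ` Z" for C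
  proof -
    have "C \<inter> cell_at p = {}" if "p \<in> Z" for p
      using components_nonoverlap[OF \<open>C \<in> _\<close> cell_comp[OF that]] \<open>C \<notin> _\<close> that by auto
    thus ?thesis using in_components_subset[OF that(1)] by (auto simp: out_eq)
  qed
  show ?thesis
  proof
    assume "connected Out"
    have "C = Out" if "C \<in> components (- drawing E)" "C \<notin> cell_at ` Z" for C
    proof -
      have "C \<subseteq> Out" "C \<noteq> {}" using component_subset_out[OF that] that in_components_nonempty by auto
      thus ?thesis
        using that(1) \<open>connected Out\<close> unfolding in_components_maximal out_eq
        by (metis (no_types, lifting) Diff_subset subset_empty)
    qed
    thus "interior_faces E = cell_at ` Z"
      using out_unbounded cell_comp bounded_cell by (auto simp: interior_faces_def)
  next
    assume faces: "interior_faces E = cell_at ` Z"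
    \<comment> \<open>The component of a point of \<open>Out\<close> is not a cell, so by hypothesis
      it is not a bounded face.\<close>
    have unb: "connected_component_set (- drawing E) x \<in> components (- drawing E)"
      "\<not> bounded (connected_component_set (- drawing E) x)" if "x \<in> Out" for x
    proof -
      show *: "connected_component_set (- drawing E) x \<in> components (- drawing E)"
        using that by (auto simp: out_eq components_def)
      have "x \<in> connected_component_set (- drawing E) x"
        using that by (auto simp: out_eq intro: connected_component_refl)
      hence "connected_component_set (- drawing E) x \<notin> cell_at ` Z"
        using that by (auto simp: out_eq)
      thus "\<not> bounded (connected_component_set (- drawing E) x)"
        using * faces by (auto simp: interior_faces_def)
    qed
    obtain x where x: "x \<in> Out" using out_unbounded by (metis bounded_empty ex_in_conv)
    let ?C = "connected_component_set (- drawing E) x"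
    have "Out \<subseteq> ?C"
    proof
      fix y assume y: "y \<in> Out"
      have "connected_component_set (- drawing E) y = ?C"
        using cobounded_unique_unbounded_components[OF db unb[OF x] unb[OF y]] by simp
      thus "y \<in> ?C" using y by (auto simp: out_eq intro: connected_component_refl)
    qed
    moreover have "?C \<notin> cell_at ` Z"
    proof
      assume "?C \<in> cell_at ` Z"
      then obtain p where "?C = cell_at p" by (rule imageE)
      thus False using unb(2)[OF x] bounded_cell[of p] by simp
    qed
    hence "?C \<subseteq> Out"
      using component_subset_out[OF unb(1)[OF x]] by blast
    ultimately show "connected Out" by (metis connected_connected_component subset_antisym)
  qed
qed

section \<open>Polyomino chains are self-avoiding words\<close>

definition shift :: "int \<times> int \<Rightarrow> orientation \<Rightarrow> int \<times> int" where
  "shift p d = (fst p + dirc Rightwards d, snd p + dirc Upwards d)"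

fun shared_edge :: "int \<times> int \<Rightarrow> orientation \<Rightarrow> complex set" where
  "shared_edge p Rightwards = vedge (fst p + 1, snd p)"
| "shared_edge p Leftwards = vedge p"
| "shared_edge p Upwards = hedge (fst p, snd p + 1)"
| "shared_edge p Downwards = hedge p"

lemma shift_simps [simp]:
  "shift p Rightwards = (fst p + 1, snd p)" "shift p Leftwards = (fst p - 1, snd p)"
  "shift p Upwards = (fst p, snd p + 1)" "shift p Downwards = (fst p, snd p - 1)"
  by (simp_all add: shift_def dirc_def)

lemma pos_Suc_shift: "1 \<le> i \<Longrightarrow> i < num_squares w \<Longrightarrow> pos w (Suc i) = shift (pos w i) (w ! (i - 1))"
  by (simp add: pos_Suc shift_def)

lemma pos_1 [simp]: "pos w (Suc 0) = (0, 0)"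
  by (simp add: pos_def)

lemma mem_corners_at:
  "z \<in> corners_at p \<longleftrightarrow> (Re z = of_int (fst p) \<or> Re z = of_int (fst p) + 1) \<and>
     (Im z = of_int (snd p) \<or> Im z = of_int (snd p) + 1)"
  by (auto simp: corners_at_def image_iff complex_eq_iff)

lemma corners_shift: "corners_at p \<inter> corners_at (shift p d) = shared_edge p d"
  by (cases d) (auto simp: mem_corners_at mem_hedge mem_vedge)

lemma shared_edge_sides: "shared_edge p d \<in> sides_at p" "shared_edge p d \<in> sides_at (shift p d)"
  by (cases d; simp add: sides_at_def)+

lemma shift_neq: "shift p d \<noteq> p" "p \<noteq> shift p d"
  by (cases d; simp add: prod_eq_iff)+

lemma side_subset_corners: "e \<in> sides_at p \<Longrightarrow> e \<subseteq> corners_at p"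
  by (auto simp: sides_at_def mem_corners_at mem_hedge mem_vedge)

lemma finite_corners_at [simp]: "finite (corners_at p)"
  by (simp add: corners_at_def)

lemma finite_sides_at [simp]: "finite (sides_at p)"
  by (simp add: sides_at_def)

lemma int_apart: "2 \<le> \<bar>b - a\<bar> \<Longrightarrow> real_of_int a \<le> x \<Longrightarrow> x \<le> of_int a + 1 \<Longrightarrow>
    of_int b \<le> x \<Longrightarrow> x \<le> of_int b + 1 \<Longrightarrow> False"
  by linarith

lemma region_apart: "apart p q \<Longrightarrow> region_at p \<inter> region_at q = {}"
  unfolding apart_def mem_region_at disjoint_iff using int_apart by metis

lemma corners_subset_region: "corners_at p \<subseteq> region_at p"
  by (auto simp: mem_corners_at mem_region_at)

lemma corners_apart: "apart p q \<Longrightarrow> corners_at p \<inter> corners_at q = {}"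
  using region_apart corners_subset_region by blast

text \<open>At a kink the two outer squares share only a corner of the middle one, and along a line
  they share nothing. The second part is parity: two steps change the sum of the coordinates by an
  even number, one step by an odd one.\<close>

lemma two_steps:
  assumes "d' \<noteq> opp d"
  shows "region_at p \<inter> region_at (shift (shift p d) d') \<subseteq> region_at (shift p d)"
    "shift (shift p d) d' \<noteq> shift p d''"
proof -
  show "region_at p \<inter> region_at (shift (shift p d) d') \<subseteq> region_at (shift p d)"
    using assms by (cases d; cases d') (auto simp: mem_region_at)
  show "shift (shift p d) d' \<noteq> shift p d''"
    by (cases d; cases d'; cases d'') (auto simp: prod_eq_iff)
qed

lemma lattice_square_cases:
  obtains "p = q" | d where "q = shift p d"
    | "\<bar>fst q - fst p\<bar> = 1" "\<bar>snd q - snd p\<bar> = 1" | "apart p q"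
proof (cases "apart p q")
  case False
  obtain x y a b where p: "p = (a, b)" and q: "q = (x, y)" by (metis surj_pair)
  have "x = a - 1 \<or> x = a \<or> x = a + 1" "y = b - 1 \<or> y = b \<or> y = b + 1"
    using False unfolding apart_def p q fst_conv snd_conv by linarith+
  thus ?thesis
    using that(1,3) that(2)[of Rightwards] that(2)[of Leftwards] that(2)[of Upwards]
      that(2)[of Downwards]
    unfolding p q by (elim disjE) simp_all
qed (use that in blast)

lemma region_diagonal:
  assumes "\<bar>fst q - fst p\<bar> = 1" "\<bar>snd q - snd p\<bar> = 1"
  obtains v where "region_at p \<inter> region_at q = {lat v}" "corners_at p \<inter> corners_at q = {lat v}"
proof -
  obtain a b x y where p: "p = (a, b)" and q: "q = (x, y)" by (metis surj_pair)
  have "x = a + 1 \<or> x = a - 1" "y = b + 1 \<or> y = b - 1" using assms unfolding p q by auto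
  hence "region_at p \<inter> region_at q = {lat (max a x, max b y)} \<and>
      corners_at p \<inter> corners_at q = {lat (max a x, max b y)}"
    unfolding p q by (auto simp: mem_region_at mem_corners_at complex_eq_iff)
  thus ?thesis using that by blast
qed

text \<open>Both ends of a common frontier edge lie in both closed squares, which makes one
  coordinate of the positions equal and lets the other differ by at most 1.\<close>

lemma dual_adj_imp_shift:
  assumes "\<And>e. e \<in> E \<Longrightarrow> unit_edge e" "inner_dual_adj E (cell_at p) (cell_at q)"
  shows "\<exists>d. q = shift p d"
proof -
  have pq: "p \<noteq> q" using assms(2) by (auto simp: inner_dual_adj_def)
  obtain e where "e \<in> E" and hull: "convex hull e \<subseteq> frontier (cell_at p) \<inter> frontier (cell_at q)"
    using assms(2) unfolding inner_dual_adj_def by (elim conjE bexE)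
  have e: "unit_edge e" using assms(1) \<open>e \<in> E\<close> .
  have "convex hull e \<subseteq> region_at p \<inter> region_at q"
  proof
    fix z assume "z \<in> convex hull e"
    hence "z \<in> frontier (cell_at p)" "z \<in> frontier (cell_at q)" using hull by (auto dest: subsetD)
    thus "z \<in> region_at p \<inter> region_at q" by (simp add: frontier_cell)
  qed
  from order_trans[OF hull_subset this]
  have sub: "e \<subseteq> region_at p" "e \<subseteq> region_at q" by simp_all
  from e obtain r where "e = hedge r \<or> e = vedge r" by (auto simp: unit_edge_def)
  thus ?thesis
  proof
    assume r: "e = hedge r"
    have "lat r \<in> e" "lat (fst r + 1, snd r) \<in> e" by (auto simp: r hedge_def)
    with sub have "lat r \<in> region_at p" "lat (fst r + 1, snd r) \<in> region_at p"
      "lat r \<in> region_at q" "lat (fst r + 1, snd r) \<in> region_at q" by auto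
    hence "fst q = fst p" "\<bar>snd q - snd p\<bar> \<le> 1" by (auto simp: mem_region_at)
    with pq have "q = shift p Upwards \<or> q = shift p Downwards"
      by (auto simp: prod_eq_iff)
    thus ?thesis by blast
  next
    assume r: "e = vedge r"
    have "lat r \<in> e" "lat (fst r, snd r + 1) \<in> e" by (auto simp: r vedge_def)
    with sub have "lat r \<in> region_at p" "lat (fst r, snd r + 1) \<in> region_at p"
      "lat r \<in> region_at q" "lat (fst r, snd r + 1) \<in> region_at q" by auto
    hence "snd q = snd p" "\<bar>fst q - fst p\<bar> \<le> 1" by (auto simp: mem_region_at)
    with pq have "q = shift p Rightwards \<or> q = shift p Leftwards"
      by (auto simp: prod_eq_iff)
    thus ?thesis by blast
  qed
qed

lemma shift_imp_dual_adj:
  assumes "i \<in> {1..num_squares w}" "j \<in> {1..num_squares w}" "pos w j = shift (pos w i) d"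
  shows "inner_dual_adj (graph_of w) (cell w i) (cell w j)"
proof -
  let ?e = "shared_edge (pos w i) d"
  have "?e \<in> graph_of w" using shared_edge_sides(1)[of "pos w i" d] assms by (auto simp: graph_of_eq)
  moreover have "convex hull ?e \<subseteq> frontier (cell w i)" "convex hull ?e \<subseteq> frontier (cell w j)"
    unfolding cell_eq frontier_cell region_diff_cell assms(3)
    using shared_edge_sides[of "pos w i" d] by blast+
  ultimately show ?thesis
    unfolding inner_dual_adj_def using assms by (auto simp: cell_eq cell_at_eq_iff shift_neq)
qed

lemma self_avoiding_no_reversal:
  assumes "self_avoiding w" "1 \<le> i" "i + 2 \<le> num_squares w"
  shows "w ! i \<noteq> opp (w ! (i - 1))"
proof
  assume "w ! i = opp (w ! (i - 1))"
  moreover have "pos w (i + 2) = shift (shift (pos w i) (w ! (i - 1))) (w ! i)"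
    using pos_Suc_shift[of i w] pos_Suc_shift[of "Suc i" w] assms by simp
  ultimately have "pos w i = pos w (i + 2)" by (simp add: shift_def)
  thus False using self_avoiding_pos_neq[OF assms(1,2), of "i + 2"] assms by simp
qed

lemma self_avoiding_apart:
  assumes "self_avoiding w" "1 \<le> i" "i + 3 \<le> j" "j \<le> num_squares w"
  shows "apart (pos w i) (pos w j)"
  using assms unfolding self_avoiding_iff_pos by blast

text \<open>A new square touches the chain so far only inside the square before it. The contact is
  therefore convex, which is what the induction over the squares uses.\<close>

lemma region_inter_subset:
  assumes "self_avoiding w" "1 \<le> i" "i \<le> k" "k < num_squares w"
  shows "region_at (pos w i) \<inter> region_at (pos w (Suc k)) \<subseteq> region_at (pos w k)"
proof -
  consider "i = k" | "Suc i = k" | "i + 3 \<le> Suc k" using assms by linarith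
  thus ?thesis
  proof cases
    case 2
    thus ?thesis
      using two_steps(1)[OF self_avoiding_no_reversal[of w i], of "pos w i"] assms
        pos_Suc_shift[of i w] pos_Suc_shift[of k w] by (simp flip: 2)
  next
    case 3
    hence "apart (pos w i) (pos w (Suc k))"
      using self_avoiding_apart[of w i "Suc k"] assms by simp
    thus ?thesis using region_apart by blast
  qed simp
qed

text \<open>Janiszewski's theorem: if a compact and a closed set do not separate the plane and their
  intersection is connected, their union does not separate it either. Here the intersection is that
  of two convex squares.\<close>

lemma connected_outside:
  assumes "self_avoiding w" "1 \<le> k" "k \<le> num_squares w"
  shows "connected (- (\<Union>i\<in>{1..k}. region_at (pos w i)))"
  using assms(2,3)
proof (induction k rule: dec_induct)
  case base
  show ?case
    by (simp add: connected_complement_bounded_convex compact_imp_bounded[OF compact_region]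
        convex_region)
next
  case (step k)
  let ?S = "\<Union>i\<in>{1..k}. region_at (pos w i)" and ?T = "region_at (pos w (Suc k))"
  have eq: "?S \<inter> ?T = region_at (pos w k) \<inter> ?T"
  proof
    show "?S \<inter> ?T \<subseteq> region_at (pos w k) \<inter> ?T"
      using region_inter_subset[OF assms(1), of _ k] step.prems by fastforce
    show "region_at (pos w k) \<inter> ?T \<subseteq> ?S \<inter> ?T"
      using step.hyps by auto
  qed
  have "connected (- (?S \<union> ?T))"
  proof (rule Janiszewski_connected)
    show "compact ?S" by (intro compact_UN) (auto simp: compact_region)
    show "closed ?T" by (simp add: compact_imp_closed compact_region)
    show "connected (?S \<inter> ?T)" unfolding eq by (intro convex_connected convex_Int convex_region)
    show "connected (- ?S)" using step by simp
    show "connected (- ?T)"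
      by (simp add: connected_complement_bounded_convex compact_imp_bounded[OF compact_region]
          convex_region)
  qed
  moreover have "?S \<union> ?T = (\<Union>i\<in>{1..Suc k}. region_at (pos w i))"
    by (auto simp: atLeastAtMostSuc_conv)
  ultimately show ?case by (simp only:)
qed

section \<open>Two-connectedness of the graph of a chain\<close>

lemma connected_within_mono:
  assumes "(u, v) \<in> {(x, y). x \<in> W \<and> y \<in> W \<and> {x, y} \<in> E}\<^sup>*" "W \<subseteq> W'" "E \<subseteq> E'"
  shows "(u, v) \<in> {(x, y). x \<in> W' \<and> y \<in> W' \<and> {x, y} \<in> E'}\<^sup>*"
  by (rule subsetD[OF rtrancl_mono assms(1)]) (use assms in auto)

lemma connected_within_Un:
  assumes "connected_within E A" "connected_within E B" "A \<inter> B \<noteq> {}"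
  shows "connected_within E (A \<union> B)"
proof -
  let ?R = "{(x, y). x \<in> A \<union> B \<and> y \<in> A \<union> B \<and> {x, y} \<in> E}"
  obtain z where z: "z \<in> A" "z \<in> B" using assms by auto
  have "(u, z) \<in> ?R\<^sup>*" "(z, u) \<in> ?R\<^sup>*" if "u \<in> A \<union> B" for u
    using that z assms(1,2)[unfolded connected_within_def]
      connected_within_mono[of _ _ A E "A \<union> B" E] connected_within_mono[of _ _ B E "A \<union> B" E]
    by blast+
  thus ?thesis unfolding connected_within_def by (meson rtrancl_trans)
qed

lemma connected_within_edge: "{u, v} \<in> E \<Longrightarrow> connected_within E {u, v}"
  by (auto simp: connected_within_def insert_commute intro!: r_into_rtrancl)

lemma connected_within_path:
  assumes "{u, v} \<in> E" "{v, t} \<in> E"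
  shows "connected_within E {u, v, t}"
  using connected_within_Un[OF assms[THEN connected_within_edge]]
  by (simp add: insert_commute)

lemma connected_within_square:
  assumes "sides_at p \<subseteq> E"
  shows "connected_within E (corners_at p - {x})"
proof -
  let ?a = "lat p" and ?b = "lat (fst p + 1, snd p)" and ?c = "lat (fst p + 1, snd p + 1)"
    and ?d = "lat (fst p, snd p + 1)"
  have corners: "corners_at p = {?a, ?b, ?c, ?d}"
    by (auto simp: corners_at_def)
  have neq: "?a \<noteq> ?b" "?a \<noteq> ?c" "?a \<noteq> ?d" "?b \<noteq> ?c" "?b \<noteq> ?d" "?c \<noteq> ?d"
    by (simp_all add: prod_eq_iff)
  have E: "{?a, ?b} \<in> E" "{?b, ?a} \<in> E" "{?b, ?c} \<in> E" "{?c, ?b} \<in> E" "{?c, ?d} \<in> E"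
    "{?d, ?c} \<in> E" "{?a, ?d} \<in> E" "{?d, ?a} \<in> E"
    using assms by (auto simp: sides_at_def hedge_def vedge_def insert_commute)
  consider "x = ?a" | "x = ?b" | "x = ?c" | "x = ?d" | "x \<notin> corners_at p"
    unfolding corners by blast
  thus ?thesis
  proof cases
    case 1
    hence "corners_at p - {x} = {?b, ?c, ?d}" using neq unfolding corners by auto
    thus ?thesis using connected_within_path[OF E(3,5)] by simp
  next
    case 2
    hence "corners_at p - {x} = {?c, ?d, ?a}" using neq unfolding corners by auto
    thus ?thesis using connected_within_path[OF E(5,8)] by simp
  next
    case 3
    hence "corners_at p - {x} = {?d, ?a, ?b}" using neq unfolding corners by auto
    thus ?thesis using connected_within_path[OF E(8,1)] by simp
  next
    case 4
    hence "corners_at p - {x} = {?a, ?b, ?c}" using neq unfolding corners by auto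
    thus ?thesis using connected_within_path[OF E(1,3)] by simp
  next
    case 5
    hence "corners_at p - {x} = {?a, ?b, ?c} \<union> {?c, ?d}" unfolding corners by blast
    thus ?thesis
      using connected_within_Un[OF connected_within_path[OF E(1,3)] connected_within_edge[OF E(5)]]
      by simp
  qed
qed

lemma Union_sides_at: "\<Union> (sides_at p) = corners_at p"
  by (auto simp: sides_at_def mem_corners_at mem_hedge mem_vedge)

lemma vertices_eq: "\<Union> (graph_of w) = (\<Union>i\<in>{1..num_squares w}. corners_at (pos w i))"
  by (auto simp: graph_of_eq Union_sides_at[symmetric])

lemma sides_subset_graph_of: "1 \<le> i \<Longrightarrow> i \<le> num_squares w \<Longrightarrow> sides_at (pos w i) \<subseteq> graph_of w"
  unfolding graph_of_eq by (intro Union_upper imageI) simp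

text \<open>Consecutive squares have two common vertices, so one of them survives the removal of
  \<open>x\<close> and still joins the two parts.\<close>

lemma connected_within_chain:
  assumes "1 \<le> k" "k \<le> num_squares w"
  shows "connected_within (graph_of w) ((\<Union>i\<in>{1..k}. corners_at (pos w i)) - {x})"
  using assms
proof (induction k rule: dec_induct)
  case base
  have "sides_at (pos w 1) \<subseteq> graph_of w" using sides_subset_graph_of[of 1] assms by simp
  from connected_within_square[OF this, of x] show ?case by simp
next
  case (step k)
  let ?A = "(\<Union>i\<in>{1..k}. corners_at (pos w i)) - {x}" and ?B = "corners_at (pos w (Suc k)) - {x}"
  have "connected_within (graph_of w) ?B"
    using step by (intro connected_within_square sides_subset_graph_of) simp_all
  moreover have "?A \<inter> ?B \<noteq> {}"
  proof -
    let ?e = "shared_edge (pos w k) (w ! (k - 1))"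
    have sub: "?e \<subseteq> corners_at (pos w k) \<inter> corners_at (pos w (Suc k))"
      using pos_Suc_shift[of k w] step corners_shift by simp
    have "card ?e = 2"
      using shared_edge_sides(1) unit_edge_sides card_unit_edge by blast
    hence "\<not> ?e \<subseteq> {x}" using card_mono[of "{x}" ?e] by auto
    then obtain z where "z \<in> ?e" "z \<noteq> x" by auto
    moreover have "k \<in> {1..k}" using step.hyps by simp
    ultimately show ?thesis
      using sub by blast
  qed
  ultimately have "connected_within (graph_of w) (?A \<union> ?B)"
    using step by (intro connected_within_Un) auto
  moreover have "?A \<union> ?B = (\<Union>i\<in>{1..Suc k}. corners_at (pos w i)) - {x}"
    by (auto simp: atLeastAtMostSuc_conv)
  ultimately show ?case by simp
qed

lemma card_corners_at: "card (corners_at p) = 4"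
proof -
  have "card ({fst p, fst p + 1} \<times> {snd p, snd p + 1}) = 4"
    by (simp only: card_cartesian_product) simp
  thus ?thesis unfolding corners_at_def by (subst card_image) (auto simp: inj_on_def)
qed

lemma finite_graph_of [simp]: "finite (graph_of w)"
  by (simp add: graph_of_eq)

lemma unit_edge_graph_of: "e \<in> graph_of w \<Longrightarrow> unit_edge e"
  using unit_edge_sides unfolding graph_of_eq by blast

lemma interior_faces_graph_of:
  "interior_faces (graph_of w) = cell w ` {1..num_squares w} \<longleftrightarrow>
     connected (- (\<Union>i\<in>{1..num_squares w}. region_at (pos w i)))"
  using faces_of_squares[of "pos w ` {1..num_squares w}"]
  by (simp add: graph_of_eq cell_eq image_image)

text \<open>Parity excludes neighbours two places apart, and disjointness excludes those further
  apart.\<close>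

lemma self_avoiding_adjacent:
  assumes sa: "self_avoiding w" and ij: "1 \<le> i" "i < j" "j \<le> num_squares w"
    and d: "pos w j = shift (pos w i) d"
  shows "j = i + 1"
proof -
  have "j \<noteq> i + 2"
  proof
    assume j: "j = i + 2"
    have "pos w j = shift (shift (pos w i) (w ! (i - 1))) (w ! i)"
      using pos_Suc_shift[of i w] pos_Suc_shift[of "Suc i" w] ij j by simp
    moreover have "w ! i \<noteq> opp (w ! (i - 1))"
      using self_avoiding_no_reversal[OF sa] ij j by simp
    ultimately show False using two_steps(2) d by metis
  qed
  moreover have "\<not> apart (pos w i) (pos w j)"
    unfolding d by (cases d) (auto simp: apart_def)
  hence "\<not> i + 3 \<le> j" using self_avoiding_apart[OF sa ij(1) _ ij(3)] by blast
  ultimately show "j = i + 1" using ij by linarith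
qed

lemma self_avoiding_imp_chain:
  assumes sa: "self_avoiding w" and "w \<noteq> []" "hd w = Rightwards"
  shows "general_polyomino_chain w"
proof -
  let ?n = "num_squares w" and ?E = "graph_of w"
  have n: "1 \<le> ?n" by (simp add: num_squares_def)
  have faces: "interior_faces ?E = cell w ` {1..?n}"
    unfolding interior_faces_graph_of using connected_outside[OF sa n] by simp
  have plane: "plane_graph ?E"
    unfolding plane_graph_def using hull_unit_edges unit_edge_graph_of card_unit_edge by auto
  have two: "two_connected ?E"
    unfolding two_connected_def
  proof (intro conjI ballI)
    have "corners_at (pos w 1) \<subseteq> \<Union> ?E" using n by (auto simp: vertices_eq)
    moreover have "finite (\<Union> ?E)" by (simp add: vertices_eq)
    ultimately show "3 \<le> card (\<Union> ?E)"
      using card_mono[of "\<Union> ?E" "corners_at (pos w 1)"] by (simp add: card_corners_at)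
    show con: "connected_within ?E (\<Union> ?E - {x})" for x
      using connected_within_chain[OF n order_refl] by (simp add: vertices_eq)
    \<comment> \<open>Removing a point off the graph removes nothing, which gives connectedness of
      the whole graph.\<close>
    obtain x where "x \<notin> \<Union> ?E"
      using ex_new_if_finite[OF infinite_UNIV_char_0 \<open>finite (\<Union> ?E)\<close>] by blast
    thus "connected_within ?E (\<Union> ?E)" using con[of x] by simp
  qed
  have square: "\<exists>z u. cmod u = 1 \<and> F = open_square z u" if F: "F \<in> interior_faces ?E" for F
  proof -
    obtain i where i: "F = cell w i" using F unfolding faces by blast
    show ?thesis by (intro exI[of _ "square_pos w i"] exI[of _ 1]) (simp add: i cell_def)
  qed
  have inj: "inj_on (cell w) {1..?n}"
  proof (rule inj_onI)
    fix i j assume "i \<in> {1..?n}" "j \<in> {1..?n}" "cell w i = cell w j"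
    thus "i = j"
      using self_avoiding_pos_neq[OF sa, of i j] self_avoiding_pos_neq[OF sa, of j i]
      by (simp add: cell_eq cell_at_eq_iff) (metis linorder_neqE_nat)
  qed
  have adj: "inner_dual_adj ?E (cell w i) (cell w j) \<longleftrightarrow> j = i + 1"
    if ij: "1 \<le> i" "i < j" "j \<le> ?n" for i j
  proof
    assume adj: "inner_dual_adj ?E (cell w i) (cell w j)"
    have "\<exists>d. pos w j = shift (pos w i) d"
      by (rule dual_adj_imp_shift[of ?E]) (fact unit_edge_graph_of, fact adj[unfolded cell_eq])
    then obtain d where d: "pos w j = shift (pos w i) d" ..
    show "j = i + 1" using self_avoiding_adjacent[OF sa ij d] .
  next
    assume "j = i + 1"
    thus "inner_dual_adj ?E (cell w i) (cell w j)"
      using shift_imp_dual_adj[of i w j] ij pos_Suc_shift[of i w] by simp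
  qed
  have adj': "inner_dual_adj ?E (cell w i) (cell w j) \<longleftrightarrow> i = j + 1 \<or> j = i + 1"
    if "i \<in> {1..?n}" "j \<in> {1..?n}" for i j
  proof -
    have comm: "inner_dual_adj ?E (cell w i) (cell w j) \<longleftrightarrow> inner_dual_adj ?E (cell w j) (cell w i)"
      unfolding inner_dual_adj_def by (metis Int_commute)
    consider "i < j" | "j < i" | "i = j" by linarith
    thus ?thesis
    proof cases
      case 1
      thus ?thesis using adj[of i j] that by simp
    next
      case 2
      thus ?thesis using adj[of j i] that comm by simp
    next
      case 3
      thus ?thesis by (simp add: inner_dual_adj_def)
    qed
  qed
  have "polyomino_system ?E"
    unfolding polyomino_system_def using plane two square by blast
  moreover have "bij_betw (cell w) {1..?n} (interior_faces ?E)"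
    unfolding bij_betw_def using inj faces by simp
  ultimately show ?thesis
    unfolding general_polyomino_chain_def using assms(2,3) adj' by blast
qed

section \<open>From faces of the drawing back to disjoint squares\<close>

lemma four_squares_at_vertex:
  assumes "lat u \<in> region_at p" "lat u \<in> region_at (shift p d)"
    "lat u \<in> region_at (shift (shift p d) d')" "lat u \<in> region_at (shift (shift (shift p d) d') d'')"
    "shift (shift p d) d' \<noteq> p" "shift (shift (shift p d) d') d'' \<noteq> shift p d"
  shows "shift (shift (shift p d) d') d'' = shift p d'"
  using assms by (cases d; cases d'; cases d'') (simp_all add: mem_region_at prod_eq_iff)

lemma regions_Suc_meet:
  assumes "1 \<le> k" "k < num_squares w"
  shows "region_at (pos w k) \<inter> region_at (pos w (Suc k)) \<noteq> {}"
proof -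
  let ?e = "shared_edge (pos w k) (w ! (k - 1))"
  have "?e \<subseteq> corners_at (pos w k) \<inter> corners_at (pos w (Suc k))"
    using pos_Suc_shift[of k w] assms corners_shift by simp
  moreover have "?e \<noteq> {}" by (cases "w ! (k - 1)") (simp_all add: hedge_def vedge_def)
  ultimately show ?thesis using corners_subset_region by blast
qed

lemma connected_regions:
  assumes "1 \<le> a" "a \<le> b" "b \<le> num_squares w"
  shows "connected (\<Union>i\<in>{a..b}. region_at (pos w i))"
  using assms(2,3)
proof (induction b rule: dec_induct)
  case base
  show ?case by (simp add: convex_connected convex_region)
next
  case (step k)
  have "connected ((\<Union>i\<in>{a..k}. region_at (pos w i)) \<union> region_at (pos w (Suc k)))"
  proof (rule connected_Un)
    show "(\<Union>i\<in>{a..k}. region_at (pos w i)) \<inter> region_at (pos w (Suc k)) \<noteq> {}"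
      using regions_Suc_meet[of k w] step assms(1) by fastforce
  qed (use step in \<open>auto simp: convex_connected convex_region\<close>)
  moreover have "(\<Union>i\<in>{a..k}. region_at (pos w i)) \<union> region_at (pos w (Suc k)) =
      (\<Union>i\<in>{a..Suc k}. region_at (pos w i))"
    using step.hyps by (auto simp: atLeastAtMostSuc_conv)
  ultimately show ?case by (simp only:)
qed

text \<open>
  Two squares that touch only in a vertex \<open>v\<close>, at positions \<open>i < j\<close>, would enclose a hole: cutting
  the chain between \<open>a\<close> and \<open>a + 1\<close> gives two continua whose union does not separate the plane, so
  their intersection is connected, and \<open>v\<close> must lie on the edge shared by squares \<open>a\<close> and \<open>a + 1\<close>.
\<close>

lemma chain_imp_self_avoiding:
  assumes chain: "general_polyomino_chain w"
  shows "self_avoiding w"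
proof -
  let ?n = "num_squares w" and ?R = "\<lambda>i. region_at (pos w i)"
  have bij: "bij_betw (cell w) {1..?n} (interior_faces (graph_of w))"
    and dual: "\<And>i j. i \<in> {1..?n} \<Longrightarrow> j \<in> {1..?n} \<Longrightarrow>
      inner_dual_adj (graph_of w) (cell w i) (cell w j) \<Longrightarrow> i = j + 1 \<or> j = i + 1"
    using chain by (auto simp: general_polyomino_chain_def)
  have inj: "pos w i \<noteq> pos w j" if "1 \<le> i" "i < j" "j \<le> ?n" for i j
    using that bij_betw_imp_inj_on[OF bij] unfolding inj_on_def cell_eq cell_at_eq_iff by fastforce
  have adj: "j = i + 1" if "1 \<le> i" "i < j" "j \<le> ?n" "pos w j = shift (pos w i) d" for i j d
  proof -
    have "i \<in> {1..?n}" "j \<in> {1..?n}" using that by auto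
    from dual[OF this shift_imp_dual_adj[OF this that(4)]] show ?thesis using that by linarith
  qed
  have "interior_faces (graph_of w) = cell w ` {1..?n}" using bij by (simp add: bij_betw_def)
  hence out: "connected (- (\<Union>i\<in>{1..?n}. ?R i))" by (simp only: interior_faces_graph_of)
  have inter: "v \<in> ?R a \<inter> ?R (Suc a)"
    if ij: "1 \<le> i" "i \<le> a" "a < j" "j \<le> ?n" "v \<in> ?R i" "v \<in> ?R j" for i j a v
  proof (rule ccontr)
    assume nv: "v \<notin> ?R a \<inter> ?R (Suc a)"
    let ?S = "\<Union>i\<in>{1..a}. ?R i" and ?T = "\<Union>i\<in>{Suc a..?n}. ?R i"
    let ?F = "?S \<inter> ?T - ?R a \<inter> ?R (Suc a)"
    have con: "connected (?S \<inter> ?T)"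
    proof (rule Janiszewski_dual)
      show "compact ?S" "compact ?T" by (intro compact_UN; simp add: compact_region)+
      show "connected ?S" using connected_regions[of 1 a w] ij by simp
      show "connected ?T" using connected_regions[of "Suc a" ?n w] ij by simp
      have "{1..?n} = {1..a} \<union> {Suc a..?n}" using ij by auto
      hence "?S \<union> ?T = (\<Union>i\<in>{1..?n}. ?R i)" by (simp only: UN_Un)
      thus "connected (- (?S \<union> ?T))" using out by (simp only:)
    qed
    \<comment> \<open>Squares on different sides of the cut, other than the two next to it, meet at
      most in a corner: a common edge would make them adjacent in the dual path. So outside the edge
      at the cut the intersection is a finite closed set containing \<open>v\<close>, which a
      connected set cannot split off.\<close>
    have fin: "finite (?R i' \<inter> ?R j' - ?R a \<inter> ?R (Suc a))"
      if "i' \<in> {1..a}" "j' \<in> {Suc a..?n}" for i' j'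
    proof -
      have lt: "1 \<le> i'" "i' < j'" "j' \<le> ?n" using that by auto
      show ?thesis
      proof (rule lattice_square_cases[of "pos w i'" "pos w j'"])
        fix d assume "pos w j' = shift (pos w i') d"
        hence "i' = a" "j' = Suc a" using adj[OF lt] that by auto
        thus ?thesis by simp
      next
        assume "\<bar>fst (pos w j') - fst (pos w i')\<bar> = 1" "\<bar>snd (pos w j') - snd (pos w i')\<bar> = 1"
        then obtain u where "?R i' \<inter> ?R j' = {lat u}" using region_diagonal by metis
        thus ?thesis by simp
      next
        assume "apart (pos w i') (pos w j')"
        thus ?thesis using region_apart by simp
      qed (use inj[OF lt] in simp)
    qed
    have "?F = (\<Union>i'\<in>{1..a}. \<Union>j'\<in>{Suc a..?n}. ?R i' \<inter> ?R j' - ?R a \<inter> ?R (Suc a))"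
      by blast
    hence "finite ?F" using fin by (simp only:) (intro finite_UN_I; simp)
    hence "closed ?F" by (rule finite_imp_closed)
    moreover have "closed (?R a \<inter> ?R (Suc a))"
      by (simp add: closed_Int compact_imp_closed compact_region)
    moreover have "v \<in> ?F" using ij nv by auto
    moreover have "?R a \<inter> ?R (Suc a) \<subseteq> ?S \<inter> ?T" using ij by fastforce
    moreover have "?R a \<inter> ?R (Suc a) \<noteq> {}" using regions_Suc_meet[of a w] ij by simp
    ultimately show False
      using con[unfolded connected_closed] by blast
  qed
  have apart: "apart (pos w i) (pos w j)" if ij: "1 \<le> i" "i + 3 \<le> j" "j \<le> ?n" for i j
  proof (rule lattice_square_cases[of "pos w i" "pos w j"])
    assume "\<bar>fst (pos w j) - fst (pos w i)\<bar> = 1" "\<bar>snd (pos w j) - snd (pos w i)\<bar> = 1"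
    then obtain u where u: "?R i \<inter> ?R j = {lat u}" using region_diagonal by metis
    let ?p = "pos w i" and ?d = "w ! (i - 1)" and ?d' = "w ! i" and ?d'' = "w ! Suc i"
    have eqs: "pos w (Suc i) = shift ?p ?d" "pos w (Suc (Suc i)) = shift (shift ?p ?d) ?d'"
      "pos w (Suc (Suc (Suc i))) = shift (shift (shift ?p ?d) ?d') ?d''"
      using pos_Suc_shift[of i w] pos_Suc_shift[of "Suc i" w] pos_Suc_shift[of "Suc (Suc i)" w] ij
      by simp_all
    \<comment> \<open>The corner lies on every cut between \<open>i\<close> and \<open>j\<close>.
      The squares \<open>i\<close> to \<open>i + 3\<close> thus wind once round it, and the fourth
      of them borders the first.\<close>
    have "lat u \<in> ?R a \<inter> ?R (Suc a)" if "i \<le> a" "a < j" for a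
      using inter[of i a j "lat u"] that ij u by blast
    from this[of i] this[of "Suc i"] this[of "Suc (Suc i)"]
    have "pos w (Suc (Suc (Suc i))) = shift ?p ?d'"
      unfolding eqs using ij inj[of i "Suc (Suc i)"] inj[of "Suc i" "Suc (Suc (Suc i))"]
      by (intro four_squares_at_vertex[of u]) (auto simp: eqs)
    from adj[OF _ _ _ this] ij have False by simp
    thus ?thesis ..
  qed (use ij inj[of i j] adj[of i j] in auto)
  show ?thesis
    unfolding self_avoiding_iff_pos using inj apart by simp
qed

lemma general_polyomino_chain_iff:
  "general_polyomino_chain w \<longleftrightarrow> w \<noteq> [] \<and> hd w = Rightwards \<and> self_avoiding w"
proof
  assume chain: "general_polyomino_chain w"
  note def = chain[unfolded general_polyomino_chain_def]
  have "w \<noteq> []" "hd w = Rightwards"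
    by (rule conjunct1[OF def], rule conjunct1[OF conjunct2[OF def]])
  with chain_imp_self_avoiding[OF chain]
  show "w \<noteq> [] \<and> hd w = Rightwards \<and> self_avoiding w" by simp
qed (blast intro: self_avoiding_imp_chain)

section \<open>The index as a sum of local contributions\<close>

definition shared :: "chain_word \<Rightarrow> nat \<Rightarrow> complex set" where
  "shared w i = shared_edge (pos w i) (w ! (i - 1))"

lemma corners_Int_Suc:
  assumes "1 \<le> i" "i < num_squares w"
  shows "corners_at (pos w i) \<inter> corners_at (pos w (Suc i)) = shared w i"
  using pos_Suc_shift[OF assms] corners_shift by (simp add: shared_def)

lemma card_side: "e \<in> sides_at p \<Longrightarrow> card e = 2"
  using unit_edge_sides card_unit_edge by blast

lemma card_shared: "card (shared w i) = 2"
  unfolding shared_def using shared_edge_sides(1) by (rule card_side)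

text \<open>A side has two vertices, whereas squares in diagonal position have only one in common
  and squares that are apart have none.\<close>

lemma common_side_imp_shift:
  assumes "e \<in> sides_at p" "e \<in> sides_at q" "p \<noteq> q"
  obtains d where "q = shift p d"
proof (rule lattice_square_cases[of p q])
  have sub: "e \<subseteq> corners_at p \<inter> corners_at q" using assms side_subset_corners by blast
  have card: "card e \<le> card (corners_at p \<inter> corners_at q)" using sub by (intro card_mono) auto
  {
    assume "\<bar>fst q - fst p\<bar> = 1" "\<bar>snd q - snd p\<bar> = 1"
    then obtain v where "corners_at p \<inter> corners_at q = {lat v}" using region_diagonal by metis
    thus thesis using card card_side[OF assms(1)] by simp
  next
    assume "apart p q"
    thus thesis using card card_side[OF assms(1)] corners_apart by simp
  }
qed (use assms that in auto)

lemma sides_Int: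
  assumes sa: "self_avoiding w" and k: "1 \<le> k" "k < num_squares w"
  shows "(\<Union>i\<in>{1..k}. sides_at (pos w i)) \<inter> sides_at (pos w (Suc k)) = {shared w k}"
proof (intro equalityI subsetI)
  fix e assume e: "e \<in> (\<Union>i\<in>{1..k}. sides_at (pos w i)) \<inter> sides_at (pos w (Suc k))"
  then obtain i where i: "1 \<le> i" "i \<le> k" and ei: "e \<in> sides_at (pos w i)"
    and ek: "e \<in> sides_at (pos w (Suc k))" by auto
  have "pos w i \<noteq> pos w (Suc k)" using self_avoiding_pos_neq[OF sa, of i "Suc k"] i k by simp
  then obtain d where "pos w (Suc k) = shift (pos w i) d" using common_side_imp_shift ei ek by metis
  hence "i = k" using self_avoiding_adjacent[OF sa, of i "Suc k" d] i k by simp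
  hence "e \<subseteq> shared w k"
    using corners_Int_Suc[OF k] side_subset_corners ei ek by blast
  hence "e = shared w k"
    using card_side[OF ei] card_shared[of w k]
    by (metis card_subset_eq card.infinite zero_neq_numeral)
  thus "e \<in> {shared w k}" by simp
next
  fix e assume "e \<in> {shared w k}"
  thus "e \<in> (\<Union>i\<in>{1..k}. sides_at (pos w i)) \<inter> sides_at (pos w (Suc k))"
    using k shared_edge_sides[of "pos w k" "w ! (k - 1)"] pos_Suc_shift[OF k]
    by (auto simp: shared_def)
qed

text \<open>A corner of the new square that lies in an earlier one also lies in the closed square
  just before, and a lattice point of a closed square is a corner of it.\<close>

lemma corners_Int:
  assumes sa: "self_avoiding w" and k: "1 \<le> k" "k < num_squares w"
  shows "(\<Union>i\<in>{1..k}. corners_at (pos w i)) \<inter> corners_at (pos w (Suc k)) = shared w k"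
proof -
  have "v \<in> corners_at (pos w k)"
    if i: "1 \<le> i" "i \<le> k" and v: "v \<in> corners_at (pos w i)" "v \<in> corners_at (pos w (Suc k))" for i v
  proof -
    have "v \<in> region_at (pos w k)"
      using region_inter_subset[OF sa i k(2)] v corners_subset_region by blast
    moreover obtain u where "v = lat u"
      using v(1) unfolding corners_at_def by blast
    ultimately show ?thesis by (simp add: lat_mem_region)
  qed
  hence "(\<Union>i\<in>{1..k}. corners_at (pos w i)) \<inter> corners_at (pos w (Suc k)) =
      corners_at (pos w k) \<inter> corners_at (pos w (Suc k))"
    using k by fastforce
  thus ?thesis using corners_Int_Suc[OF k] by simp
qed

text \<open>Inclusion and exclusion for sets glued in a row: each new set meets the union so far in
  \<open>B k\<close>, whose terms would otherwise be counted twice.\<close>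

lemma sum_Union_chain:
  fixes f :: "'a \<Rightarrow> real"
  assumes "\<And>i. finite (A i)" "1 \<le> n"
    and "\<And>k. 1 \<le> k \<Longrightarrow> k < n \<Longrightarrow> (\<Union>i\<in>{1..k}. A i) \<inter> A (Suc k) = B k"
  shows "(\<Sum>x\<in>(\<Union>i\<in>{1..n}. A i). f x) =
     (\<Sum>i=1..n. \<Sum>x\<in>A i. f x) - (\<Sum>i\<in>{1..<n}. \<Sum>x\<in>B i. f x)"
  using assms(2,3)
proof (induction n rule: dec_induct)
  case base
  show ?case by simp
next
  case (step k)
  let ?U = "\<Union>i\<in>{1..k}. A i"
  have eq: "(\<Union>i\<in>{1..Suc k}. A i) = ?U \<union> A (Suc k)" by (auto simp: atLeastAtMostSuc_conv)
  have "sum f (?U \<union> A (Suc k)) = sum f ?U + sum f (A (Suc k)) - sum f (?U \<inter> A (Suc k))"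
    using assms(1) by (intro sum_Un) auto
  also have "sum f ?U = (\<Sum>i=1..k. sum f (A i)) - (\<Sum>i\<in>{1..<k}. sum f (B i))"
    using step by simp
  also have "?U \<inter> A (Suc k) = B k" using step by simp
  finally show ?case unfolding eq using step.hyps by simp
qed

lemma sum_edges:
  fixes f :: "complex set \<Rightarrow> real"
  assumes "self_avoiding w"
  shows "(\<Sum>e\<in>graph_of w. f e) =
     (\<Sum>i=1..num_squares w. \<Sum>e\<in>sides_at (pos w i). f e) - (\<Sum>i\<in>{1..<num_squares w}. f (shared w i))"
proof -
  have "graph_of w = (\<Union>i\<in>{1..num_squares w}. sides_at (pos w i))" by (auto simp: graph_of_eq)
  thus ?thesis
    using sum_Union_chain[of "\<lambda>i. sides_at (pos w i)" "num_squares w" "\<lambda>i. {shared w i}" f]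
      sides_Int[OF assms] by (simp add: num_squares_def)
qed

lemma sum_vertices:
  fixes f :: "complex \<Rightarrow> real"
  assumes "self_avoiding w"
  shows "(\<Sum>v\<in>\<Union> (graph_of w). f v) = (\<Sum>i=1..num_squares w. \<Sum>v\<in>corners_at (pos w i). f v)
     - (\<Sum>i\<in>{1..<num_squares w}. \<Sum>v\<in>shared w i. f v)"
  unfolding vertices_eq
  using sum_Union_chain[of "\<lambda>i. corners_at (pos w i)" "num_squares w" "\<lambda>i. shared w i" f]
    corners_Int[OF assms] by (simp add: num_squares_def)

lemma hedge_neq: "hedge p \<noteq> vedge q" "hedge (a, b) = hedge (a', b') \<longleftrightarrow> a = a' \<and> b = b'"
  "vedge (a, b) = vedge (a', b') \<longleftrightarrow> a = a' \<and> b = b'"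
  by (cases p; cases q; auto simp: hedge_def vedge_def doubleton_eq_iff)+

lemma sum_sides:
  "(\<Sum>e\<in>sides_at (a, b). f e) =
     f (hedge (a, b)) + f (vedge (a + 1, b)) + f (hedge (a, b + 1)) + (f (vedge (a, b)) :: real)"
proof -
  have "hedge (a, b) \<noteq> hedge (a, b + 1)" "vedge (a + 1, b) \<noteq> vedge (a, b)"
    by (simp_all add: hedge_neq)
  thus ?thesis
    unfolding sides_at_def fst_conv snd_conv
    by (subst sum.insert; simp add: hedge_neq hedge_neq(1)[symmetric])+
qed

lemma card_edges:
  assumes "self_avoiding w"
  shows "real (card (graph_of w)) = 3 * real (num_squares w) + 1"
proof -
  have "(\<Sum>e\<in>sides_at p. 1 :: real) = 4" for p by (cases p) (simp add: sum_sides del: sum_constant)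
  thus ?thesis using sum_edges[OF assms, of "\<lambda>_. 1"] by (simp add: num_squares_def)
qed

lemma card_vertices:
  assumes "self_avoiding w"
  shows "real (card (\<Union> (graph_of w))) = 2 * real (num_squares w) + 2"
  using sum_vertices[OF assms, of "\<lambda>_. 1"]
  by (simp add: num_squares_def card_corners_at card_shared)

lemma sum_sides_mem:
  "(\<Sum>e\<in>sides_at p. of_bool (v \<in> e)) = (2 * of_bool (v \<in> corners_at p) :: real)"
proof (cases "v \<in> corners_at p")
  case True
  obtain a b where p: "p = (a, b)" by force
  have "v = lat (a, b) \<or> v = lat (a + 1, b) \<or> v = lat (a, b + 1) \<or> v = lat (a + 1, b + 1)"
    using True by (simp add: p mem_corners_at complex_eq_iff) blast
  thus ?thesis unfolding p
    by (elim disjE) (simp_all add: sum_sides mem_hedge mem_vedge mem_corners_at)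
next
  case False
  hence "v \<notin> e" if "e \<in> sides_at p" for e using that side_subset_corners by blast
  thus ?thesis using False by simp
qed

text \<open>Each square at \<open>v\<close> contributes two edges, and each shared edge at
  \<open>v\<close> has then been counted twice.\<close>

lemma vertex_degree_eq:
  assumes "self_avoiding w"
  shows "real (vertex_degree (graph_of w) v) =
     2 * (\<Sum>i=1..num_squares w. of_bool (v \<in> corners_at (pos w i))) -
     (\<Sum>i\<in>{1..<num_squares w}. of_bool (v \<in> shared w i))"
proof -
  have "real (vertex_degree (graph_of w) v) = (\<Sum>e\<in>graph_of w. of_bool (v \<in> e))"
    by (simp add: vertex_degree_def of_bool_def sum.If_cases Int_def)
  also have "\<dots> = (\<Sum>i=1..num_squares w. \<Sum>e\<in>sides_at (pos w i). of_bool (v \<in> e))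
      - (\<Sum>i\<in>{1..<num_squares w}. of_bool (v \<in> shared w i))"
    by (rule sum_edges[OF assms])
  finally show ?thesis by (simp add: sum_sides_mem sum_distrib_left)
qed

definition defect :: "chain_word \<Rightarrow> complex \<Rightarrow> real" where
  "defect w v = 12 / real (vertex_degree (graph_of w) v) - 4"

lemma vertex_degree_pos:
  assumes "v \<in> \<Union> (graph_of w)"
  shows "vertex_degree (graph_of w) v > 0"
  using assms by (auto simp: vertex_degree_def card_gt_0_iff)

text \<open>
  Since \<open>1 / d = (defect + 4) / 12\<close>, the product over an edge is a constant plus a term linear in
  the defects, whose sum over all edges depends only on the number of squares, plus the product of
  the two defects. The defect is \<open>2\<close>, \<open>0\<close>, \<open>-1\<close> for degree \<open>2\<close>, \<open>3\<close>, \<open>4\<close>.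
\<close>

lemma R_chain_eq:
  assumes sa: "self_avoiding w"
  shows "R_chain w = real (num_squares w) / 3 + 5 / 9 +
    (\<Sum>e\<in>graph_of w. \<Prod>v\<in>e. defect w v) / 144"
proof -
  let ?E = "graph_of w" and ?d = "\<lambda>v. real (vertex_degree (graph_of w) v)"
  have e: "1 / (\<Prod>v\<in>e. ?d v) =
      (16 + 4 * (\<Sum>v\<in>e. defect w v) + (\<Prod>v\<in>e. defect w v)) / 144" if e: "e \<in> ?E" for e
  proof -
    obtain x y where xy: "e = {x, y}" "x \<noteq> y"
      using card_unit_edge[OF unit_edge_graph_of[OF e]] by (auto simp: card_2_iff)
    have "?d x \<noteq> 0" "?d y \<noteq> 0"
      using e xy vertex_degree_pos[of x w] vertex_degree_pos[of y w] by auto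
    thus ?thesis using xy by (simp add: defect_def field_simps)
  qed
  have fin: "finite (\<Union> ?E)" by (simp add: vertices_eq)
  have "(\<Sum>e\<in>?E. \<Sum>v\<in>e. defect w v) = (\<Sum>e\<in>?E. \<Sum>v\<in>\<Union> ?E. of_bool (v \<in> e) * defect w v)"
  proof (rule sum.cong[OF refl])
    fix e assume "e \<in> ?E"
    hence "\<Union> ?E \<inter> {v. v \<in> e} = e" by auto
    thus "(\<Sum>v\<in>e. defect w v) = (\<Sum>v\<in>\<Union> ?E. of_bool (v \<in> e) * defect w v)"
      using fin by (simp add: of_bool_def if_distrib[of "\<lambda>x. x * _"] sum.If_cases cong: if_cong)
  qed
  also have "\<dots> = (\<Sum>v\<in>\<Union> ?E. ?d v * defect w v)"
    by (subst sum.swap)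
      (simp add: vertex_degree_def of_bool_def sum.If_cases Int_def flip: sum_distrib_right)
  also have "\<dots> = (\<Sum>v\<in>\<Union> ?E. 12 - 4 * ?d v)"
    by (rule sum.cong[OF refl]) (use vertex_degree_pos[of _ w] in \<open>fastforce simp: defect_def field_simps\<close>)
  also have "\<dots> = 12 * real (card (\<Union> ?E)) - 4 * (\<Sum>v\<in>\<Union> ?E. ?d v)"
    by (simp add: sum_subtractf sum_distrib_left)
  also have "(\<Sum>v\<in>\<Union> ?E. ?d v) = (\<Sum>e\<in>?E. \<Sum>v\<in>\<Union> ?E. of_bool (v \<in> e))"
    by (subst sum.swap) (simp add: vertex_degree_def of_bool_def sum.If_cases Int_def)
  also have "\<dots> = (\<Sum>e\<in>?E. 2)"
  proof (rule sum.cong[OF refl])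
    fix e assume e: "e \<in> ?E"
    hence "\<Union> ?E \<inter> {v. v \<in> e} = e" by auto
    thus "(\<Sum>v\<in>\<Union> ?E. of_bool (v \<in> e)) = (2 :: real)"
      using fin card_unit_edge[OF unit_edge_graph_of[OF e]] by (simp add: of_bool_def sum.If_cases)
  qed
  \<comment> \<open>With \<open>n\<close> squares this is
    \<open>12 * (2 * n + 2) - 8 * (3 * n + 1)\<close>, in which \<open>n\<close> cancels.\<close>
  finally have lin: "(\<Sum>e\<in>?E. \<Sum>v\<in>e. defect w v) = 16"
    using card_edges[OF sa] card_vertices[OF sa] by simp
  have "R_chain w =
      (\<Sum>e\<in>?E. (16 + 4 * (\<Sum>v\<in>e. defect w v) + (\<Prod>v\<in>e. defect w v)) / 144)"
    unfolding R_chain_def R_minus_1_def by (rule sum.cong[OF refl e])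
  also have "\<dots> = (16 * real (card ?E) + 4 * (\<Sum>e\<in>?E. \<Sum>v\<in>e. defect w v) +
      (\<Sum>e\<in>?E. \<Prod>v\<in>e. defect w v)) / 144"
    by (simp add: sum_divide_distrib[symmetric] sum.distrib sum_distrib_left)
  finally show ?thesis unfolding lin card_edges[OF sa] by (simp add: field_simps)
qed

text \<open>
  A square is placed at the origin; \<open>a\<close>, \<open>b\<close> are the letters that lead to the square before it and to
  itself, and \<open>c\<close>, \<open>d\<close> those that lead to the next two squares (\<open>None\<close> beyond the ends of the
  chain). Only these four squares can contribute to the degree of a corner \<open>r\<close> of the square.
\<close>

definition rel_corner :: "int \<times> int \<Rightarrow> orientation list \<Rightarrow> int" where
  "rel_corner r ds = (let p = foldl shift (0, 0) ds in
     of_bool (0 \<le> fst r - fst p \<and> fst r - fst p \<le> 1 \<and> 0 \<le> snd r - snd p \<and> snd r - snd p \<le> 1))"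

text \<open>This is \<open>vertex_degree_eq\<close> restricted to five squares: twice the number of
  squares at the corner minus the number of consecutive pairs at it. The square in the middle always
  counts, hence the leading 2 and the coefficient 1 of its neighbours.\<close>

definition local_degree ::
  "orientation option \<Rightarrow> orientation option \<Rightarrow> orientation option \<Rightarrow> orientation option \<Rightarrow> int \<times> int \<Rightarrow> int" where
  "local_degree a b c d r = 2
     + (case b of None \<Rightarrow> 0 | Some b \<Rightarrow> rel_corner r [opp b] +
         (case a of None \<Rightarrow> 0 | Some a \<Rightarrow> rel_corner r [opp b, opp a] * (2 - rel_corner r [opp b])))
     + (case c of None \<Rightarrow> 0 | Some c \<Rightarrow> rel_corner r [c] +
         (case d of None \<Rightarrow> 0 | Some d \<Rightarrow> rel_corner r [c, d] * (2 - rel_corner r [c])))"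

definition local_defect where
  "local_defect a b c d r =
     (let k = local_degree a b c d r in if k = 2 then 2 else if k = 4 then - 1 else (0 :: int))"

fun side_product :: "(int \<times> int \<Rightarrow> int) \<Rightarrow> orientation \<Rightarrow> int" where
  "side_product y Rightwards = y (1, 0) * y (1, 1)"
| "side_product y Leftwards = y (0, 0) * y (0, 1)"
| "side_product y Upwards = y (0, 1) * y (1, 1)"
| "side_product y Downwards = y (0, 0) * y (1, 0)"

text \<open>The side shared with the next square is left to that square, so that every edge of the
  chain is counted once.\<close>

definition local_sum where
  "local_sum a b c d = (let y = local_defect a b c d in
     side_product y Rightwards + side_product y Leftwards + side_product y Upwards +
     side_product y Downwards - (case c of None \<Rightarrow> 0 | Some c \<Rightarrow> side_product y c))"

fun turn :: "orientation option \<Rightarrow> orientation option \<Rightarrow> bool" where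
  "turn (Some a) (Some b) = perp a b"
| "turn _ _ = False"

text \<open>The products of defects behind these values: 4 on the outer side of an end square, -2
  beside it if its neighbour is a kink, and 1 between the inner corners of the two kinks of a
  U-turn. Of two adjacent kinks the first square carries -2; the second carries -2 and the 1 of the
  side shared by them.\<close>

definition local_score where
  "local_score a b c d =
     (if b = None then 4 - 2 * of_bool (turn c d)
      else if c = None then 4 - 2 * of_bool (turn a b)
      else if turn b c then - of_bool (turn a b) - 2 * of_bool (turn c d)
      else of_bool (turn a b \<and> turn c d \<and> d = map_option opp a) :: int)"

fun opposed :: "orientation option \<Rightarrow> orientation option \<Rightarrow> bool" where
  "opposed (Some a) (Some b) = (b = opp a)"
| "opposed _ _ = False"

text \<open>Letters one or two places apart are never opposite in a self-avoiding word, whereas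
  \<open>a\<close> and \<open>d\<close> are opposite at a U-turn. The first conditions say that
  letters are missing only beyond the ends and that there is more than one square.\<close>

definition local_ok where
  "local_ok a b c d \<longleftrightarrow> (a \<noteq> None \<longrightarrow> b \<noteq> None) \<and> (d \<noteq> None \<longrightarrow> c \<noteq> None) \<and> (b \<noteq> None \<or> c \<noteq> None) \<and>
     \<not> opposed a b \<and> \<not> opposed a c \<and> \<not> opposed b c \<and> \<not> opposed b d \<and> \<not> opposed c d"

definition opts where "opts = [None, Some Rightwards, Some Leftwards, Some Upwards, Some Downwards]"

text \<open>A finite check of the 625 possible windows by evaluation. The degrees are included
  because \<open>local_defect\<close> is the true defect only for degrees 2, 3 and 4.\<close>

lemma local_check:
  "\<forall>a\<in>set opts. \<forall>b\<in>set opts. \<forall>c\<in>set opts. \<forall>d\<in>set opts. local_ok a b c d \<longrightarrow>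
    local_sum a b c d = local_score a b c d \<and>
    list_all (\<lambda>r. local_degree a b c d r \<in> {2, 3, 4}) [(0, 0), (0, 1), (1, 0), (1, 1)]"
  by code_simp

lemma set_opts: "a \<in> set opts"
proof (cases a)
  case (Some x)
  thus ?thesis by (cases x) (simp_all add: opts_def)
qed (simp add: opts_def)

lemma local_sum_eq: "local_ok a b c d \<Longrightarrow> local_sum a b c d = local_score a b c d"
  using local_check set_opts by blast

lemma local_degree_cases:
  assumes "local_ok a b c d" "r \<in> {0, 1} \<times> {0, 1}"
  shows "local_degree a b c d r \<in> {2, 3, 4}"
proof -
  have "r \<in> set [(0, 0), (0, 1), (1, 0), (1, 1)]" using assms(2) by auto
  thus ?thesis using local_check set_opts assms(1) unfolding list_all_iff by blast
qed

text \<open>Indexed by the square to which the letter leads. Square 1 has no letter, hence the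
  offset 2.\<close>

definition letter :: "chain_word \<Rightarrow> nat \<Rightarrow> orientation option" where
  "letter w j = (if 2 \<le> j \<and> j \<le> num_squares w then Some (w ! (j - 2)) else None)"

definition at_window ::
  "(orientation option \<Rightarrow> orientation option \<Rightarrow> orientation option \<Rightarrow> orientation option \<Rightarrow> 'a) \<Rightarrow>
    chain_word \<Rightarrow> nat \<Rightarrow> 'a" where
  "at_window f w i = f (letter w (i - 1)) (letter w i) (letter w (i + 1)) (letter w (i + 2))"

lemma dirc_abs_le: "\<bar>dirc a b\<bar> \<le> 1"
  by (simp add: dirc_def)

text \<open>If a letter is undone after one other letter, the three together move by a single step,
  so squares three places apart would touch.\<close>

lemma letter_not_opposed:
  assumes sa: "self_avoiding w" and "j = Suc i \<or> j = Suc (Suc i)"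
  shows "\<not> opposed (letter w i) (letter w j)"
proof -
  have "w ! j \<noteq> opp (w ! i)" if "j < length w" "j = Suc i \<or> j = Suc (Suc i)" for i j
  proof
    assume opp: "w ! j = opp (w ! i)"
    let ?v = "take (Suc j - i) (drop i w)"
    have "sublist ?v w" by (meson sublist_drop sublist_order.order_trans sublist_take)
    hence *: "(length ?v = 2 \<longrightarrow> disp Rightwards ?v \<noteq> 0 \<or> disp Upwards ?v \<noteq> 0) \<and>
        (3 \<le> length ?v \<longrightarrow> far ?v)"
      using sa unfolding self_avoiding_def by blast
    from that(2) show False
    proof
      assume j: "j = Suc i"
      hence "?v = [w ! i, w ! j]"
        using that(1) by (simp add: Cons_nth_drop_Suc[symmetric] take_Suc_conv_app_nth)
      thus False using * opp by simp
    next
      assume j: "j = Suc (Suc i)"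
      hence "?v = [w ! i, w ! Suc i, w ! j]"
        using that(1) by (simp add: Cons_nth_drop_Suc[symmetric])
      hence "far [w ! i, w ! Suc i, w ! j]" using * by simp
      thus False
        using dirc_abs_le[of Rightwards "w ! Suc i"] dirc_abs_le[of Upwards "w ! Suc i"]
        unfolding opp by (simp add: far_def)
    qed
  qed
  note no_opp = this
  show ?thesis
  proof (cases "2 \<le> i")
    case True
    define k where "k = i - 2"
    have "i = Suc (Suc k)" using True by (simp add: k_def)
    thus ?thesis
      using assms(2) no_opp[of "Suc k" k] no_opp[of "Suc (Suc k)" k]
      by (auto simp: letter_def num_squares_def)
  qed (simp add: letter_def)
qed

lemma local_ok_window:
  assumes "self_avoiding w" "w \<noteq> []" "i \<in> {1..num_squares w}"
  shows "at_window local_ok w i"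
proof -
  have "\<not> opposed (letter w (i - 1)) (letter w i)" "\<not> opposed (letter w (i - 1)) (letter w (i + 1))"
    "\<not> opposed (letter w i) (letter w (i + 1))" "\<not> opposed (letter w i) (letter w (i + 2))"
    "\<not> opposed (letter w (i + 1)) (letter w (i + 2))"
    using assms by (intro letter_not_opposed; auto)+
  moreover have "2 \<le> num_squares w" using assms(2) by (cases w) (auto simp: num_squares_def)
  ultimately show ?thesis
    unfolding at_window_def local_ok_def using assms(3) by (auto simp: letter_def)
qed

lemma shift_foldl: "foldl shift p ds = (fst p + disp Rightwards ds, snd p + disp Upwards ds)"
  by (induction ds arbitrary: p) (simp_all add: shift_def prod_eq_iff)

lemma rel_corner_eq:
  assumes "q = foldl shift p ds"
  shows "of_bool (lat (fst p + fst r, snd p + snd r) \<in> corners_at q) = real_of_int (rel_corner r ds)"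
proof -
  have "lat u \<in> corners_at q \<longleftrightarrow> 0 \<le> fst u - fst q \<and> fst u - fst q \<le> 1 \<and>
      0 \<le> snd u - snd q \<and> snd u - snd q \<le> 1" for u q
    by (cases u; cases q) (auto simp: corners_at_def image_iff mem_Times_iff)
  thus ?thesis unfolding assms by (simp add: rel_corner_def Let_def shift_foldl algebra_simps)
qed

lemma sum_window:
  fixes f :: "nat \<Rightarrow> real"
  assumes "i \<in> {1..n}" "\<And>j. j \<in> {1..n} \<Longrightarrow> j + 3 \<le> i \<or> i + 3 \<le> j \<Longrightarrow> f j = 0"
  shows "(\<Sum>j=1..n. f j) = (if 3 \<le> i then f (i - 2) else 0) + (if 2 \<le> i then f (i - 1) else 0) + f i
     + (if i + 1 \<le> n then f (i + 1) else 0) + (if i + 2 \<le> n then f (i + 2) else 0)"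
proof -
  define A where "A = (if 3 \<le> i then {i - 2} else {})"
  define B where "B = (if 2 \<le> i then {i - 1} else {})"
  define C where "C = (if i + 1 \<le> n then {i + 1} else {})"
  define D where "D = (if i + 2 \<le> n then {i + 2} else {})"
  note defs = A_def B_def C_def D_def
  have "(\<Sum>j=1..n. f j) = sum f (A \<union> B \<union> {i} \<union> C \<union> D)"
  proof (rule sum.mono_neutral_right)
    show "A \<union> B \<union> {i} \<union> C \<union> D \<subseteq> {1..n}" using assms(1) by (auto simp: defs)
    show "\<forall>j\<in>{1..n} - (A \<union> B \<union> {i} \<union> C \<union> D). f j = 0"
    proof
      fix j assume j: "j \<in> {1..n} - (A \<union> B \<union> {i} \<union> C \<union> D)"
      have "j + 2 \<noteq> i" "j + 1 \<noteq> i" "j \<noteq> i" "j \<noteq> i + 1" "j \<noteq> i + 2"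
        using j by (auto simp: defs split: if_splits)
      hence "j + 3 \<le> i \<or> i + 3 \<le> j" by linarith
      thus "f j = 0" using assms(2) j by blast
    qed
  qed (simp)
  also have "\<dots> = sum f A + sum f B + sum f {i} + sum f C + sum f D"
  proof -
    have "A \<inter> B = {}" "(A \<union> B) \<inter> {i} = {}" "(A \<union> B \<union> {i}) \<inter> C = {}"
      "(A \<union> B \<union> {i} \<union> C) \<inter> D = {}"
      by (auto simp: defs split: if_splits)
    moreover have "finite A" "finite B" "finite C" "finite D" by (simp_all add: defs)
    ultimately show ?thesis by (simp add: sum.union_disjoint del: Un_insert_right)
  qed
  finally show ?thesis by (simp add: defs)
qed

lemma degree_local:
  assumes sa: "self_avoiding w" and i: "i \<in> {1..num_squares w}" and r: "r \<in> {0, 1} \<times> {0, 1}"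
  shows "real (vertex_degree (graph_of w) (lat (fst (pos w i) + fst r, snd (pos w i) + snd r))) =
    real_of_int (at_window local_degree w i r)"
proof -
  let ?n = "num_squares w" and ?p = "pos w i"
  define v where "v = lat (fst ?p + fst r, snd ?p + snd r)"
  define c where "c j = (of_bool (v \<in> corners_at (pos w j)) :: real)" for j
  have ci: "c i = 1" using r by (auto simp: c_def v_def corners_at_def)
  hence vi: "v \<in> corners_at ?p" by (simp add: c_def split: if_splits)
  have c0: "c j = 0" if "j \<in> {1..?n}" "j + 3 \<le> i \<or> i + 3 \<le> j" for j
  proof -
    have "apart (pos w j) ?p \<or> apart ?p (pos w j)"
      using that self_avoiding_apart[OF sa, of j i] self_avoiding_apart[OF sa, of i j] i by auto
    thus ?thesis using corners_apart vi by (fastforce simp: c_def)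
  qed
  have s: "(\<Sum>j\<in>{1..<?n}. of_bool (v \<in> shared w j)) =
      (\<Sum>j=1..?n. if j < ?n then c j * c (j + 1) else 0)"
  proof -
    have "of_bool (v \<in> shared w j) = c j * c (j + 1)" if "j \<in> {1..<?n}" for j
      using corners_Int_Suc[of j w] that by (auto simp: c_def)
    hence "(\<Sum>j\<in>{1..<?n}. of_bool (v \<in> shared w j)) =
        (\<Sum>j\<in>{1..<?n}. if j < ?n then c j * c (j + 1) else 0)" by (intro sum.cong) auto
    also have "\<dots> = (\<Sum>j=1..?n. if j < ?n then c j * c (j + 1) else 0)"
      by (intro sum.mono_neutral_left) auto
    finally show ?thesis .
  qed
  have shift_pos: "pos w (Suc j) = shift (pos w j) (w ! (j - 1))" if "1 \<le> j" "j < ?n" for j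
    using pos_Suc_shift that .
  have pos_prev: "pos w j = shift (pos w (Suc j)) (opp (w ! (j - 1)))" if "1 \<le> j" "j < ?n" for j
    using shift_pos[OF that] by (simp add: shift_def)
  have c1: "c (i + 1) = rel_corner r [w ! (i - 1)]" if "i < ?n"
    unfolding c_def v_def using shift_pos[of i] that i by (intro rel_corner_eq) simp
  have c2: "c (i + 2) = rel_corner r [w ! (i - 1), w ! i]" if "i + 1 < ?n"
    unfolding c_def v_def using shift_pos[of i] shift_pos[of "Suc i"] that i
    by (intro rel_corner_eq) simp
  have b1: "c (i - 1) = rel_corner r [opp (w ! (i - 2))]" if "2 \<le> i"
  proof -
    define k where "k = i - 2"
    have k: "i = Suc (Suc k)" using that by (simp add: k_def)
    show ?thesis
      unfolding c_def v_def using pos_prev[of "Suc k"] i by (intro rel_corner_eq) (simp add: k)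
  qed
  have b2: "c (i - 2) = rel_corner r [opp (w ! (i - 2)), opp (w ! (i - 3))]" if "3 \<le> i"
  proof -
    define k where "k = i - 3"
    have k: "i = Suc (Suc (Suc k))" using that by (simp add: k_def)
    show ?thesis
      unfolding c_def v_def using pos_prev[of "Suc (Suc k)"] pos_prev[of "Suc k"] i
      by (intro rel_corner_eq) (simp add: k)
  qed
  have "(\<Sum>j=1..?n. c j) = (if 3 \<le> i then c (i - 2) else 0) + (if 2 \<le> i then c (i - 1) else 0) + c i
     + (if i + 1 \<le> ?n then c (i + 1) else 0) + (if i + 2 \<le> ?n then c (i + 2) else 0)"
    by (rule sum_window[OF i]) (rule c0)
  moreover have "(\<Sum>j=1..?n. if j < ?n then c j * c (j + 1) else 0) =
     (if 3 \<le> i then c (i - 2) * c (i - 1) else 0) + (if 2 \<le> i then c (i - 1) * c i else 0) +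
     (if i < ?n then c i * c (i + 1) else 0) + (if i + 1 < ?n then c (i + 1) * c (i + 2) else 0)"
  proof -
    have "i - 2 + 1 = i - 1" if "3 \<le> i" using that by simp
    \<comment> \<open>The pair of squares \<open>i + 2\<close> and \<open>i + 3\<close> falls into
      the range of \<open>sum_window\<close>, but square \<open>i + 3\<close> does not contain the
      corner.\<close>
    moreover have "c (i + 2 + 1) = 0" if "i + 2 < ?n" using c0[of "i + 2 + 1"] that by simp
    moreover have "i - 2 < ?n" if "3 \<le> i" using i that by auto
    moreover have "i - 1 < ?n \<and> i - 1 + 1 = i" if "2 \<le> i" using i that by auto
    ultimately show ?thesis
      by (subst sum_window[OF i]) (use c0 in auto)
  qed
  moreover have "real (vertex_degree (graph_of w) v) = 2 * (\<Sum>j=1..?n. c j) -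
      (\<Sum>j=1..?n. if j < ?n then c j * c (j + 1) else 0)"
    unfolding vertex_degree_eq[OF sa] s by (simp add: c_def)
  ultimately have "real (vertex_degree (graph_of w) v) =
     2 * ((if 3 \<le> i then c (i - 2) else 0) + (if 2 \<le> i then c (i - 1) else 0) + c i +
       (if i + 1 \<le> ?n then c (i + 1) else 0) + (if i + 2 \<le> ?n then c (i + 2) else 0)) -
     ((if 3 \<le> i then c (i - 2) * c (i - 1) else 0) + (if 2 \<le> i then c (i - 1) * c i else 0) +
       (if i < ?n then c i * c (i + 1) else 0) + (if i + 1 < ?n then c (i + 1) * c (i + 2) else 0))"
    by (simp only:)
  also have "\<dots> = real_of_int (local_degree
      (if 3 \<le> i then Some (w ! (i - 3)) else None) (if 2 \<le> i then Some (w ! (i - 2)) else None)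
      (if i < ?n then Some (w ! (i - 1)) else None) (if i + 1 < ?n then Some (w ! i) else None) r)"
  proof -
    have "3 \<le> i \<longrightarrow> 2 \<le> i" "i + 1 < ?n \<longrightarrow> i < ?n" by simp_all
    moreover have "i + 1 \<le> ?n \<longleftrightarrow> i < ?n" "i + 2 \<le> ?n \<longleftrightarrow> i + 1 < ?n" by auto
    ultimately show ?thesis
      unfolding local_degree_def
      by (cases "3 \<le> i"; cases "2 \<le> i"; cases "i + 1 < ?n"; cases "i < ?n";
          simp only: b1 b2 c1 c2 ci if_True if_False option.case not_True_eq_False simp_thms;
          simp add: algebra_simps)
  qed
  also have "local_degree
      (if 3 \<le> i then Some (w ! (i - 3)) else None) (if 2 \<le> i then Some (w ! (i - 2)) else None)
      (if i < ?n then Some (w ! (i - 1)) else None) (if i + 1 < ?n then Some (w ! i) else None) =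
      at_window local_degree w i"
  proof -
    have "2 \<le> i - 1 \<longleftrightarrow> 3 \<le> i" "i - 1 - 2 = i - 3" "i + 1 - 2 = i - 1" "i + 2 - 2 = i"
      "i - 1 \<le> ?n" "i \<le> ?n" "2 \<le> i + 1" "2 \<le> i + 2"
      "i + 1 \<le> ?n \<longleftrightarrow> i < ?n" "i + 2 \<le> ?n \<longleftrightarrow> i + 1 < ?n"
      using i by auto
    thus ?thesis unfolding at_window_def letter_def by (simp only: simp_thms)
  qed
  finally show ?thesis unfolding v_def .
qed

lemma defect_local:
  assumes "self_avoiding w" "w \<noteq> []" "i \<in> {1..num_squares w}" "r \<in> {0, 1} \<times> {0, 1}"
  shows "defect w (lat (fst (pos w i) + fst r, snd (pos w i) + snd r)) =
    real_of_int (at_window local_defect w i r)"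
proof -
  have "at_window local_degree w i r \<in> {2, 3, 4}"
    using local_degree_cases[OF local_ok_window[OF assms(1-3), unfolded at_window_def] assms(4)]
    by (simp add: at_window_def)
  thus ?thesis
    unfolding defect_def degree_local[OF assms(1,3,4)]
    by (auto simp: at_window_def local_defect_def Let_def)
qed

lemma prod_hedge: "(\<Prod>v\<in>hedge (a, b). f v) = f (lat (a, b)) * (f (lat (a + 1, b)) :: real)"
  by (simp add: hedge_def)

lemma prod_vedge: "(\<Prod>v\<in>vedge (a, b). f v) = f (lat (a, b)) * (f (lat (a, b + 1)) :: real)"
  by (simp add: vedge_def)

lemma score_local:
  assumes "self_avoiding w" "w \<noteq> []" "i \<in> {1..num_squares w}"
  shows "(\<Sum>e\<in>sides_at (pos w i). \<Prod>v\<in>e. defect w v) -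
     (if i < num_squares w then \<Prod>v\<in>shared w i. defect w v else 0) =
     real_of_int (at_window local_score w i)"
proof -
  obtain a b where p: "pos w i = (a, b)" by force
  let ?y = "at_window local_defect w i"
  have y: "defect w (lat (a, b)) = ?y (0, 0)" "defect w (lat (a + 1, b)) = ?y (1, 0)"
    "defect w (lat (a, b + 1)) = ?y (0, 1)" "defect w (lat (a + 1, b + 1)) = ?y (1, 1)"
    using defect_local[OF assms, of "(0, 0)"] defect_local[OF assms, of "(1, 0)"]
      defect_local[OF assms, of "(0, 1)"] defect_local[OF assms, of "(1, 1)"]
    by (simp_all add: p)
  have sides: "(\<Sum>e\<in>sides_at (a, b). \<Prod>v\<in>e. defect w v) =
      real_of_int (side_product ?y Rightwards + side_product ?y Leftwards +
        side_product ?y Upwards + side_product ?y Downwards)"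
    by (simp add: sum_sides prod_hedge prod_vedge y)
  have "(\<Prod>v\<in>shared_edge (a, b) d. defect w v) = real_of_int (side_product ?y d)" for d
    by (cases d) (simp_all add: prod_hedge prod_vedge y)
  hence shared: "(if i < num_squares w then \<Prod>v\<in>shared w i. defect w v else 0) =
      real_of_int (case letter w (i + 1) of None \<Rightarrow> 0 | Some c \<Rightarrow> side_product ?y c)"
    using assms(3) by (auto simp: shared_def p letter_def)
  have "(\<Sum>e\<in>sides_at (pos w i). \<Prod>v\<in>e. defect w v) -
      (if i < num_squares w then \<Prod>v\<in>shared w i. defect w v else 0) =
      real_of_int (at_window local_sum w i)"
    unfolding p sides shared by (simp only: of_int_diff[symmetric] at_window_def local_sum_def Let_def)
  also have "at_window local_sum w i = at_window local_score w i"
    using local_sum_eq local_ok_window[OF assms] by (simp add: at_window_def)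
  finally show ?thesis .
qed

section \<open>The index in terms of kinks and U-turns\<close>

definition kink :: "chain_word \<Rightarrow> nat \<Rightarrow> bool" where
  "kink w i \<longleftrightarrow> turn (letter w i) (letter w (i + 1))"

definition u_turn :: "chain_word \<Rightarrow> nat \<Rightarrow> bool" where
  "u_turn w i \<longleftrightarrow> kink w (i - 1) \<and> \<not> kink w i \<and> kink w (i + 1) \<and>
     letter w (i + 2) = map_option opp (letter w (i - 1))"

lemma kink_bounds: "kink w i \<Longrightarrow> 2 \<le> i \<and> i < num_squares w"
  by (auto simp: kink_def letter_def split: if_splits)

text \<open>The two end squares contribute \<open>8 / 144\<close>, and
  \<open>5 / 9 + 8 / 144 = 11 / 18\<close>. The shares -2 and -1 of two adjacent kinks add up to -3
  after an index shift.\<close>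

lemma R_chain_score:
  assumes sa: "self_avoiding w" and n: "3 \<le> num_squares w"
  shows "R_chain w = 11 / 18 + real (num_squares w) / 3 +
     (real (card {i. u_turn w i}) - 3 * real (card {i. kink w i \<and> kink w (i + 1)})
       - 2 * of_bool (kink w 2) - 2 * of_bool (kink w (num_squares w - 1))) / 144"
proof -
  let ?n = "num_squares w"
  have ne: "w \<noteq> []" using n by (auto simp: num_squares_def)
  have "(\<Sum>e\<in>graph_of w. \<Prod>v\<in>e. defect w v) = (\<Sum>i=1..?n. \<Sum>e\<in>sides_at (pos w i). \<Prod>v\<in>e. defect w v)
      - (\<Sum>i\<in>{1..<?n}. \<Prod>v\<in>shared w i. defect w v)"
    by (rule sum_edges[OF sa])
  also have "(\<Sum>i\<in>{1..<?n}. \<Prod>v\<in>shared w i. defect w v) =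
      (\<Sum>i=1..?n. if i < ?n then \<Prod>v\<in>shared w i. defect w v else 0)"
  proof -
    have "{1..?n} \<inter> {i. i < ?n} = {1..<?n}" by auto
    thus ?thesis by (simp add: sum.If_cases)
  qed
  also have "(\<Sum>i=1..?n. \<Sum>e\<in>sides_at (pos w i). \<Prod>v\<in>e. defect w v) - \<dots> =
      (\<Sum>i=1..?n. real_of_int (at_window local_score w i))"
    unfolding sum_subtractf[symmetric] by (rule sum.cong[OF refl]) (rule score_local[OF sa ne])
  also have "{1..?n} = insert 1 (insert ?n {2..<?n})" using n by auto
  also have "(\<Sum>i\<in>\<dots>. real_of_int (at_window local_score w i)) =
      real_of_int (at_window local_score w 1) + real_of_int (at_window local_score w ?n) +
      (\<Sum>i\<in>{2..<?n}. real_of_int (at_window local_score w i))"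
    using n by simp
  also have "at_window local_score w 1 = 4 - 2 * of_bool (kink w 2)"
    by (simp add: at_window_def local_score_def letter_def kink_def numeral_2_eq_2 numeral_3_eq_3)
  also have "at_window local_score w ?n = 4 - 2 * of_bool (kink w (?n - 1))"
    using n by (simp add: at_window_def local_score_def kink_def) (simp add: letter_def)
  also have "(\<Sum>i\<in>{2..<?n}. real_of_int (at_window local_score w i)) =
      (\<Sum>i\<in>{2..<?n}. of_bool (u_turn w i) - of_bool (kink w (i - 1) \<and> kink w i)
         - 2 * of_bool (kink w i \<and> kink w (i + 1)))"
  proof (rule sum.cong[OF refl])
    fix i assume i: "i \<in> {2..<?n}"
    hence "letter w i \<noteq> None" "letter w (i + 1) \<noteq> None" "i - 1 + 1 = i" "i + 1 + 1 = i + 2"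
      by (auto simp: letter_def)
    thus "real_of_int (at_window local_score w i) = of_bool (u_turn w i) -
        of_bool (kink w (i - 1) \<and> kink w i) - 2 * of_bool (kink w i \<and> kink w (i + 1))"
      unfolding at_window_def local_score_def u_turn_def kink_def by simp
  qed
  also have "\<dots> = (\<Sum>i\<in>{2..<?n}. of_bool (u_turn w i)) -
      (\<Sum>i\<in>{2..<?n}. of_bool (kink w (i - 1) \<and> kink w i)) -
      2 * (\<Sum>i\<in>{2..<?n}. of_bool (kink w i \<and> kink w (i + 1)))"
    by (simp add: sum_subtractf sum_distrib_left)
  also have "(\<Sum>i\<in>{2..<?n}. of_bool (u_turn w i)) = real (card {i. u_turn w i})"
  proof -
    have "{2..<?n} \<inter> {i. u_turn w i} = {i. u_turn w i}"
      using kink_bounds by (fastforce simp: u_turn_def)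
    thus ?thesis by (simp add: of_bool_def sum.If_cases)
  qed
  also have "(\<Sum>i\<in>{2..<?n}. of_bool (kink w i \<and> kink w (i + 1))) =
      real (card {i. kink w i \<and> kink w (i + 1)})"
  proof -
    have "{2..<?n} \<inter> {i. kink w i \<and> kink w (i + 1)} = {i. kink w i \<and> kink w (i + 1)}"
      using kink_bounds by auto
    thus ?thesis by (simp add: of_bool_def sum.If_cases)
  qed
  also have "(\<Sum>i\<in>{2..<?n}. of_bool (kink w (i - 1) \<and> kink w i)) =
      real (card {i. kink w i \<and> kink w (i + 1)})"
  proof -
    have "{2..<?n} \<inter> {i. kink w (i - 1) \<and> kink w i} = Suc ` {i. kink w i \<and> kink w (i + 1)}"
    proof (intro equalityI subsetI)
      fix i assume i: "i \<in> {2..<?n} \<inter> {i. kink w (i - 1) \<and> kink w i}"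
      hence "i = Suc (i - 1)" "i - 1 \<in> {i. kink w i \<and> kink w (i + 1)}" by auto
      thus "i \<in> Suc ` {i. kink w i \<and> kink w (i + 1)}" by blast
    qed (use kink_bounds in fastforce)
    thus ?thesis by (simp add: of_bool_def sum.If_cases card_image)
  qed
  finally show ?thesis unfolding R_chain_eq[OF sa] by (simp add: field_simps)
qed

section \<open>Runs\<close>

type_synonym runs = "(orientation \<times> nat) list"

definition word_of :: "runs \<Rightarrow> chain_word" where
  "word_of rs = concat (map (\<lambda>(d, a). replicate a d) rs)"

definition wf_runs :: "runs \<Rightarrow> bool" where
  "wf_runs rs \<longleftrightarrow> rs \<noteq> [] \<and> (\<forall>p\<in>set rs. 1 \<le> snd p) \<and> successively (\<lambda>p q. perp (fst p) (fst q)) rs"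

text \<open>The number of letters before run \<open>j\<close>. The segment of run \<open>j\<close>
  begins at square \<open>start rs j + 1\<close>, and its first letter leads to square
  \<open>start rs j + 2\<close>.\<close>

definition start :: "runs \<Rightarrow> nat \<Rightarrow> nat" where
  "start rs j = sum_list (map snd (take j rs))"

abbreviation rdir :: "runs \<Rightarrow> nat \<Rightarrow> orientation" where
  "rdir rs j \<equiv> fst (rs ! j)"

abbreviation rlen :: "runs \<Rightarrow> nat \<Rightarrow> nat" where
  "rlen rs j \<equiv> snd (rs ! j)"

lemma word_of_simps [simp]: "word_of [] = []" "word_of (p # rs) = replicate (snd p) (fst p) @ word_of rs"
  "word_of (rs @ rs') = word_of rs @ word_of rs'"
  by (simp_all add: word_of_def case_prod_beta)

lemma start_0 [simp]: "start rs 0 = 0"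
  by (simp add: start_def)

lemma start_Suc: "j < length rs \<Longrightarrow> start rs (Suc j) = start rs j + rlen rs j"
  by (simp add: start_def take_Suc_conv_app_nth)

lemma start_Cons [simp]: "start (p # rs) (Suc j) = snd p + start rs j"
  by (simp add: start_def)

lemma length_word_of: "length (word_of rs) = start rs (length rs)"
  by (induction rs) (auto simp: start_def)

lemma nth_word_of: "j < length rs \<Longrightarrow> t < rlen rs j \<Longrightarrow> word_of rs ! (start rs j + t) = rdir rs j"
proof (induction rs arbitrary: j)
  case (Cons p rs)
  thus ?case by (cases j) (auto simp: nth_append)
qed simp

lemma wf_runs_len: "wf_runs rs \<Longrightarrow> j < length rs \<Longrightarrow> 1 \<le> rlen rs j"
  by (auto simp: wf_runs_def)

lemma wf_runs_perp: "wf_runs rs \<Longrightarrow> Suc j < length rs \<Longrightarrow> perp (rdir rs j) (rdir rs (Suc j))"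
  by (auto simp: wf_runs_def successively_conv_nth)

lemma start_less:
  assumes "wf_runs rs" "i < j" "j \<le> length rs"
  shows "start rs i < start rs j"
  using assms(2,3)
proof (induction j)
  case (Suc j)
  have "start rs j < start rs (Suc j)"
    using start_Suc[of j rs] wf_runs_len[OF assms(1), of j] Suc.prems by simp
  thus ?case using Suc by (cases "i = j") auto
qed simp

lemma start_eq_iff:
  assumes "wf_runs rs" "i \<le> length rs" "j \<le> length rs"
  shows "start rs i = start rs j \<longleftrightarrow> i = j"
  using start_less[OF assms(1), of i j] start_less[OF assms(1), of j i] assms(2,3)
  by (metis linorder_neqE_nat less_irrefl)

lemma start_less_iff:
  assumes "wf_runs rs" "i \<le> length rs" "j \<le> length rs"
  shows "start rs i < start rs j \<longleftrightarrow> i < j"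
  using start_less[OF assms(1), of i j] start_less[OF assms(1), of j i] assms(2,3)
  by (metis linorder_neqE_nat less_irrefl less_asym)

lemma locate_run:
  assumes "t < start rs k" "k \<le> length rs"
  obtains j where "j < k" "start rs j \<le> t" "t < start rs (Suc j)"
  using assms
proof (induction k arbitrary: thesis)
  case (Suc k)
  show ?case
  proof (cases "t < start rs k")
    case True
    then obtain j where "j < k" "start rs j \<le> t" "t < start rs (Suc j)"
      using Suc.IH Suc.prems(3) by (metis Suc_leD)
    thus ?thesis using Suc.prems(1)[of j] by simp
  next
    case False
    thus ?thesis using Suc.prems(1)[of k] Suc.prems(2) by simp
  qed
qed simp

lemma num_squares_word_of: "num_squares (word_of rs) = start rs (length rs) + 1"
  by (simp add: num_squares_def length_word_of)

lemma letter_start: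
  assumes "wf_runs rs" "j < length rs" "t < rlen rs j"
  shows "letter (word_of rs) (start rs j + t + 2) = Some (rdir rs j)"
proof -
  have "start rs (Suc j) \<le> start rs (length rs)"
    using start_less[OF assms(1), of "Suc j" "length rs"] assms(2) by (cases "Suc j = length rs") auto
  thus ?thesis
    using assms nth_word_of[OF assms(2,3)] start_Suc[OF assms(2)]
    by (simp add: letter_def num_squares_word_of)
qed

lemma letter_start_last:
  assumes "wf_runs rs" "1 \<le> j" "j \<le> length rs"
  shows "letter (word_of rs) (start rs j + 1) = Some (rdir rs (j - 1))"
proof -
  have "1 \<le> rlen rs (j - 1)" using wf_runs_len[OF assms(1), of "j - 1"] assms by simp
  thus ?thesis
    using letter_start[OF assms(1), of "j - 1" "rlen rs (j - 1) - 1"] assms start_Suc[of "j - 1" rs]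
    by simp
qed

lemma kink_iff:
  assumes wf: "wf_runs rs"
  shows "kink (word_of rs) i \<longleftrightarrow> (\<exists>j. 1 \<le> j \<and> j < length rs \<and> i = start rs j + 1)"
proof
  assume k: "kink (word_of rs) i"
  hence i: "2 \<le> i" "i \<le> start rs (length rs)"
    using kink_bounds[OF k] by (simp_all add: num_squares_word_of)
  hence "i - 1 < start rs (length rs)" by simp
  then obtain j where j: "j < length rs" "start rs j \<le> i - 1" "i - 1 < start rs (Suc j)"
    by (rule locate_run) simp
  have "start rs j = i - 1"
  proof (rule ccontr)
    assume "start rs j \<noteq> i - 1"
    hence "start rs j + (i - 2 - start rs j) + 2 = i" "start rs j + (i - 1 - start rs j) + 2 = i + 1"
      "i - 2 - start rs j < rlen rs j" "i - 1 - start rs j < rlen rs j"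
      using j i start_Suc[OF j(1)] by auto
    hence "letter (word_of rs) i = Some (rdir rs j)" "letter (word_of rs) (i + 1) = Some (rdir rs j)"
      using letter_start[OF wf j(1)] by metis+
    thus False using k by (simp add: kink_def)
  qed
  moreover have "1 \<le> j" using calculation i by (cases j) auto
  ultimately show "\<exists>j. 1 \<le> j \<and> j < length rs \<and> i = start rs j + 1" using j(1) i by auto
next
  assume "\<exists>j. 1 \<le> j \<and> j < length rs \<and> i = start rs j + 1"
  then obtain j where j: "1 \<le> j" "j < length rs" "i = start rs j + 1" by blast
  have "perp (rdir rs (j - 1)) (rdir rs j)" using wf_runs_perp[OF wf, of "j - 1"] j by simp
  thus "kink (word_of rs) i"
    using letter_start[OF wf j(2), of 0] letter_start_last[OF wf j(1)] wf_runs_len[OF wf j(2)] j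
    by (simp add: kink_def)
qed

lemma kink_kink_iff:
  assumes wf: "wf_runs rs"
  shows "kink (word_of rs) i \<and> kink (word_of rs) (i + 1) \<longleftrightarrow>
     (\<exists>j. 1 \<le> j \<and> Suc j < length rs \<and> rlen rs j = 1 \<and> i = start rs j + 1)"
proof
  assume "kink (word_of rs) i \<and> kink (word_of rs) (i + 1)"
  then obtain j j' where j: "1 \<le> j" "j < length rs" "i = start rs j + 1"
    and j': "j' < length rs" "start rs j' = start rs j + 1"
    unfolding kink_iff[OF wf] by auto
  have "j < j'" using start_less_iff[OF wf, of j j'] j j' by simp
  moreover have "\<not> Suc j < j'"
  proof
    assume "Suc j < j'"
    hence "start rs (Suc j) < start rs j'" "start rs j < start rs (Suc j)"
      using start_less[OF wf, of "Suc j" j'] start_less[OF wf, of j "Suc j"] j j' by simp_all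
    thus False using j'(2) by simp
  qed
  ultimately have "j' = Suc j" by simp
  thus "\<exists>j. 1 \<le> j \<and> Suc j < length rs \<and> rlen rs j = 1 \<and> i = start rs j + 1"
    using j j' start_Suc[OF j(2)] by auto
next
  assume "\<exists>j. 1 \<le> j \<and> Suc j < length rs \<and> rlen rs j = 1 \<and> i = start rs j + 1"
  then obtain j where j: "1 \<le> j" "Suc j < length rs" "rlen rs j = 1" "i = start rs j + 1" by blast
  thus "kink (word_of rs) i \<and> kink (word_of rs) (i + 1)"
    unfolding kink_iff[OF wf] using start_Suc[of j rs]
    by (intro conjI exI[of _ j] exI[of _ "Suc j"]) auto
qed

definition u_turns :: "runs \<Rightarrow> nat set" where
  "u_turns rs = {j. 1 \<le> j \<and> Suc j < length rs \<and> rlen rs j = 2 \<and> rdir rs (Suc j) = opp (rdir rs (j - 1))}"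

lemma u_turn_iff:
  assumes wf: "wf_runs rs"
  shows "u_turn (word_of rs) i \<longleftrightarrow> (\<exists>j\<in>u_turns rs. i = start rs j + 2)"
proof
  assume u: "u_turn (word_of rs) i"
  hence i: "2 \<le> i - 1" using kink_bounds by (auto simp: u_turn_def)
  from u obtain j j' where j: "1 \<le> j" "j < length rs" "i - 1 = start rs j + 1"
    and j': "j' < length rs" "i + 1 = start rs j' + 1"
    unfolding kink_iff[OF wf] u_turn_def by auto
  hence ij: "i = start rs j + 2" "start rs j' = start rs j + 2" using i by auto
  have lt: "j < j'" using start_less_iff[OF wf, of j j'] j j' ij by simp
  moreover have "\<not> Suc j < j'"
  proof
    assume lt': "Suc j < j'"
    hence "start rs (Suc j) < start rs j'" "start rs j < start rs (Suc j)"
      using start_less[OF wf, of "Suc j" j'] start_less[OF wf, of j "Suc j"] lt' j j' by simp_all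
    hence "start rs (Suc j) + 1 = i" using ij by simp
    hence "kink (word_of rs) i" unfolding kink_iff[OF wf] using lt' j'(1)
      by (intro exI[of _ "Suc j"]) auto
    thus False using u by (simp add: u_turn_def)
  qed
  ultimately have j'_eq: "j' = Suc j" by simp
  have "rlen rs j = 2" using start_Suc[OF j(2)] ij j'_eq by simp
  moreover have "letter (word_of rs) (i + 2) = Some (rdir rs (Suc j))"
    using letter_start[OF wf, of "Suc j" 0] wf_runs_len[OF wf, of "Suc j"] j' j'_eq ij by simp
  moreover have "letter (word_of rs) (i - 1) = Some (rdir rs (j - 1))"
    using letter_start_last[OF wf j(1)] j ij by simp
  ultimately have "j \<in> u_turns rs"
    using u j j' j'_eq by (simp add: u_turns_def u_turn_def)
  thus "\<exists>j\<in>u_turns rs. i = start rs j + 2" using ij by blast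
next
  assume "\<exists>j\<in>u_turns rs. i = start rs j + 2"
  then obtain j where j: "1 \<le> j" "Suc j < length rs" "rlen rs j = 2"
    "rdir rs (Suc j) = opp (rdir rs (j - 1))" "i = start rs j + 2"
    by (auto simp: u_turns_def)
  have s: "start rs (Suc j) = start rs j + 2" using start_Suc[of j rs] j by simp
  have "kink (word_of rs) (i - 1)" "kink (word_of rs) (i + 1)"
    unfolding kink_iff[OF wf] using j s
    by (intro exI[of _ j], simp, intro exI[of _ "Suc j"], simp)
  moreover have "\<not> kink (word_of rs) i"
  proof
    assume "kink (word_of rs) i"
    then obtain l where l: "l < length rs" "start rs l = start rs j + 1"
      unfolding kink_iff[OF wf] using j by auto
    hence "j < l" "l < Suc j"
      using start_less_iff[OF wf, of j l] start_less_iff[OF wf, of l "Suc j"] j s by auto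
    thus False by simp
  qed
  moreover have "letter (word_of rs) (i + 2) = Some (rdir rs (Suc j))"
    using letter_start[OF wf, of "Suc j" 0] wf_runs_len[OF wf, of "Suc j"] j s by simp
  moreover have "letter (word_of rs) (i - 1) = Some (rdir rs (j - 1))"
    using letter_start_last[OF wf j(1)] j by simp
  ultimately show "u_turn (word_of rs) i" using j by (simp add: u_turn_def)
qed

definition short_runs :: "runs \<Rightarrow> nat set" where
  "short_runs rs = {j. 1 \<le> j \<and> Suc j < length rs \<and> rlen rs j = 1}"

lemma inj_start: "wf_runs rs \<Longrightarrow> A \<subseteq> {..<length rs} \<Longrightarrow> inj_on (\<lambda>j. start rs j + c) A"
proof (rule inj_onI)
  fix x y assume wf: "wf_runs rs" and "A \<subseteq> {..<length rs}" "x \<in> A" "y \<in> A"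
    and eq: "start rs x + c = start rs y + c"
  hence "x < length rs" "y < length rs" by auto
  thus "x = y" using start_eq_iff[OF wf, of x y] eq by simp
qed

lemma finite_u_turns [simp]: "finite (u_turns rs)"
  by (rule finite_subset[of _ "{..<length rs}"]) (auto simp: u_turns_def)

lemma finite_short_runs [simp]: "finite (short_runs rs)"
  by (rule finite_subset[of _ "{..<length rs}"]) (auto simp: short_runs_def)

lemma R_chain_runs:
  assumes wf: "wf_runs rs" and sa: "self_avoiding (word_of rs)" and n: "3 \<le> num_squares (word_of rs)"
  shows "R_chain (word_of rs) = 11 / 18 + real (num_squares (word_of rs)) / 3 +
     (real (card (u_turns rs)) - 3 * real (card (short_runs rs))
       - 2 * of_bool (2 \<le> length rs \<and> rlen rs 0 = 1)
       - 2 * of_bool (2 \<le> length rs \<and> rlen rs (length rs - 1) = 1)) / 144"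
proof -
  let ?w = "word_of rs" and ?r = "length rs"
  have r: "0 < ?r" using wf by (simp add: wf_runs_def)
  have "{i. u_turn ?w i} = (\<lambda>j. start rs j + 2) ` u_turns rs"
    using u_turn_iff[OF wf] by auto
  hence u: "card {i. u_turn ?w i} = card (u_turns rs)"
    using card_image[OF inj_start[OF wf, of "u_turns rs" 2]] by (auto simp: u_turns_def subset_iff)
  have "{i. kink ?w i \<and> kink ?w (i + 1)} = (\<lambda>j. start rs j + 1) ` short_runs rs"
    unfolding kink_kink_iff[OF wf] by (auto simp: short_runs_def)
  hence s: "card {i. kink ?w i \<and> kink ?w (i + 1)} = card (short_runs rs)"
    using card_image[OF inj_start[OF wf, of "short_runs rs" 1]]
    by (auto simp: short_runs_def subset_iff)
  have k2: "kink ?w 2 \<longleftrightarrow> 2 \<le> ?r \<and> rlen rs 0 = 1"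
  proof
    assume "kink ?w 2"
    then obtain j where j: "1 \<le> j" "j < ?r" "start rs j = 1" unfolding kink_iff[OF wf] by auto
    have "\<not> 1 < j"
    proof
      assume "1 < j"
      hence "start rs 1 < start rs j" "start rs 0 < start rs 1"
        using start_less[OF wf, of 1 j] start_less[OF wf, of 0 1] j by auto
      thus False using j(3) by simp
    qed
    hence "j = 1" using j(1) by linarith
    thus "2 \<le> ?r \<and> rlen rs 0 = 1" using j start_Suc[OF r] by simp
  next
    assume "2 \<le> ?r \<and> rlen rs 0 = 1"
    thus "kink ?w 2" unfolding kink_iff[OF wf] using start_Suc[OF r] by (intro exI[of _ 1]) simp
  qed
  have kn: "kink ?w (num_squares ?w - 1) \<longleftrightarrow> 2 \<le> ?r \<and> rlen rs (?r - 1) = 1"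
  proof
    assume "kink ?w (num_squares ?w - 1)"
    then obtain j where j: "1 \<le> j" "j < ?r" "start rs ?r = start rs j + 1"
      unfolding kink_iff[OF wf] num_squares_word_of by auto
    have "\<not> Suc j < ?r"
    proof
      assume "Suc j < ?r"
      hence "start rs j < start rs (Suc j)" "start rs (Suc j) < start rs ?r"
        using start_less[OF wf, of j "Suc j"] start_less[OF wf, of "Suc j" ?r] by auto
      thus False using j(3) by simp
    qed
    hence "?r = Suc j" using j by simp
    thus "2 \<le> ?r \<and> rlen rs (?r - 1) = 1" using j start_Suc[of j rs] by auto
  next
    assume "2 \<le> ?r \<and> rlen rs (?r - 1) = 1"
    moreover from this have "Suc (?r - 1) = ?r" "?r - 1 < ?r" by linarith+
    ultimately show "kink ?w (num_squares ?w - 1)"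
      unfolding kink_iff[OF wf] num_squares_word_of using start_Suc[of "?r - 1" rs]
      by (intro exI[of _ "?r - 1"]) simp
  qed
  show ?thesis unfolding R_chain_score[OF sa n] u s k2 kn ..
qed

lemma ex_runs:
  assumes "w \<noteq> []" "successively (\<lambda>a b. b \<noteq> opp a) w"
  shows "\<exists>rs. wf_runs rs \<and> word_of rs = w"
  using assms
proof (induction w)
  case (Cons x w)
  show ?case
  proof (cases "w = []")
    case True
    thus ?thesis by (intro exI[of _ "[(x, 1)]"]) (simp add: wf_runs_def)
  next
    case False
    then obtain rs where rs: "wf_runs rs" "word_of rs = w" using Cons by (cases w) auto
    then obtain d a rs' where rs': "rs = (d, Suc a) # rs'"
      by (cases rs) (auto simp: wf_runs_def dest: Suc_le_D)
    hence "hd w = d" using rs by auto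
    hence "d \<noteq> opp x" using Cons.prems(2) False by (cases w) auto
    show ?thesis
    proof (cases "x = d")
      case True
      have "wf_runs ((d, Suc (Suc a)) # rs')"
        using rs(1) unfolding rs' wf_runs_def by (simp add: successively_Cons)
      moreover have "word_of ((d, Suc (Suc a)) # rs') = x # w"
        unfolding rs(2)[symmetric] rs' using True by simp
      ultimately show ?thesis by (intro exI conjI)
    next
      case False
      hence "perp x d" using \<open>d \<noteq> opp x\<close> not_perp_iff[of x d] by metis
      hence "wf_runs ((x, 1) # rs)"
        using rs(1) unfolding rs' wf_runs_def by (simp add: successively_Cons)
      moreover have "word_of ((x, 1) # rs) = x # w" using rs(2) by simp
      ultimately show ?thesis by (intro exI conjI)
    qed
  qed
qed simp

lemma self_avoiding_ex_runs:
  assumes "self_avoiding w" "w \<noteq> []"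
  obtains rs where "wf_runs rs" "word_of rs = w"
proof -
  have "successively (\<lambda>a b. b \<noteq> opp a) w"
    unfolding successively_conv_nth
  proof (intro allI impI)
    fix i assume "Suc i < length w"
    thus "w ! Suc i \<noteq> opp (w ! i)"
      using self_avoiding_no_reversal[OF assms(1), of "Suc i"] by (simp add: num_squares_def)
  qed
  thus ?thesis using ex_runs[OF assms(2)] that by blast
qed

section \<open>What self-avoidance forbids for runs\<close>

lemma sublist_runs:
  assumes "i < l" "l < length rs" "x \<le> rlen rs i" "y \<le> rlen rs l"
  shows "sublist (replicate x (rdir rs i) @ word_of (map ((!) rs) [Suc i..<l]) @ replicate y (rdir rs l))
    (word_of rs)"
proof -
  have "rs = map ((!) rs) ([0..<i] @ i # [Suc i..<l] @ l # [Suc l..<length rs])"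
    using assms(1,2) map_nth[of rs] upt_add_eq_append[of 0 i "length rs - i"]
      upt_add_eq_append[of "Suc i" l "length rs - l"] upt_conv_Cons[of i "length rs"]
      upt_conv_Cons[of l "length rs"] by simp
  then obtain ps qs where *: "rs = ps @ rs ! i # map ((!) rs) [Suc i..<l] @ rs ! l # qs"
    unfolding map_append list.map by blast
  have "replicate (rlen rs i) (rdir rs i) = replicate (rlen rs i - x) (rdir rs i) @ replicate x (rdir rs i)"
    "replicate (rlen rs l) (rdir rs l) = replicate y (rdir rs l) @ replicate (rlen rs l - y) (rdir rs l)"
    using assms(3,4) by (simp_all flip: replicate_add)
  hence "word_of rs = (word_of ps @ replicate (rlen rs i - x) (rdir rs i)) @
      (replicate x (rdir rs i) @ word_of (map ((!) rs) [Suc i..<l]) @ replicate y (rdir rs l)) @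
      (replicate (rlen rs l - y) (rdir rs l) @ word_of qs)"
    by (subst *) simp
  thus ?thesis unfolding sublist_def by blast
qed

text \<open>The factors used for contradictions all have this form: the end of one run, all runs
  strictly between, and the beginning of a later run.\<close>

lemma self_avoiding_runs_far:
  assumes "self_avoiding (word_of rs)" "i < l" "l < length rs" "x \<le> rlen rs i" "y \<le> rlen rs l"
    and "perp a c"
    and "v = replicate x (rdir rs i) @ word_of (map ((!) rs) [Suc i..<l]) @ replicate y (rdir rs l)"
    and "3 \<le> length v"
  shows "2 \<le> \<bar>disp a v\<bar> \<or> 2 \<le> \<bar>disp c v\<bar>"
proof -
  obtain p q where "word_of rs = p @ v @ q"
    using sublist_runs[OF assms(2-5)] assms(7) unfolding sublist_def by blast
  thus ?thesis using self_avoiding_factor[of p v q a c] assms by simp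
qed

lemma u_turns_bounds: "j \<in> u_turns rs \<Longrightarrow> 1 \<le> j \<and> Suc j < length rs \<and> rlen rs j = 2"
  by (simp add: u_turns_def)

text \<open>With one letter before and one after, two successive U-turns displace by 1 in absolute
  value along both axes, so the outer squares touch in a corner.\<close>

lemma u_turns_not_consecutive:
  assumes wf: "wf_runs rs" and sa: "self_avoiding (word_of rs)" and j: "j \<in> u_turns rs"
  shows "Suc j \<notin> u_turns rs"
proof
  assume "Suc j \<in> u_turns rs"
  moreover obtain i where i: "j = Suc i" using j by (cases j) (auto simp: u_turns_def)
  ultimately have *: "Suc (Suc (Suc i)) < length rs" "rlen rs (Suc i) = 2" "rlen rs (Suc (Suc i)) = 2"
    "rdir rs (Suc (Suc i)) = opp (rdir rs i)" "rdir rs (Suc (Suc (Suc i))) = opp (rdir rs (Suc i))"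
    using j by (auto simp: u_turns_def)
  have perp: "perp (rdir rs i) (rdir rs (Suc i))" using wf_runs_perp[OF wf] * by simp
  have "[Suc i..<Suc (Suc (Suc i))] = [Suc i, Suc (Suc i)]" by (simp add: upt_rec)
  thus False
    using self_avoiding_runs_far[OF sa, of i "Suc (Suc (Suc i))" 1 1 "rdir rs i" "rdir rs (Suc i)", OF _ _ _ _ perp refl]
      * perp wf_runs_len[OF wf, of i] wf_runs_len[OF wf, of "Suc (Suc (Suc i))"]
    by (simp add: dirc_perp perp_commute)
qed

section \<open>The upper bound and the case of equality\<close>

definition tight :: "runs \<Rightarrow> nat \<Rightarrow> bool" where
  "tight rs m \<longleftrightarrow> (\<forall>j<length rs. 2 \<le> rlen rs j) \<and> card (u_turns rs) = m"

lemma length_word_of_sum: "length (word_of rs) = (\<Sum>j<length rs. rlen rs j)"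
  by (simp add: length_word_of start_def sum_list_sum_nth atLeast0LessThan)

text \<open>Pair every U-turn with the run after it. The pairs are disjoint, as U-turns are not
  consecutive, and none contains the first run.\<close>

lemma card_u_turns:
  assumes wf: "wf_runs rs" and sa: "self_avoiding (word_of rs)"
  defines "X \<equiv> u_turns rs \<union> Suc ` u_turns rs"
  shows "X \<subseteq> {1..<length rs}" "card X = 2 * card (u_turns rs)" "2 * card (u_turns rs) + 1 \<le> length rs"
proof -
  show X: "X \<subseteq> {1..<length rs}" using u_turns_bounds by (fastforce simp: X_def)
  have "u_turns rs \<inter> Suc ` u_turns rs = {}" using u_turns_not_consecutive[OF wf sa] by auto
  thus "card X = 2 * card (u_turns rs)" by (simp add: X_def card_Un_disjoint card_image)
  with card_mono[OF _ X] wf show "2 * card (u_turns rs) + 1 \<le> length rs"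
    by (simp add: wf_runs_def) (metis Suc_pred length_greater_0_conv not_less_eq_eq)
qed

text \<open>A short inner run costs 3 and a short outer one costs 2, while \<open>q\<close> short
  runs allow at most \<open>q\<close> U-turns beyond \<open>m\<close>.\<close>

lemma R_chain_bound:
  assumes wf: "wf_runs rs" and sa: "self_avoiding (word_of rs)"
    and n: "num_squares (word_of rs) = k + 4 * m" and k: "3 \<le> k" "k \<le> 6"
  shows "R_chain (word_of rs) \<le> 11 / 18 + real k / 3 + 193 / 144 * real m"
    "R_chain (word_of rs) = 11 / 18 + real k / 3 + 193 / 144 * real m \<longleftrightarrow> tight rs m"
proof -
  let ?r = "length rs" and ?u = "card (u_turns rs)" and ?s = "card (short_runs rs)"
  define b where "b = (of_bool (2 \<le> ?r \<and> rlen rs 0 = 1) :: nat)"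
  define e where "e = (of_bool (2 \<le> ?r \<and> rlen rs (?r - 1) = 1) :: nat)"
  define ones where "ones = {j. j < ?r \<and> rlen rs j = 1}"
  have sum: "(\<Sum>j<?r. rlen rs j) + 1 = k + 4 * m"
    using n by (simp add: num_squares_def length_word_of_sum)
  have u: "2 * ?u + 1 \<le> ?r" by (rule card_u_turns[OF wf sa])
  let ?A = "11 / 18 + real k / 3 + 193 / 144 * real m"
  \<comment> \<open>The \<open>4 * m\<close> squares yield \<open>192 / 144 * m\<close>. The
    coefficient 193 includes the gain of \<open>m\<close> U-turns, which is therefore subtracted
    again.\<close>
  have R: "R_chain (word_of rs) = ?A + (real ?u - real (m + 3 * ?s + 2 * b + 2 * e)) / 144"
  proof -
    have "real (k + 4 * m) / 3 + x / 144 = real k / 3 + 193 / 144 * real m + (x - real m) / 144" for x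
      by (simp add: field_simps)
    thus ?thesis using R_chain_runs[OF wf sa] n k by (simp add: b_def e_def)
  qed
  have one: "rlen rs j \<ge> 1" if "j < ?r" for j using wf_runs_len[OF wf that] .
  have "2 * ?r = (\<Sum>j<?r. 2)" by simp
  also have "\<dots> \<le> (\<Sum>j<?r. rlen rs j + of_bool (j \<in> ones))"
    using one by (intro sum_mono) (fastforce simp: ones_def)
  also have "\<dots> = (\<Sum>j<?r. rlen rs j) + card ones"
    by (auto simp: sum.distrib ones_def intro!: arg_cong[where f = card])
  finally have r: "2 * ?r + 1 \<le> k + 4 * m + card ones" using sum by simp
  have ones: "card ones \<le> ?s + b + e"
  proof (cases "2 \<le> ?r")
    case True
    have "ones \<subseteq> short_runs rs \<union> (if rlen rs 0 = 1 then {0} else {}) \<union>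
        (if rlen rs (?r - 1) = 1 then {?r - 1} else {})" (is "_ \<subseteq> _ \<union> ?B \<union> ?E")
    proof
      fix j assume "j \<in> ones"
      moreover have "j = 0 \<or> j = ?r - 1 \<or> 1 \<le> j \<and> Suc j < ?r" using calculation by (auto simp: ones_def)
      ultimately show "j \<in> short_runs rs \<union> ?B \<union> ?E" by (auto simp: ones_def short_runs_def)
    qed
    hence "card ones \<le> card (short_runs rs \<union> ?B \<union> ?E)" by (intro card_mono) auto
    also have "\<dots> \<le> ?s + card ?B + card ?E"
      by (meson add_mono card_Un_le le_trans order_refl)
    finally show ?thesis using True by (auto simp: b_def e_def split: if_splits)
  next
    case False
    hence "?r = 1" using wf by (cases rs) (auto simp: wf_runs_def Suc_le_eq)
    hence "ones = {}" using sum k by (auto simp: ones_def)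
    thus ?thesis by simp
  qed
  \<comment> \<open>From \<open>4 * ?u + 2 \<le> 2 * ?r \<le> 4 * m + 5 + card ones\<close>: without
    short runs rounding gives \<open>?u \<le> m\<close>, and otherwise
    \<open>3 + card ones \<le> 4 * card ones\<close>.\<close>
  have le: "?u \<le> m + (?s + b + e)"
    using u r ones k by linarith
  hence "?u \<le> m + 3 * ?s + 2 * b + 2 * e" by linarith
  hence "real ?u \<le> real (m + 3 * ?s + 2 * b + 2 * e)" by (simp only: of_nat_le_iff)
  thus "R_chain (word_of rs) \<le> ?A" unfolding R by (simp only: add_le_same_cancel1 divide_le_0_iff) linarith
  have "R_chain (word_of rs) = ?A \<longleftrightarrow> real ?u = real (m + 3 * ?s + 2 * b + 2 * e)"
    unfolding R by (simp only: add_cancel_left_right divide_eq_0_iff) linarith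
  also have "\<dots> \<longleftrightarrow> ?u = m + 3 * ?s + 2 * b + 2 * e"
    by (simp only: of_nat_eq_iff)
  also have "\<dots> \<longleftrightarrow> ?u = m \<and> ?s = 0 \<and> b = 0 \<and> e = 0"
    using le by auto
  also have "\<dots> \<longleftrightarrow> tight rs m"
  proof
    assume *: "?u = m \<and> ?s = 0 \<and> b = 0 \<and> e = 0"
    hence "ones = {}" using ones by (simp add: ones_def)
    hence "2 \<le> rlen rs j" if "j < ?r" for j
      using one[OF that] that unfolding ones_def by (cases "rlen rs j = 1") auto
    thus "tight rs m" using * by (simp add: tight_def)
  next
    assume t: "tight rs m"
    hence two: "rlen rs j \<noteq> 1" if "j < ?r" for j using that by (auto simp: tight_def)
    hence "short_runs rs = {}" by (auto simp: short_runs_def)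
    moreover have "rlen rs 0 \<noteq> 1" "rlen rs (?r - 1) \<noteq> 1"
      using wf by (auto intro!: two simp: wf_runs_def simp del: One_nat_def)
    ultimately show "?u = m \<and> ?s = 0 \<and> b = 0 \<and> e = 0" using t by (simp add: tight_def b_def e_def)
  qed
  finally show "R_chain (word_of rs) = 11 / 18 + real k / 3 + 193 / 144 * real m \<longleftrightarrow> tight rs m" .
qed

text \<open>Turning back after a run of three or more steps leaves so few letters that nearly all
  other runs belong to pairs of a U-turn and its successor. The U-turns next to the wide turn then
  make the chain meet itself.\<close>

lemma tight_same_turns:
  assumes wf: "wf_runs rs" and sa: "self_avoiding (word_of rs)"
    and n: "num_squares (word_of rs) = k + 4 * m" and k: "k \<le> 6"
    and tight: "tight rs m" and j: "1 \<le> j" "Suc j < length rs" "j \<notin> u_turns rs"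
  shows "rdir rs (Suc j) = rdir rs (j - 1)"
proof (rule ccontr)
  assume neq: "rdir rs (Suc j) \<noteq> rdir rs (j - 1)"
  let ?r = "length rs" and ?X = "u_turns rs \<union> Suc ` u_turns rs"
  obtain i where i: "j = Suc i" using j by (cases j) auto
  have perp: "perp (rdir rs i) (rdir rs (Suc i))" using wf_runs_perp[OF wf, of i] i j by simp
  have opp: "rdir rs (Suc (Suc i)) = opp (rdir rs i)"
    using neq perp_perp[OF perp] wf_runs_perp[OF wf, of "Suc i"] i j by auto
  have len: "2 \<le> rlen rs l" if "l < ?r" for l using tight that by (simp add: tight_def)
  have u: "card (u_turns rs) = m" using tight by (simp add: tight_def)
  note X = card_u_turns[OF wf sa, unfolded u]
  have "rlen rs j \<noteq> 2" using j opp i by (auto simp: u_turns_def)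
  hence j3: "3 \<le> rlen rs j" using len[of j] j by simp
  have "2 * ?r + (rlen rs j - 2) = (\<Sum>l<?r. 2 + (if l = j then rlen rs j - 2 else 0))"
    using j by (subst sum.distrib) simp
  also have "\<dots> \<le> (\<Sum>l<?r. rlen rs l)" using len j3 by (intro sum_mono) (simp del: add_2_eq_Suc)
  \<comment> \<open>As \<open>rlen rs j \<ge> 3\<close>, this means
    \<open>length rs \<le> 2 * m + 2\<close>. At most one run after the first is outside
    \<open>?X\<close>, and if there is one, then \<open>rlen rs j = 3\<close>.\<close>
  finally have r: "2 * ?r + rlen rs j \<le> 4 * m + 7"
    using n k j3 by (simp add: num_squares_def length_word_of_sum)
  have missing: "card ({1..<?r} - ?X) = ?r - 1 - 2 * m"
    using X by (simp add: card_Diff_subset)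
  have next_u: "Suc j \<in> u_turns rs" if "Suc j \<in> ?X" using that j by auto
  have prev_u: "i \<in> u_turns rs" if "j \<in> ?X" using that j i by auto
  have eps: "rdir rs (Suc (Suc (Suc i))) = opp (rdir rs (Suc i)) \<and> Suc (Suc (Suc i)) < ?r \<and>
      rlen rs (Suc (Suc i)) = 2" if "Suc j \<in> u_turns rs"
    using that i by (simp add: u_turns_def)
  have bef: "rdir rs (Suc i) = opp (rdir rs (i - 1)) \<and> 1 \<le> i \<and> rlen rs i = 2" if "i \<in> u_turns rs"
    using that by (simp add: u_turns_def)
  show False
  proof (cases "Suc j \<in> ?X")
    case True
    note nx = eps[OF next_u[OF True]]
    show False
    proof (cases "j \<in> ?X")
      case j_in: True
      note pv = bef[OF prev_u[OF j_in]]
      obtain h where h: "i = Suc h" using pv by (cases i) auto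
      have "rlen rs j \<le> 5" using r X(3) by linarith
      hence a: "rlen rs j = 3 \<or> rlen rs j = 4 \<or> rlen rs j = 5" using j3 by linarith
      have up: "[i..<Suc (Suc (Suc i))] = [i, Suc i, Suc (Suc i)]" by (simp add: upt_rec)
      have "perp (rdir rs h) (rdir rs i)" using wf_runs_perp[OF wf, of h] h nx by simp
      \<comment> \<open>U-turns on both sides of run \<open>j\<close>: from two letters before them
        to two letters after them the displacement is \<open>4 - rlen rs j\<close> along run
        \<open>h\<close>, which is -1, 0 or 1, and 0 along run \<open>i\<close>.\<close>
      thus False
        using self_avoiding_runs_far[OF sa, of h "Suc (Suc (Suc i))" 2 2 "rdir rs h" "rdir rs i", OF _ _ _ _ _ refl]
          h pv nx opp a len[of h] len[of "Suc (Suc (Suc i))"] i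
        by (auto simp: dirc_perp perp_commute up)
    next
      case False
      hence "{j} \<subseteq> {1..<?r} - ?X" using j by auto
      hence "1 \<le> ?r - 1 - 2 * m" using card_mono[of "{1..<?r} - ?X" "{j}"] missing by simp
      hence a: "rlen rs j = 3" using r j3 by linarith
      have up: "[Suc i..<Suc (Suc (Suc i))] = [Suc i, Suc (Suc i)]" by (simp add: upt_rec)
      \<comment> \<open>A U-turn only after run \<open>j\<close>: the displacement is 0 along run
        \<open>i\<close> and 1 along run \<open>j\<close>.\<close>
      show False
        using self_avoiding_runs_far[OF sa, of i "Suc (Suc (Suc i))" 2 2 "rdir rs i" "rdir rs (Suc i)", OF _ _ _ _ perp refl]
          nx opp a len[of i] len[of "Suc (Suc (Suc i))"] i
        using perp by (auto simp: dirc_perp perp_commute up)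
    qed
  next
    case False
    hence "{Suc j} \<subseteq> {1..<?r} - ?X" using j by auto
    hence "1 \<le> ?r - 1 - 2 * m" using card_mono[of "{1..<?r} - ?X" "{Suc j}"] missing by simp
    hence one: "card ({1..<?r} - ?X) \<le> 1" and a: "rlen rs j = 3" using r j3 missing by linarith+
    have "j \<in> ?X"
    proof (rule ccontr)
      assume "j \<notin> ?X"
      hence "{j, Suc j} \<subseteq> {1..<?r} - ?X" using False j by auto
      hence "card {j, Suc j} \<le> card ({1..<?r} - ?X)" by (intro card_mono) auto
      thus False using one by simp
    qed
    note pv = bef[OF prev_u[OF this]]
    obtain h where h: "i = Suc h" using pv by (cases i) auto
    have up: "[i..<Suc (Suc i)] = [i, Suc i]" by (simp add: upt_rec)
    have "perp (rdir rs h) (rdir rs i)" using wf_runs_perp[OF wf, of h] h j i by simp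
    \<comment> \<open>A U-turn only before run \<open>j\<close>: the displacement is -1 along run
      \<open>h\<close> and 0 along run \<open>i\<close>.\<close>
    thus False
      using self_avoiding_runs_far[OF sa, of h "Suc (Suc i)" 2 2 "rdir rs h" "rdir rs i", OF _ _ _ _ _ refl]
        h pv opp a len[of h] len[of "Suc (Suc i)"] i j
      by (auto simp: dirc_perp perp_commute up)
  qed
qed

section \<open>Codes of maximal chains\<close>

text \<open>
  Every run of a maximal chain has at least two steps, and the \<open>u_turns\<close> are isolated. A code lists,
  after the number of extra steps of the first run, what follows a run in direction \<open>d\<close> that
  is left in direction \<open>c\<close>: either an item \<open>(True, t)\<close>, a \<open>u_turns\<close> run and a run with \<open>t\<close> extra
  steps back in direction \<open>opp d\<close>, or an item \<open>(False, t)\<close>, a single run in direction \<open>c\<close>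
  with \<open>t\<close> extra steps, which is left in direction \<open>d\<close>.
\<close>

type_synonym items = "(bool \<times> nat) list"

fun enc :: "orientation \<Rightarrow> orientation \<Rightarrow> nat \<Rightarrow> items \<Rightarrow> runs" where
  "enc d c s [] = [(d, 2 + s)]"
| "enc d c s ((True, t) # its) = (d, 2 + s) # (c, 2) # enc (opp d) c t its"
| "enc d c s ((False, t) # its) = (d, 2 + s) # enc c d t its"

lemma enc_induct [case_names Nil True False]:
  fixes P :: "orientation \<Rightarrow> orientation \<Rightarrow> nat \<Rightarrow> items \<Rightarrow> bool"
  assumes "\<And>d c s. P d c s []"
    "\<And>d c s t its. P (opp d) c t its \<Longrightarrow> P d c s ((True, t) # its)"
    "\<And>d c s t its. P c d t its \<Longrightarrow> P d c s ((False, t) # its)"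
  shows "P d c s its"
  using assms by (induction d c s its rule: enc.induct) blast+

lemma hd_enc: "\<exists>rs. enc d c s its = (d, 2 + s) # rs"
  by (induction d c s its rule: enc_induct) auto

lemma enc_nonempty [simp]: "enc d c s its \<noteq> []"
  using hd_enc[of d c s its] by auto

lemma snd_enc: "its \<noteq> [] \<Longrightarrow> \<exists>a rs. enc d c s its = (d, 2 + s) # (c, a) # rs"
  using hd_enc by (cases "(d, c, s, its)" rule: enc.cases) (auto, metis)

lemma u_turns_Cons:
  "j \<in> u_turns (p # rs) \<longleftrightarrow> (\<exists>i. j = Suc i \<and> i \<in> u_turns rs) \<or>
     j = 1 \<and> (\<exists>p1 p2 rs'. rs = p1 # p2 # rs' \<and> snd p1 = 2 \<and> fst p2 = opp (fst p))"
proof (cases j)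
  case (Suc i)
  thus ?thesis
  proof (cases i)
    case 0
    thus ?thesis using Suc by (cases rs; cases "tl rs") (auto simp: u_turns_def)
  qed (auto simp: u_turns_def)
qed (auto simp: u_turns_def)

lemma u_turns_Cons':
  "u_turns (p # rs) = Suc ` u_turns rs \<union>
     (if \<exists>p1 p2 rs'. rs = p1 # p2 # rs' \<and> snd p1 = 2 \<and> fst p2 = opp (fst p) then {1} else {})"
  by (rule set_eqI, subst u_turns_Cons) auto

lemma u_turns_tl: "Suc j \<in> u_turns (p # rs) \<longleftrightarrow> j \<in> u_turns rs \<or> j = 0 \<and> 1 \<in> u_turns (p # rs)"
  by (subst (1 2) u_turns_Cons) (auto simp: u_turns_def)

text \<open>What reading off a code requires of a maximal chain, in a form that passes to tails;
  \<open>tight\<close> does not, since it fixes the number of U-turns.\<close>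

definition straight :: "runs \<Rightarrow> bool" where
  "straight rs \<longleftrightarrow> rs \<noteq> [] \<and> (\<forall>j<length rs. 2 \<le> rlen rs j) \<and> (\<forall>j\<in>u_turns rs. Suc j \<notin> u_turns rs) \<and>
     (\<forall>j. 1 \<le> j \<longrightarrow> Suc j < length rs \<longrightarrow> j \<notin> u_turns rs \<longrightarrow> rdir rs (Suc j) = rdir rs (j - 1))"

lemma straight_tl:
  assumes "straight (p # rs)" "rs \<noteq> []"
  shows "straight rs"
proof -
  have "rdir rs (Suc j) = rdir rs (j - 1)" if "1 \<le> j" "Suc j < length rs" "j \<notin> u_turns rs" for j
  proof -
    have "Suc j \<notin> u_turns (p # rs)" using that u_turns_tl[of j p rs] by simp
    hence "rdir (p # rs) (Suc (Suc j)) = rdir (p # rs) (Suc j - 1)"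
      using assms(1) that(2) unfolding straight_def by (elim conjE allE[of _ "Suc j"]) simp
    thus ?thesis using that(1) by (cases j) auto
  qed
  moreover have "2 \<le> rlen rs j" if "j < length rs" for j
    using assms(1) that unfolding straight_def by fastforce
  moreover have "Suc j \<notin> u_turns rs" if "j \<in> u_turns rs" for j
    using assms(1) that u_turns_tl[of j p rs] u_turns_tl[of "Suc j" p rs] unfolding straight_def by blast
  ultimately show ?thesis using assms(2) by (simp add: straight_def)
qed

text \<open>The code is read from the front: whether the second run is a U-turn decides the kind of
  the first item. A single run does not determine \<open>c\<close>.\<close>

lemma straight_imp_enc:
  assumes "straight rs" "2 \<le> length rs \<Longrightarrow> rdir rs 1 = c"
  shows "\<exists>s its. rs = enc (rdir rs 0) c s its"
  using assms
proof (induction "length rs" arbitrary: rs c rule: less_induct)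
  case less
  obtain d a rs1 where rs: "rs = (d, a) # rs1" using less.prems by (cases rs) (auto simp: straight_def)
  have a: "a = 2 + (a - 2)" using less.prems by (auto simp: straight_def rs)
  show ?case
  proof (cases "rs1 = []")
    case True
    thus ?thesis using rs a by (intro exI[of _ "a - 2"] exI[of _ "[]"]) simp
  next
    case False
    then obtain b rs2 where rs1: "rs1 = (c, b) # rs2" using less.prems(2) rs by (cases rs1) auto
    have st1: "straight rs1" using straight_tl[of _ rs1] less.prems False rs by metis
    show ?thesis
    proof (cases "1 \<in> u_turns rs")
      case True
      hence ne: "rs2 \<noteq> []" and u: "b = 2" "rdir rs2 0 = opp d" by (auto simp: u_turns_def rs rs1)
      have "straight rs2" using straight_tl[of _ rs2] st1 ne rs1 by metis
      \<comment> \<open>The run after a U-turn is not a U-turn itself, so it is left in the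
        direction \<open>c\<close> of the run before it.\<close>
      moreover have "rdir rs2 1 = c" if "2 \<le> length rs2"
        using less.prems True that unfolding straight_def
        by (auto simp: rs rs1 numeral_2_eq_2 numeral_3_eq_3 dest!: spec[of _ 2] bspec[of _ _ 1])
      ultimately obtain s its where "rs2 = enc (opp d) c s its"
        using less.hyps[of rs2 c] u rs rs1 by auto
      thus ?thesis using rs rs1 u a by (intro exI[of _ "a - 2"] exI[of _ "(True, s) # its"]) simp
    next
      case False
      hence "rdir rs1 1 = d" if "2 \<le> length rs1"
        using less.prems(1) that unfolding straight_def by (auto simp: rs dest!: spec[of _ 1])
      then obtain s its where "rs1 = enc c d s its"
        using less.hyps[of rs1 d] st1 rs rs1 by auto
      thus ?thesis using rs a by (intro exI[of _ "a - 2"] exI[of _ "(False, s) # its"]) simp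
    qed
  qed
qed

lemma wf_enc: "perp d c \<Longrightarrow> wf_runs (enc d c s its)"
proof (induction d c s its rule: enc_induct)
  case (True d c s t its)
  thus ?case using hd_enc[of "opp d" c t its]
    by (auto simp: wf_runs_def successively_Cons perp_commute)
next
  case (False d c s t its)
  thus ?case using hd_enc[of c d t its] by (auto simp: wf_runs_def successively_Cons perp_commute)
qed (simp add: wf_runs_def)

lemma len_enc: "p \<in> set (enc d c s its) \<Longrightarrow> 2 \<le> snd p"
  by (induction d c s its rule: enc_induct) auto

abbreviation uturns_of :: "items \<Rightarrow> nat" where
  "uturns_of its \<equiv> length (filter fst its)"

text \<open>The run with which an item ends is entered from and left in the same direction, so it is
  no U-turn even if it has just two steps.\<close>

lemma card_u_turns_enc: "card (u_turns (enc d c s its)) = uturns_of its"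
proof (induction d c s its rule: enc_induct)
  case (Nil d c s)
  thus ?case by (simp add: u_turns_def)
next
  case (True d c s t its)
  have no: "\<not> (\<exists>p1 p2 rs'. enc (opp d) c t its = p1 # p2 # rs' \<and> snd p1 = 2 \<and> fst p2 = opp c)"
    using snd_enc[of its "opp d" c t] by (cases "its = []") auto
  obtain rs where rs: "enc (opp d) c t its = (opp d, 2 + t) # rs" using hd_enc by blast
  have "u_turns ((c, 2) # enc (opp d) c t its) = Suc ` u_turns (enc (opp d) c t its)"
    using no by (simp add: u_turns_Cons'[of "(c, 2)"])
  moreover have "u_turns ((d, 2 + s) # (c, 2) # enc (opp d) c t its) =
      insert 1 (Suc ` u_turns ((c, 2) # enc (opp d) c t its))"
    by (subst u_turns_Cons') (auto simp: rs)
  moreover have "0 \<notin> u_turns (enc (opp d) c t its)" by (simp add: u_turns_def)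
  ultimately show ?case using True by (simp add: card_image card_insert_if image_iff)
next
  case (False d c s t its)
  have no: "\<not> (\<exists>p1 p2 rs'. enc c d t its = p1 # p2 # rs' \<and> snd p1 = 2 \<and> fst p2 = opp d)"
    using snd_enc[of its c d t] by (cases "its = []") auto
  have "u_turns ((d, 2 + s) # enc c d t its) = Suc ` u_turns (enc c d t its)"
    by (subst u_turns_Cons') (use no in auto)
  thus ?case using False by (simp add: card_image)
qed

lemma tight_enc: "tight (enc d c s its) (uturns_of its)"
  by (auto simp: tight_def card_u_turns_enc intro!: len_enc nth_mem)

abbreviation slack :: "items \<Rightarrow> nat" where
  "slack its \<equiv> sum_list (map snd its)"

lemma length_word_of_enc:
  "length (word_of (enc d c s its)) + 2 * uturns_of its = 2 + s + 2 * length its + 4 * uturns_of its + slack its"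
  by (induction d c s its rule: enc_induct) auto

lemma ex_enc:
  assumes "wf_runs rs" "self_avoiding (word_of rs)" "num_squares (word_of rs) = k + 4 * m" "k \<le> 6"
    and "tight rs m" and "2 \<le> length rs \<Longrightarrow> rdir rs 1 = c"
  obtains s its where "rs = enc (rdir rs 0) c s its"
proof -
  have "straight rs"
    using assms(1,5) tight_same_turns[OF assms(1-5)] u_turns_not_consecutive[OF assms(1,2)]
    by (auto simp: straight_def tight_def wf_runs_def)
  thus ?thesis using straight_imp_enc[OF _ assms(6)] that by blast
qed

section \<open>Self-avoidance of zigzags and of two joined zigzags\<close>

definition clear :: "orientation list \<Rightarrow> bool" where
  "clear v \<longleftrightarrow> (length v = 2 \<longrightarrow> disp Rightwards v \<noteq> 0 \<or> disp Upwards v \<noteq> 0) \<and> (3 \<le> length v \<longrightarrow> far v)"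

lemma clear_perp:
  assumes "perp a c"
  shows "clear v \<longleftrightarrow> (length v = 2 \<longrightarrow> disp a v \<noteq> 0 \<or> disp c v \<noteq> 0) \<and>
     (3 \<le> length v \<longrightarrow> 2 \<le> \<bar>disp a v\<bar> \<or> 2 \<le> \<bar>disp c v\<bar>)"
  unfolding clear_def far_perp[OF assms] nonclosed_perp[OF assms] ..

text \<open>Only factors across the seam are new; they consist of a suffix of one word and a prefix
  of the other.\<close>

lemma self_avoiding_append:
  "self_avoiding (p @ q) \<longleftrightarrow> self_avoiding p \<and> self_avoiding q \<and>
     (\<forall>p' q'. suffix p' p \<longrightarrow> prefix q' q \<longrightarrow> p' \<noteq> [] \<longrightarrow> q' \<noteq> [] \<longrightarrow> clear (p' @ q'))" (is "?L \<longleftrightarrow> ?R")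
proof
  assume sa: ?L
  have "clear (p' @ q')" if "suffix p' p" "prefix q' q" for p' q'
    using sa that unfolding self_avoiding_def clear_def sublist_append by blast
  thus ?R using self_avoiding_sublist[OF sa] by simp
next
  assume R: ?R
  have "clear v" if "sublist v (p @ q)" for v
  proof -
    consider "sublist v p" | "sublist v q"
      | p' q' where "v = p' @ q'" "suffix p' p" "prefix q' q" "p' \<noteq> []" "q' \<noteq> []"
      using \<open>sublist v (p @ q)\<close> unfolding sublist_append
      by (metis append_Nil append_Nil2 prefix_imp_sublist suffix_imp_sublist)
    thus ?thesis using R unfolding self_avoiding_def clear_def by cases blast+
  qed
  thus ?L unfolding self_avoiding_def clear_def by blast
qed

lemma prefix_replicate_iff: "prefix v (replicate n d) \<longleftrightarrow> (\<exists>k\<le>n. v = replicate k d)"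
proof
  assume "prefix v (replicate n d)"
  then obtain v' where "v @ v' = replicate n d" by (metis prefixE)
  hence "v = replicate (length v) d" "length v \<le> n"
    by (metis append_eq_conv_conj take_replicate min_def length_replicate length_append le_add1)+
  thus "\<exists>k\<le>n. v = replicate k d" by blast
next
  assume "\<exists>k\<le>n. v = replicate k d"
  thus "prefix v (replicate n d)" by (metis le_add_diff_inverse prefixI replicate_add)
qed

lemma suffix_replicate_iff: "suffix v (replicate n d) \<longleftrightarrow> (\<exists>k\<le>n. v = replicate k d)"
  using prefix_replicate_iff[of "rev v" n d] unfolding suffix_to_prefix rev_replicate
  by (metis rev_rev_ident rev_replicate)

lemma self_avoiding_replicate: "self_avoiding (replicate n d)"
proof -
  have "sublist v (replicate n d) \<Longrightarrow> \<exists>k. v = replicate k d" for v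
    unfolding sublist_altdef prefix_replicate_iff using suffix_replicate_iff by metis
  moreover have "clear (replicate k d)" for k
  proof -
    obtain c where "perp d c" by (cases d) (auto simp: perp_def horizontal_def intro: that[of Upwards] that[of Rightwards])
    thus ?thesis by (auto simp: clear_perp)
  qed
  ultimately show ?thesis unfolding self_avoiding_def clear_def by blast
qed

abbreviation zigzag :: "items \<Rightarrow> bool" where
  "zigzag its \<equiv> list_all fst its"

text \<open>A zigzag climbs by two in direction \<open>c\<close> between runs that alternate between
  \<open>d\<close> and \<open>opp d\<close>. Along \<open>d\<close> it oscillates, and only extra
  steps can make it drift beyond the first run.\<close>

lemma zigzag_prefix:
  assumes "zigzag its" "perp d c" "prefix v (word_of (enc d c s its))"
  shows "(\<exists>k. v = replicate k d) \<or> v = replicate (2 + s) d @ [c] \<or> 2 \<le> disp c v"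
    "- int (slack its) \<le> disp d v \<and> disp d v \<le> int (2 + s + slack its)"
proof -
  \<comment> \<open>The clause \<open>0 \<le> disp c v\<close> strengthens the induction: two steps
    in direction \<open>c\<close> followed by a later prefix then reach height 2.\<close>
  have "((\<exists>k. v = replicate k d) \<or> v = replicate (2 + s) d @ [c] \<or> 2 \<le> disp c v) \<and> 0 \<le> disp c v \<and>
    - int (slack its) \<le> disp d v \<and> disp d v \<le> int (2 + s + slack its)"
    using assms
  proof (induction d c s its arbitrary: v rule: enc_induct)
    case (Nil d c s)
    hence "prefix v (replicate (2 + s) d)" by simp
    thus ?case using Nil.prems(2) unfolding prefix_replicate_iff by (auto simp: dirc_perp perp_commute)
  next
    case (True d c s t its)
    have "prefix v (replicate (2 + s) d @ c # c # word_of (enc (opp d) c t its))"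
      using True.prems(3) by (simp add: numeral_2_eq_2)
    then consider k where "v = replicate k d" "k \<le> 2 + s"
      | u where "v = replicate (2 + s) d @ u" "prefix u (c # c # word_of (enc (opp d) c t its))"
      unfolding prefix_append prefix_replicate_iff by blast
    then consider k where "v = replicate k d" "k \<le> 2 + s"
      | "v = replicate (2 + s) d @ [c]"
      | v' where "v = replicate (2 + s) d @ c # c # v'" "prefix v' (word_of (enc (opp d) c t its))"
    proof cases
      case (2 u)
      thus ?thesis using that(1)[of "2 + s"] that(2,3) by (auto simp: prefix_Cons)
    qed blast
    thus ?case
    proof cases
      case 3
      have "0 \<le> disp c v'" "- int (slack its) \<le> disp (opp d) v'"
        "disp (opp d) v' \<le> int (2 + t + slack its)"
        using True.IH[OF _ _ 3(2)] True.prems by auto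
      thus ?thesis using True.prems(2) by (simp add: 3(1) dirc_perp perp_commute)
    qed (use True.prems(2) in \<open>auto simp: dirc_perp perp_commute\<close>)
  qed auto
  thus "(\<exists>k. v = replicate k d) \<or> v = replicate (2 + s) d @ [c] \<or> 2 \<le> disp c v"
    "- int (slack its) \<le> disp d v \<and> disp d v \<le> int (2 + s + slack its)" by auto
qed

lemma zigzag_prefix_nonneg:
  assumes "zigzag its" "perp d c" "prefix v (word_of (enc d c s its))"
  shows "0 \<le> disp c v"
  using zigzag_prefix(1)[OF assms] assms(2) by (auto simp: dirc_perp perp_commute)

text \<open>Built from the back. Nothing after a seam descends in direction \<open>c\<close>, so any
  factor that takes both steps of the U-turn has height 2, and the remaining ones are short or
  nearly straight.\<close>

lemma self_avoiding_zigzag: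
  "zigzag its \<Longrightarrow> perp d c \<Longrightarrow> self_avoiding (word_of (enc d c s its))"
proof (induction d c s its rule: enc_induct)
  case (Nil d c s)
  thus ?case by (simp only: enc.simps word_of_simps snd_conv fst_conv append_Nil2 self_avoiding_replicate)
next
  case (True d c s t its)
  let ?w = "word_of (enc (opp d) c t its)"
  have perp: "perp (opp d) c" "perp c d" using True.prems by (auto simp: perp_commute)
  have dc: "dirc c d = 0" "dirc d c = 0" using True.prems by (auto simp: dirc_perp perp_commute)
  have nonneg: "0 \<le> disp c v" if "prefix v ?w" for v
    using zigzag_prefix_nonneg[OF _ perp(1) that] True.prems by simp
  have cases: "(\<exists>k. v = replicate k (opp d)) \<or> v = replicate (2 + t) (opp d) @ [c] \<or> 2 \<le> disp c v"
    if "prefix v ?w" for v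
    using zigzag_prefix(1)[OF _ perp(1) that] True.prems by simp
  have "clear (v @ v')" if v: "suffix v (replicate 2 c)" "prefix v' ?w" "v \<noteq> []" "v' \<noteq> []" for v v'
  proof -
    obtain k where k: "v = replicate k c" "k = 1 \<or> k = 2"
      using v(1,3) unfolding suffix_replicate_iff by (force simp: le_Suc_eq numeral_2_eq_2)
    show ?thesis using cases[OF v(2)] v(4) k dc by (auto simp: clear_perp[OF True.prems(2)])
  qed
  hence 1: "self_avoiding (replicate 2 c @ ?w)"
    unfolding self_avoiding_append using True.IH True.prems self_avoiding_replicate by simp
  have "clear (v @ v')"
    if v: "suffix v (replicate (2 + s) d)" "prefix v' (replicate 2 c @ ?w)" "v \<noteq> []" "v' \<noteq> []" for v v'
  proof -
    obtain k where k: "v = replicate k d" "1 \<le> k"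
      using v(1,3) unfolding suffix_replicate_iff by (auto simp: Suc_le_eq)
    have "v' = [c] \<or> 2 \<le> disp c v'"
      using v(2,4) nonneg by (auto simp: prefix_append prefix_Cons numeral_2_eq_2)
    thus ?thesis using k dc by (auto simp: clear_perp[OF True.prems(2)])
  qed
  hence "self_avoiding (replicate (2 + s) d @ replicate 2 c @ ?w)"
    unfolding self_avoiding_append[of "replicate (2 + s) d"]
    using 1 self_avoiding_replicate[of "2 + s" d] by blast
  thus ?case by (simp only: enc.simps word_of_simps snd_conv fst_conv)
qed auto

lemma enc_snoc:
  assumes "zigzag its"
  shows "enc d c s (its @ (u, t) # its') = enc d c s its @
    (if u then (c, 2) # enc (opp (rdir (rev (enc d c s its)) 0)) c t its'
     else enc c (rdir (rev (enc d c s its)) 0) t its')"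
  using assms
proof (induction d c s its rule: enc_induct)
  case (Nil d c s)
  thus ?case by (cases u) auto
next
  case (True d c s t its)
  thus ?case by (simp add: nth_append)
qed auto

lemma zigzag_last:
  "zigzag its \<Longrightarrow> rdir (rev (enc d c s its)) 0 \<in> {d, opp d}"
  by (induction d c s its rule: enc_induct) (auto simp: nth_append)

text \<open>Reversing the order of the letters keeps the displacement, so suffixes of a zigzag can
  be treated as prefixes of another zigzag with the same total of extra steps.\<close>

lemma rev_zigzag:
  assumes "zigzag its"
  shows "\<exists>s' its'. rev (enc d c s its) = enc (rdir (rev (enc d c s its)) 0) c s' its' \<and> zigzag its' \<and>
    s' + slack its' = s + slack its"
  using assms
proof (induction its rule: rev_induct)
  case Nil
  show ?case by (intro exI[of _ s] exI[of _ "[]"]) simp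
next
  case (snoc x its)
  obtain t where x: "x = (True, t)" using snoc.prems by (cases x) auto
  let ?e = "rdir (rev (enc d c s its)) 0"
  obtain s' its' where *: "rev (enc d c s its) = enc ?e c s' its'" "zigzag its'"
    "s' + slack its' = s + slack its"
    using snoc by auto
  have eq: "enc d c s (its @ [x]) = enc d c s its @ [(c, 2), (opp ?e, 2 + t)]"
    using snoc.prems by (simp add: x enc_snoc)
  have "rev (enc d c s (its @ [x])) = enc (opp ?e) c t ((True, s') # its')"
    unfolding eq by (simp flip: *(1))
  moreover have "rdir (rev (enc d c s (its @ [x]))) 0 = opp ?e" unfolding eq by simp
  ultimately show ?case using *(2,3) by (intro exI[of _ t] exI[of _ "(True, s') # its'"]) (simp add: x)
qed

text \<open>The first zigzag advances in direction \<open>c\<close>, the second in the direction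
  \<open>e\<close> of the last run of the first. Drifting back against the other one's advance takes
  an extra step, and there is at most one in total.\<close>

lemma self_avoiding_two_zigzags:
  assumes A: "zigzag A" and B: "zigzag B" and perp: "perp d c" and slack: "s + slack A + t + slack B \<le> 1"
  shows "self_avoiding (word_of (enc d c s (A @ (False, t) # B)))"
proof -
  define e where "e = rdir (rev (enc d c s A)) 0"
  obtain s' A' where rev: "rev (enc d c s A) = enc e c s' A'" "zigzag A'" "s' + slack A' = s + slack A"
    using rev_zigzag[OF A] e_def by metis
  let ?p = "word_of (enc d c s A)" and ?q = "word_of (enc c e t B)"
  have "perp e c" using zigzag_last[OF A, of d c s] perp by (auto simp: e_def)
  have rev_word: "rev (word_of rs) = word_of (rev rs)" for rs by (induction rs) auto
  have disp_rev: "disp a (rev v) = disp a v" for a v by (induction v) auto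
  have "clear (p @ q)" if p: "suffix p ?p" "p \<noteq> []" and q: "prefix q ?q" "q \<noteq> []" for p q
  proof -
    have "prefix (rev p) (word_of (enc e c s' A'))"
      using p(1) by (simp add: suffix_to_prefix rev_word rev(1))
    note P = zigzag_prefix[OF rev(2) \<open>perp e c\<close> this] zigzag_prefix_nonneg[OF rev(2) \<open>perp e c\<close> this]
    have "perp c e" using \<open>perp e c\<close> by (simp add: perp_commute)
    note Q = zigzag_prefix[OF B this q(1)] zigzag_prefix_nonneg[OF B this q(1)]
    have ec: "dirc c e = 0" "dirc e c = 0" using \<open>perp e c\<close> by (auto simp: dirc_perp perp_commute)
    have P1: "(\<exists>k. p = replicate k e) \<or> p = c # replicate (2 + s') e \<or> 2 \<le> disp c p"
      using P(1) by (metis disp_rev rev_replicate rev_rev_ident rev_append rev_singleton_conv append_Cons append_Nil rev_swap)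
    have P2: "- int (slack A') \<le> disp e p" "0 \<le> disp c p" using P(2,3) by (simp_all add: disp_rev)
    \<comment> \<open>If \<open>p\<close> drifts back along \<open>e\<close>, then the only extra
      step belongs to the first zigzag. So \<open>q\<close> does not drift back along
      \<open>c\<close>, where \<open>p\<close> has already gained 2.\<close>
    consider (pos) "0 \<le> disp e p" | (neg) "2 \<le> disp c p" "0 \<le> disp c q"
    proof (cases "0 \<le> disp e p")
      case False
      hence "2 \<le> disp c p" using P1 ec by auto
      moreover have "slack B = 0" using False P2 slack rev(3) by linarith
      hence "0 \<le> disp c q" using Q(2) by linarith
      ultimately show ?thesis using neg by blast
    qed blast
    thus ?thesis
    proof cases
      case pos
      show ?thesis using Q(1)
      proof (elim disjE exE)
        fix k assume k: "q = replicate k c"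
        show ?thesis using P1 p(2) q(2) P2 ec unfolding clear_perp[OF \<open>perp e c\<close>] k
          by (elim disjE exE) auto
      next
        assume k: "q = replicate (2 + t) c @ [e]"
        show ?thesis using P2 ec unfolding clear_perp[OF \<open>perp e c\<close>] k by auto
      next
        assume k: "2 \<le> disp e q"
        show ?thesis using k pos unfolding clear_perp[OF \<open>perp e c\<close>] by auto
      qed
    next
      case neg
      thus ?thesis unfolding clear_perp[OF \<open>perp e c\<close>] by auto
    qed
  qed
  moreover have "self_avoiding ?p" by (rule self_avoiding_zigzag[OF A perp])
  moreover have "self_avoiding ?q" using \<open>perp e c\<close> by (intro self_avoiding_zigzag[OF B]) (simp add: perp_commute)
  ultimately have "self_avoiding (?p @ ?q)" unfolding self_avoiding_append by blast
  thus ?thesis using A by (simp add: enc_snoc e_def)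
qed

section \<open>Segments and families in terms of runs\<close>

definition seg :: "runs \<Rightarrow> nat \<Rightarrow> nat \<times> nat" where
  "seg rs j = (start rs j + 1, start rs (Suc j) + 1)"

lemma orient_word_of:
  assumes "j < length rs" "start rs j + 2 \<le> i" "i \<le> start rs (Suc j) + 1"
  shows "orient (word_of rs) i = rdir rs j"
proof -
  have "i - 2 = start rs j + (i - 2 - start rs j)" "i - 2 - start rs j < rlen rs j"
    using assms by (auto simp: start_Suc)
  thus ?thesis unfolding orient_def using nth_word_of[OF assms(1)] by metis
qed

lemma orient_start:
  assumes "wf_runs rs" "j < length rs"
  shows "orient (word_of rs) (start rs j + 2) = rdir rs j"
    "orient (word_of rs) (start rs (Suc j) + 1) = rdir rs j"
  using orient_word_of[OF assms(2)] wf_runs_len[OF assms] start_Suc[OF assms(2)] by simp_all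

lemma link_eq_1_iff:
  "link w k = 1 \<longleftrightarrow> k \<le> 2 \<or> horizontal (orient w k) = horizontal (orient w (k - 1))"
  by (simp add: link_def Let_def)

lemma linear_part_word_of:
  assumes wf: "wf_runs rs"
  shows "linear_part (word_of rs) a b \<longleftrightarrow>
    a < b \<and> (\<exists>j<length rs. start rs j + 1 \<le> a \<and> b \<le> start rs (Suc j) + 1)"
proof
  assume lin: "linear_part (word_of rs) a b"
  hence ab: "1 \<le> a" "a < b" "b \<le> start rs (length rs) + 1"
    by (simp_all add: linear_part_def num_squares_word_of)
  hence "a - 1 < start rs (length rs)" by simp
  then obtain j where j: "j < length rs" "start rs j \<le> a - 1" "a - 1 < start rs (Suc j)"
    by (rule locate_run) simp
  have "b \<le> start rs (Suc j) + 1"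
  proof (rule ccontr)
    assume *: "\<not> b \<le> start rs (Suc j) + 1"
    hence "Suc j < length rs" using ab j by (metis Suc_lessI)
    moreover have "link (word_of rs) (start rs (Suc j) + 2) = 1"
      using lin * j ab unfolding linear_part_def by auto
    ultimately show False
      using orient_start[OF wf, of "Suc j"] orient_start[OF wf, of j] j ab wf_runs_perp[OF wf, of j]
      unfolding link_eq_1_iff perp_def by simp
  qed
  thus "a < b \<and> (\<exists>j<length rs. start rs j + 1 \<le> a \<and> b \<le> start rs (Suc j) + 1)"
    using j ab by (auto intro!: exI[of _ j])
next
  assume "a < b \<and> (\<exists>j<length rs. start rs j + 1 \<le> a \<and> b \<le> start rs (Suc j) + 1)"
  then obtain j where j: "a < b" "j < length rs" "start rs j + 1 \<le> a" "b \<le> start rs (Suc j) + 1" by blast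
  have "link (word_of rs) k = 1" if "k \<in> {a + 2..b}" for k
  proof -
    have "start rs j + 2 \<le> k - 1" "k - 1 \<le> start rs (Suc j) + 1" using j that by auto
    thus ?thesis using orient_word_of[OF j(2), of k] orient_word_of[OF j(2), of "k - 1"] j that
      unfolding link_eq_1_iff by simp
  qed
  moreover have "start rs (Suc j) \<le> start rs (length rs)"
    using start_less[OF wf, of "Suc j" "length rs"] j(2) by (cases "Suc j = length rs") auto
  ultimately show "linear_part (word_of rs) a b"
    using j by (simp add: linear_part_def num_squares_word_of)
qed

lemma start_mono: "wf_runs rs \<Longrightarrow> i \<le> j \<Longrightarrow> j \<le> length rs \<Longrightarrow> start rs i \<le> start rs j"
  using start_less[of rs i j] by (cases "i = j") auto

lemma segments_word_of:
  assumes wf: "wf_runs rs"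
  shows "segments (word_of rs) = seg rs ` {..<length rs}"
proof (intro equalityI subsetI)
  fix s assume s: "s \<in> segments (word_of rs)"
  obtain a b where ab: "s = (a, b)" by force
  obtain j where j: "a < b" "j < length rs" "start rs j + 1 \<le> a" "b \<le> start rs (Suc j) + 1"
    using s unfolding segments_def ab linear_part_word_of[OF wf] by auto
  have "linear_part (word_of rs) (start rs j + 1) (start rs (Suc j) + 1)"
    using j unfolding linear_part_word_of[OF wf] by auto
  hence "\<not> {a..b} \<subset> {start rs j + 1..start rs (Suc j) + 1}" using s unfolding segments_def ab by blast
  hence "s = seg rs j" using j unfolding ab seg_def by (auto simp: psubset_eq Icc_eq_Icc)
  thus "s \<in> seg rs ` {..<length rs}" using j by blast
next
  fix s assume "s \<in> seg rs ` {..<length rs}"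
  then obtain j where j: "j < length rs" "s = seg rs j" by blast
  have lt: "start rs j < start rs (Suc j)" using start_less[OF wf, of j "Suc j"] j by simp
  have "False" if lin: "linear_part (word_of rs) a b"
    and sub: "{start rs j + 1..start rs (Suc j) + 1} \<subset> {a..b}" for a b
  proof -
    obtain i where i: "a < b" "i < length rs" "start rs i + 1 \<le> a" "b \<le> start rs (Suc i) + 1"
      using lin unfolding linear_part_word_of[OF wf] by auto
    have ab: "a \<le> start rs j + 1" "start rs (Suc j) + 1 \<le> b"
      using sub lt by (auto simp: psubset_eq)
    have "start rs i < start rs (Suc j)" "start rs j < start rs (Suc i)" using i ab lt by linarith+
    hence "i = j" using start_less_iff[OF wf, of i "Suc j"] start_less_iff[OF wf, of j "Suc i"] i j by simp
    thus False using sub i ab by simp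
  qed
  thus "s \<in> segments (word_of rs)"
    using j lt unfolding segments_def seg_def by (auto simp: linear_part_word_of[OF wf])
qed

lemma inj_on_seg: "wf_runs rs \<Longrightarrow> inj_on (seg rs) {..<length rs}"
  by (auto simp: inj_on_def seg_def start_eq_iff)

lemma seg_length_seg: "j < length rs \<Longrightarrow> seg_length (seg rs j) = rlen rs j + 1"
  by (simp add: seg_length_def seg_def start_Suc)

lemma fst_seg_eq_1: "wf_runs rs \<Longrightarrow> j < length rs \<Longrightarrow> fst (seg rs j) = 1 \<longleftrightarrow> j = 0"
  using start_eq_iff[of rs j 0] by (simp add: seg_def)

lemma link_seg:
  assumes wf: "wf_runs rs" and j: "Suc j < length rs"
  shows "link (word_of rs) (fst (seg rs (Suc j)) + 1) =
    (if j = 0 \<or> rdir rs (Suc j) = rdir rs (j - 1) then 2 else 3)"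
proof -
  let ?w = "word_of rs" and ?k = "start rs (Suc j) + 2"
  define J where "J = {l. 1 < l \<and> l < ?k - 1 \<and> horizontal (orient ?w l) \<noteq> horizontal (orient ?w (?k - 1))}"
  have o: "orient ?w ?k = rdir rs (Suc j)" "orient ?w (?k - 1) = rdir rs j"
    using orient_start[OF wf, of "Suc j"] orient_start[OF wf, of j] j by auto
  have lt: "start rs j < start rs (Suc j)" using start_less[OF wf, of j "Suc j"] j by simp
  have "link ?w ?k = (if J = {} \<or> orient ?w ?k = orient ?w (Max J) then 2 else 3)"
    using o wf_runs_perp[OF wf j] lt by (simp add: link_def Let_def perp_def J_def)
  moreover have not_in: "l \<le> start rs j + 1" if "l \<in> J" for l
  proof (rule ccontr)
    assume "\<not> l \<le> start rs j + 1"
    thus False using that orient_word_of[of j rs l] j o unfolding J_def by simp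
  qed
  moreover have "J = {}" if "j = 0" using not_in that by (force simp: J_def)
  moreover have "J \<noteq> {} \<and> orient ?w (Max J) = rdir rs (j - 1)" if j0: "j \<noteq> 0"
  proof -
    obtain i where i: "j = Suc i" using j0 by (cases j) auto
    have oi: "orient ?w (start rs j + 1) = rdir rs i" using orient_start(2)[OF wf, of i] i j by simp
    have "0 < start rs j" using start_less[OF wf, of 0 j] i j by simp
    hence "start rs j + 1 \<in> J" using oi o lt wf_runs_perp[OF wf, of i] i j by (simp add: J_def perp_def)
    \<comment> \<open>The kink at which run \<open>j\<close> starts is reached by the last letter of
      run \<open>j - 1\<close>, and all later squares up to the link are reached along run
      \<open>j\<close>.\<close>
    moreover have "Max J = start rs j + 1"
      using calculation not_in by (intro Max_eqI finite_subset[of J "{..start rs j + 1}"]) auto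
    ultimately show ?thesis using oi i by auto
  qed
  ultimately show ?thesis using o by (cases "j = 0") (simp_all add: seg_def)
qed

lemma generated_by_seg:
  assumes wf: "wf_runs rs" and j: "j < length rs"
  shows "generated_by (word_of rs) (seg rs j) t \<longleftrightarrow>
    1 \<le> j \<and> t = (if j = 1 \<or> rdir rs j = rdir rs (j - 2) then 2 else 3)"
proof (cases j)
  case (Suc i)
  have "0 < start rs j" using start_less[OF wf, of 0 j] Suc j by simp
  thus ?thesis using link_seg[OF wf, of i] Suc j
    by (auto simp: generated_by_def seg_def diff_Suc split: if_splits nat.splits)
qed (simp add: generated_by_def seg_def)

lemma horizontal_rdir:
  assumes "wf_runs rs" "horizontal (rdir rs 0)" "j < length rs"
  shows "horizontal (rdir rs j) \<longleftrightarrow> even j"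
  using assms(3)
proof (induction j)
  case (Suc j)
  thus ?case using wf_runs_perp[OF assms(1), of j] by (auto simp: perp_def)
qed (simp add: assms(2))

lemma h_segments_word_of:
  assumes "wf_runs rs" "horizontal (rdir rs 0)"
  shows "h_segments (word_of rs) = seg rs ` {j. j < length rs \<and> even j}"
    "v_segments (word_of rs) = seg rs ` {j. j < length rs \<and> odd j}"
proof -
  have "horizontal (orient (word_of rs) (fst (seg rs j) + 1)) \<longleftrightarrow> even j" if "j < length rs" for j
    using orient_start(1)[OF assms(1) that] horizontal_rdir[OF assms that] by (simp add: seg_def)
  thus "h_segments (word_of rs) = seg rs ` {j. j < length rs \<and> even j}"
    "v_segments (word_of rs) = seg rs ` {j. j < length rs \<and> odd j}"
    unfolding h_segments_def v_segments_def segments_word_of[OF assms(1)] by auto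
qed

lemma segment_list_word_of:
  assumes wf: "wf_runs rs"
  shows "segment_list (word_of rs) = map (seg rs) [0..<length rs]"
  unfolding segment_list_def
proof (rule the_equality)
  have "sorted_wrt (<) (map fst (map (seg rs) [0..<length rs]))"
    using start_less[OF wf] by (auto simp: sorted_wrt_iff_nth_less seg_def)
  thus *: "sorted_wrt (<) (map fst (map (seg rs) [0..<length rs])) \<and>
      set (map (seg rs) [0..<length rs]) = segments (word_of rs)"
    unfolding segments_word_of[OF wf] by auto
  fix ss assume ss: "sorted_wrt (<) (map fst ss) \<and> set ss = segments (word_of rs)"
  have "set ss = set (map (seg rs) [0..<length rs])" using ss * by simp
  hence "set (map fst ss) = set (map fst (map (seg rs) [0..<length rs]))" by (simp only: set_map)
  hence "map fst ss = map fst (map (seg rs) [0..<length rs])"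
    using ss * by (intro sorted_distinct_set_unique) (auto simp: strict_sorted_iff)
  moreover have "inj_on fst (set ss \<union> set (map (seg rs) [0..<length rs]))"
    using ss * unfolding segments_word_of[OF wf]
    by (auto simp: inj_on_def seg_def start_eq_iff[OF wf])
  ultimately show "ss = map (seg rs) [0..<length rs]" by (rule map_inj_on)
qed

lemma card_seg_length:
  assumes "wf_runs rs" "S \<subseteq> {..<length rs}"
  shows "card {s \<in> seg rs ` S. seg_length s = Suc l} = card {j \<in> S. rlen rs j = l}"
proof -
  have "{s \<in> seg rs ` S. seg_length s = Suc l} = seg rs ` {j \<in> S. rlen rs j = l}"
    using assms(2) by (auto simp: seg_length_seg)
  thus ?thesis using inj_on_seg[OF assms(1)] assms(2)
    by (metis (no_types, lifting) card_image inj_on_subset mem_Collect_eq subsetI order_trans)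
qed

lemma card_seg: "wf_runs rs \<Longrightarrow> S \<subseteq> {..<length rs} \<Longrightarrow> card (seg rs ` S) = card S"
  using inj_on_seg by (metis card_image inj_on_subset)

lemma card_even_odd:
  "card {j::nat. j < r \<and> even j} = (r + 1) div 2" "card {j::nat. j < r \<and> odd j} = r div 2"
proof -
  have "card {j::nat. j < r \<and> even j} = (r + 1) div 2 \<and> card {j::nat. j < r \<and> odd j} = r div 2"
  proof (induction r)
    case (Suc r)
    have "{j. j < Suc r \<and> even j} = (if even r then insert r else id) {j. j < r \<and> even j}"
      "{j. j < Suc r \<and> odd j} = (if odd r then insert r else id) {j. j < r \<and> odd j}"
      by (auto simp: less_Suc_eq)
    thus ?case using Suc by (cases "even r") auto
  qed simp
  thus "card {j::nat. j < r \<and> even j} = (r + 1) div 2" "card {j::nat. j < r \<and> odd j} = r div 2"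
    by auto
qed

text \<open>A segment of \<open>l\<close> squares is a run of \<open>l - 1\<close> letters;
  \<open>0 < l\<close> keeps the truncated subtraction from identifying the lengths 0 and 1.\<close>

lemma C_family_word_of:
  assumes wf: "wf_runs rs" and chain: "general_polyomino_chain (word_of rs)"
    and ls: "\<forall>(l, \<alpha>)\<in>set ls. 0 < l" and h: "horizontal (rdir rs 0)"
  shows "word_of rs \<in> C_family ls \<longleftrightarrow>
    (\<forall>j<length rs. odd j \<longrightarrow> rlen rs j = 2) \<and>
    (\<forall>j. even j \<longrightarrow> Suc (Suc j) < length rs \<longrightarrow> rdir rs (Suc (Suc j)) \<noteq> rdir rs j) \<and>
    int ((length rs + 1) div 2) = sum_list (map snd ls) \<and>
    (\<forall>(l, \<alpha>)\<in>set ls. int (card {j. j < length rs \<and> even j \<and> rlen rs j = l - 1}) = \<alpha>)"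
proof -
  note hv = h_segments_word_of[OF wf h]
  have 1: "(\<forall>s\<in>v_segments (word_of rs). seg_length s = 3) \<longleftrightarrow> (\<forall>j<length rs. odd j \<longrightarrow> rlen rs j = 2)"
    unfolding hv by (auto simp: seg_length_seg)
  have gen: "(fst (seg rs j) \<noteq> 1 \<longrightarrow> generated_by (word_of rs) (seg rs j) 3) \<longleftrightarrow>
      (2 \<le> j \<longrightarrow> rdir rs j \<noteq> rdir rs (j - 2))" if "j < length rs" "even j" for j
    using that fst_seg_eq_1[OF wf that(1)] generated_by_seg[OF wf that(1), of 3]
    by (cases "j = 0"; cases "j = 1") auto
  have 2: "(\<forall>s\<in>h_segments (word_of rs). fst s \<noteq> 1 \<longrightarrow> generated_by (word_of rs) s 3) \<longleftrightarrow>
      (\<forall>j. even j \<longrightarrow> Suc (Suc j) < length rs \<longrightarrow> rdir rs (Suc (Suc j)) \<noteq> rdir rs j)"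
  proof -
    have "(\<forall>s\<in>h_segments (word_of rs). fst s \<noteq> 1 \<longrightarrow> generated_by (word_of rs) s 3) \<longleftrightarrow>
        (\<forall>j. j < length rs \<longrightarrow> even j \<longrightarrow> 2 \<le> j \<longrightarrow> rdir rs j \<noteq> rdir rs (j - 2))"
      unfolding hv using gen by blast
    also have "\<dots> \<longleftrightarrow> (\<forall>j. even j \<longrightarrow> Suc (Suc j) < length rs \<longrightarrow> rdir rs (Suc (Suc j)) \<noteq> rdir rs j)"
    proof (intro iffI allI impI)
      fix j assume *: "\<forall>j. j < length rs \<longrightarrow> even j \<longrightarrow> 2 \<le> j \<longrightarrow> rdir rs j \<noteq> rdir rs (j - 2)"
        "even j" "Suc (Suc j) < length rs"
      show "rdir rs (Suc (Suc j)) \<noteq> rdir rs j" using *(1)[rule_format, of "Suc (Suc j)"] *(2,3) by simp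
    next
      fix j assume *: "\<forall>j. even j \<longrightarrow> Suc (Suc j) < length rs \<longrightarrow> rdir rs (Suc (Suc j)) \<noteq> rdir rs j"
        "j < length rs" "even j" "2 \<le> j"
      have "Suc (Suc (j - 2)) = j" using *(4) by simp
      thus "rdir rs j \<noteq> rdir rs (j - 2)" using *(1)[rule_format, of "j - 2"] *(2-4) by simp
    qed
    finally show ?thesis .
  qed
  have 3: "card (h_segments (word_of rs)) = (length rs + 1) div 2"
    unfolding hv by (subst card_seg[OF wf]) (auto simp: card_even_odd)
  have 4: "card {s \<in> h_segments (word_of rs). seg_length s = l} =
      card {j. j < length rs \<and> even j \<and> rlen rs j = l - 1}" if "0 < l" for l
    using card_seg_length[OF wf, of "{j. j < length rs \<and> even j}" "l - 1"] that
    unfolding hv by (simp add: subset_iff conj_assoc)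
  have "(\<forall>(l, \<alpha>)\<in>set ls. int (card {s \<in> h_segments (word_of rs). seg_length s = l}) = \<alpha>) \<longleftrightarrow>
      (\<forall>(l, \<alpha>)\<in>set ls. int (card {j. j < length rs \<and> even j \<and> rlen rs j = l - 1}) = \<alpha>)"
    using ls 4 by (intro ball_cong) auto
  thus ?thesis unfolding C_family_def mem_Collect_eq 1 2 3 using chain by simp
qed

text \<open>The horizontal segment of pair \<open>a\<close> is run \<open>2 * a\<close>, the
  vertical one is run \<open>2 * a + 1\<close>, and each is compared with the run two places before.
  So \<open>a \<le> i\<close> becomes \<open>2 * a - 2 < 2 * i\<close>, and \<open>i < a\<close>
  becomes \<open>2 * i < 2 * a - 1\<close>.\<close>

lemma paired_chain_word_of:
  assumes wf: "wf_runs rs" and chain: "general_polyomino_chain (word_of rs)"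
    and h: "horizontal (rdir rs 0)" and i: "i \<le> m"
  shows "paired_chain m i (word_of rs) \<longleftrightarrow> length rs = 2 * m + 2 \<and>
    (\<forall>j. Suc (Suc j) < length rs \<longrightarrow>
      (rdir rs (Suc (Suc j)) \<noteq> rdir rs j \<longleftrightarrow> (if even j then j < 2 * i else 2 * i < j)))"
proof -
  let ?w = "word_of rs" and ?r = "length rs"
  note hv = h_segments_word_of[OF wf h]
  have len: "card (h_segments ?w) = m + 1 \<and> card (v_segments ?w) = m + 1 \<longleftrightarrow> ?r = 2 * m + 2"
    unfolding hv by (subst (1 2) card_seg[OF wf]) (auto simp: card_even_odd)
  have "(\<forall>j\<le>m. let h = segment_list ?w ! (2 * j); v = segment_list ?w ! (2 * j + 1) in
        if j \<le> i then (j = 0 \<or> generated_by ?w h 3) \<and> generated_by ?w v 2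
        else generated_by ?w h 2 \<and> generated_by ?w v 3) \<longleftrightarrow>
    (\<forall>j. Suc (Suc j) < ?r \<longrightarrow>
      (rdir rs (Suc (Suc j)) \<noteq> rdir rs j \<longleftrightarrow> (if even j then j < 2 * i else 2 * i < j)))" (is "?L \<longleftrightarrow> ?R")
    if r: "?r = 2 * m + 2"
  proof -
    have gen: "generated_by ?w (segment_list ?w ! (2 * j)) t \<longleftrightarrow>
        1 \<le> j \<and> t = (if rdir rs (2 * j) = rdir rs (2 * j - 2) then 2 else 3)"
      "generated_by ?w (segment_list ?w ! Suc (2 * j)) t \<longleftrightarrow>
        t = (if j = 0 \<or> rdir rs (Suc (2 * j)) = rdir rs (2 * j - 1) then 2 else 3)"
      if "j \<le> m" for j t
      using that r generated_by_seg[OF wf, of "2 * j" t] generated_by_seg[OF wf, of "Suc (2 * j)" t]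
      unfolding segment_list_word_of[OF wf] by (auto simp del: upt_Suc)
    have "?L \<longleftrightarrow> (\<forall>j\<le>m. 1 \<le> j \<longrightarrow> (rdir rs (2 * j) \<noteq> rdir rs (2 * j - 2) \<longleftrightarrow> j \<le> i) \<and>
        (rdir rs (2 * j + 1) \<noteq> rdir rs (2 * j - 1) \<longleftrightarrow> i < j))"
      unfolding Let_def by (intro all_cong1 imp_cong refl) (auto simp: gen)
    also have "\<dots> \<longleftrightarrow> ?R"
    proof (rule iffI; intro allI impI)
      fix j assume *: "\<forall>j\<le>m. 1 \<le> j \<longrightarrow> (rdir rs (2 * j) \<noteq> rdir rs (2 * j - 2) \<longleftrightarrow> j \<le> i) \<and>
        (rdir rs (2 * j + 1) \<noteq> rdir rs (2 * j - 1) \<longleftrightarrow> i < j)" "Suc (Suc j) < ?r"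
      show "rdir rs (Suc (Suc j)) \<noteq> rdir rs j \<longleftrightarrow> (if even j then j < 2 * i else 2 * i < j)"
      proof (cases "even j")
        case True
        then obtain a where "j = 2 * a" by (elim evenE)
        thus ?thesis using *(1)[rule_format, of "Suc a"] *(2) r by auto
      next
        case False
        then obtain a where "j = 2 * a + 1" by (elim oddE)
        thus ?thesis using *(1)[rule_format, of "Suc a"] *(2) r by auto
      qed
    next
      fix j assume R: ?R and j: "j \<le> m" "1 \<le> j"
      then obtain a where a: "j = Suc a" by (cases j) auto
      show "(rdir rs (2 * j) \<noteq> rdir rs (2 * j - 2) \<longleftrightarrow> j \<le> i) \<and>
        (rdir rs (2 * j + 1) \<noteq> rdir rs (2 * j - 1) \<longleftrightarrow> i < j)"
        using R[rule_format, of "2 * a"] R[rule_format, of "2 * a + 1"] j r unfolding a by auto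
    qed
    finally show ?thesis .
  qed
  thus ?thesis unfolding paired_chain_def using len chain by blast
qed

section \<open>Isomorphisms of chains\<close>

fun mirror :: "orientation \<Rightarrow> orientation" where
  "mirror Upwards = Downwards"
| "mirror Downwards = Upwards"
| "mirror Rightwards = Rightwards"
| "mirror Leftwards = Leftwards"

lemma mirror_mirror [simp]: "mirror (mirror d) = d"
  by (cases d) auto

lemma disp_mirror: "disp Rightwards (map mirror v) = disp Rightwards v"
  "disp Upwards (map mirror v) = - disp Upwards v"
proof -
  have "dirc Rightwards (mirror d) = dirc Rightwards d" "dirc Upwards (mirror d) = - dirc Upwards d" for d
    by (cases d; simp add: dirc_def)+
  thus "disp Rightwards (map mirror v) = disp Rightwards v"
    "disp Upwards (map mirror v) = - disp Upwards v"
    by (induction v) simp_all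
qed

lemma num_squares_mirror [simp]: "num_squares (map mirror w) = num_squares w"
  by (simp add: num_squares_def)

lemma pos_mirror: "pos (map mirror w) i = (fst (pos w i), - snd (pos w i))"
  by (simp add: pos_def take_map disp_mirror)

text \<open>Reflection in the horizontal midline of square 1: the square at height \<open>y\<close>
  goes to the one at height \<open>-y\<close>.\<close>

definition reflect :: "complex \<Rightarrow> complex" where
  "reflect z = Complex (Re z) (1 - Im z)"

lemma inj_reflect: "inj reflect"
  by (auto simp: inj_def reflect_def complex_eq_iff)

lemma reflect_reflect [simp]: "reflect (reflect z) = z"
  by (simp add: reflect_def)

lemma reflect_lat: "reflect (lat p) = lat (fst p, 1 - snd p)"
  by (simp add: reflect_def complex_eq_iff)

lemma reflect_corners_at: "reflect ` corners_at p = corners_at (fst p, - snd p)"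
proof -
  have "reflect z \<in> corners_at (fst p, - snd p) \<longleftrightarrow> z \<in> corners_at p" for z
    by (auto simp: reflect_def mem_corners_at)
  thus ?thesis by (metis (no_types, lifting) image_eqI reflect_reflect subsetI subset_antisym image_subset_iff)
qed

lemma reflect_sides_at: "image reflect ` sides_at p = sides_at (fst p, - snd p)"
  by (auto simp: sides_at_def hedge_def vedge_def reflect_lat insert_commute)

lemma reflect_corners: "reflect ` corners w i = corners (map mirror w) i"
  by (simp add: corners_eq reflect_corners_at pos_mirror)

lemma reflect_graph_of: "{reflect u, reflect v} \<in> graph_of (map mirror w) \<longleftrightarrow> {u, v} \<in> graph_of w"
proof -
  have "graph_of (map mirror w) = image reflect ` graph_of w"
    by (simp add: graph_of_eq pos_mirror image_Union image_image reflect_sides_at image_UN)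
  moreover have "{reflect u, reflect v} = reflect ` {u, v}" by simp
  ultimately show ?thesis using inj_image_mem_iff[OF inj_image_eq_iff[OF inj_reflect, THEN iffD1, THEN injI]]
    by metis
qed

lemma vertices_corners: "\<Union> (graph_of w) = (\<Union>i\<in>{1..num_squares w}. corners w i)"
  by (simp add: vertices_eq corners_eq)

definition square_iso :: "(complex \<Rightarrow> complex) \<Rightarrow> chain_word \<Rightarrow> chain_word \<Rightarrow> bool" where
  "square_iso f w w' \<longleftrightarrow> bij_betw f (\<Union>(graph_of w)) (\<Union>(graph_of w')) \<and>
     (\<forall>u\<in>\<Union>(graph_of w). \<forall>v\<in>\<Union>(graph_of w). {u, v} \<in> graph_of w \<longleftrightarrow> {f u, f v} \<in> graph_of w') \<and>
     (\<forall>i\<in>{1..num_squares w}. f ` corners w i = corners w' i)"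

lemma square_iso_mirror: "square_iso reflect w (map mirror w)"
proof -
  have "reflect ` \<Union> (graph_of w) = \<Union> (graph_of (map mirror w))"
    by (simp add: vertices_corners image_UN reflect_corners)
  thus ?thesis
    using inj_reflect by (simp add: square_iso_def bij_betw_def inj_on_subset[of _ UNIV] reflect_corners reflect_graph_of)
qed

lemma square_iso_comp:
  assumes "square_iso f w w'" "square_iso g w' w''" "num_squares w = num_squares w'"
  shows "square_iso (g \<circ> f) w w''"
proof -
  have "f u \<in> \<Union> (graph_of w')" if "u \<in> \<Union> (graph_of w)" for u
    using assms(1) that unfolding square_iso_def bij_betw_def by blast
  thus ?thesis
    using assms bij_betw_trans[of f "\<Union> (graph_of w)" "\<Union> (graph_of w')" g "\<Union> (graph_of w'')"]
    unfolding square_iso_def image_comp[symmetric] by simp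
qed

lemma unit_edge_lat: "unit_edge {lat p, lat q} \<Longrightarrow> \<bar>fst p - fst q\<bar> + \<bar>snd p - snd q\<bar> = 1"
  by (auto simp: unit_edge_def hedge_def vedge_def doubleton_eq_iff)

text \<open>With two adjacent corners fixed, the other two could at most be exchanged, and this
  would turn a side of the square into a diagonal.\<close>

lemma fixed_square:
  assumes e: "e \<in> sides_at q" "\<forall>z\<in>e. f z = z" and im: "f ` corners_at q = corners_at q"
    and inj: "inj_on f (corners_at q)" and adj: "\<And>u v. {u, v} \<in> sides_at q \<Longrightarrow> unit_edge {f u, f v}"
  shows "\<forall>z\<in>corners_at q. f z = z"
proof -
  have fixed: "f (lat v) = lat v \<and> f (lat v') = lat v'"
    if c: "corners_at q = {lat p, lat p', lat v, lat v'}" and fp: "f (lat p) = lat p" "f (lat p') = lat p'"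
      and edges: "{lat p, lat v} \<in> sides_at q"
      and opposite: "\<bar>fst p - fst v'\<bar> + \<bar>snd p - snd v'\<bar> = 2" and dist: "distinct [p, p', v, v']"
    for p p' v v'
  proof -
    have mem: "f (lat v) \<in> {lat p, lat p', lat v, lat v'}" "f (lat v') \<in> {lat p, lat p', lat v, lat v'}"
      using im unfolding c by blast+
    have eq: "f (lat a) = f (lat b) \<longleftrightarrow> a = b" if "a \<in> {p, p', v, v'}" "b \<in> {p, p', v, v'}" for a b
      using inj_on_eq_iff[OF inj, of "lat a" "lat b"] that unfolding c by auto
    have neq: "f (lat v) \<noteq> lat p" "f (lat v) \<noteq> lat p'" "f (lat v') \<noteq> lat p" "f (lat v') \<noteq> lat p'"
      "f (lat v) \<noteq> f (lat v')"
      using eq[of v p] eq[of v p'] eq[of v' p] eq[of v' p'] eq[of v v'] fp dist by auto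
    have "f (lat v) \<noteq> lat v'"
    proof
      assume "f (lat v) = lat v'"
      hence "unit_edge {lat p, lat v'}" using adj[OF edges] fp by simp
      thus False using unit_edge_lat opposite by fastforce
    qed
    thus ?thesis using mem neq by auto
  qed
  obtain x y where q: "q = (x, y)" by force
  have c: "corners_at q = {lat (x, y), lat (x + 1, y), lat (x, y + 1), lat (x + 1, y + 1)}"
    by (auto simp: corners_at_def q)
  consider "e = hedge (x, y)" | "e = vedge (x + 1, y)" | "e = hedge (x, y + 1)" | "e = vedge (x, y)"
    using e(1) by (auto simp: sides_at_def q)
  thus ?thesis
  proof cases
    case 1
    thus ?thesis using e(2) fixed[of "(x, y)" "(x + 1, y)" "(x, y + 1)" "(x + 1, y + 1)"]
      unfolding c by (simp add: hedge_def vedge_def sides_at_def q insert_commute)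
  next
    case 2
    thus ?thesis using e(2) fixed[of "(x + 1, y)" "(x + 1, y + 1)" "(x, y)" "(x, y + 1)"]
      unfolding c by (simp add: hedge_def vedge_def sides_at_def q insert_commute)
  next
    case 3
    thus ?thesis using e(2) fixed[of "(x, y + 1)" "(x + 1, y + 1)" "(x, y)" "(x + 1, y)"]
      unfolding c by (simp add: hedge_def vedge_def sides_at_def q insert_commute)
  next
    case 4
    thus ?thesis using e(2) fixed[of "(x, y)" "(x, y + 1)" "(x + 1, y)" "(x + 1, y + 1)"]
      unfolding c by (simp add: hedge_def vedge_def sides_at_def q insert_commute)
  qed
qed

lemma shared_edge_inj: "shared_edge p d \<subseteq> shared_edge p d' \<Longrightarrow> d = d'"
  by (cases d; cases d') (auto simp: hedge_def vedge_def prod_eq_iff)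

text \<open>Fixing one side pointwise fixes the first square. The side shared with the next square
  is then fixed too, which determines the next letter and fixes the next square.\<close>

lemma square_iso_rigid:
  assumes iso: "square_iso f w w'" and n: "num_squares w = num_squares w'"
    and first: "\<forall>z\<in>vedge (1, 0). f z = z"
  shows "w = w'"
proof -
  have adj: "unit_edge {f u, f v}" if "{u, v} \<in> sides_at (pos w i)" "1 \<le> i" "i \<le> num_squares w" for u v i
  proof -
    have "{u, v} \<in> graph_of w" using sides_subset_graph_of[OF that(2,3)] that(1) by blast
    thus ?thesis using iso unit_edge_graph_of unfolding square_iso_def by blast
  qed
  have inj: "inj_on f (corners_at (pos w i))" if "1 \<le> i" "i \<le> num_squares w" for i
    using iso that unfolding square_iso_def bij_betw_def vertices_eq
    by (metis (no_types, lifting) UN_upper atLeastAtMost_iff inj_on_subset)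
  have im: "f ` corners_at (pos w i) = corners_at (pos w' i)" if "1 \<le> i" "i \<le> num_squares w" for i
    using iso that unfolding square_iso_def corners_eq by simp
  have "take (j - 1) w = take (j - 1) w' \<and> (\<forall>z\<in>corners_at (pos w j). f z = z)"
    if "1 \<le> j" "j \<le> num_squares w" for j
    using that
  proof (induction j rule: nat_induct_at_least)
    case base
    have "vedge (1, 0) \<in> sides_at (pos w 1)" by (simp add: sides_at_def)
    thus ?case using fixed_square[OF _ first, of "pos w 1"] adj[of _ _ 1] inj[of 1] im[of 1] base by simp
  next
    case (Suc j)
    let ?p = "pos w j" and ?d = "w ! (j - 1)" and ?d' = "w' ! (j - 1)"
    have IH: "take (j - 1) w = take (j - 1) w'" "\<forall>z\<in>corners_at ?p. f z = z" using Suc by auto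
    have p: "pos w' j = ?p" using IH(1) by (simp add: pos_def)
    have next_pos: "pos w (Suc j) = shift ?p ?d" "pos w' (Suc j) = shift ?p ?d'"
      using pos_Suc_shift[of j w] pos_Suc_shift[of j w'] Suc n p by auto
    have fixed: "\<forall>z\<in>shared_edge ?p ?d. f z = z"
      using IH(2) side_subset_corners[OF shared_edge_sides(1)] by blast
    have "f ` shared_edge ?p ?d \<subseteq> corners_at (pos w' (Suc j))"
      unfolding im[OF _ Suc.prems, symmetric, simplified] next_pos(1)
      by (intro image_mono side_subset_corners shared_edge_sides)
    hence "shared_edge ?p ?d \<subseteq> corners_at (pos w' (Suc j))" using fixed by auto
    hence "shared_edge ?p ?d \<subseteq> shared_edge ?p ?d'"
      using side_subset_corners[OF shared_edge_sides(1), of ?p ?d] corners_shift[of ?p ?d'] next_pos by auto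
    hence d: "?d = ?d'" by (rule shared_edge_inj)
    have "take j w = take j w'"
      using IH(1) d Suc n take_Suc_conv_app_nth[of "j - 1" w] take_Suc_conv_app_nth[of "j - 1" w']
      by (simp add: num_squares_def)
    moreover have "\<forall>z\<in>corners_at (pos w (Suc j)). f z = z"
      using fixed_square[OF _ fixed, of "pos w (Suc j)"] adj[of _ _ "Suc j"] inj[of "Suc j"] im[of "Suc j"]
        Suc.prems next_pos d shared_edge_sides(2) by simp
    ultimately show ?case by simp
  qed
  from this[of "num_squares w"] n show ?thesis by (simp add: num_squares_def)
qed

text \<open>An isomorphism maps the common side of squares 1 and 2 to itself. If it exchanges the
  two ends, composition with the reflection leads to the rigid case.\<close>

lemma chain_iso_iff:
  "(w, w') \<in> chain_iso \<longleftrightarrow> general_polyomino_chain w \<and> general_polyomino_chain w' \<and>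
     (w' = w \<or> w' = map mirror w)"
proof
  assume "(w, w') \<in> chain_iso"
  then obtain f where c: "general_polyomino_chain w" "general_polyomino_chain w'"
    and n: "num_squares w = num_squares w'" and f: "square_iso f w w'"
    unfolding chain_iso_def square_iso_def by blast
  have hd: "w \<noteq> []" "w' \<noteq> []" "hd w = Rightwards" "hd w' = Rightwards"
    using c by (auto simp: general_polyomino_chain_iff)
  hence n2: "1 < num_squares w" "1 < num_squares w'" by (auto simp: num_squares_def)
  have e: "corners_at (pos v 1) \<inter> corners_at (pos v 2) = vedge (1, 0)"
    if "v \<noteq> []" "hd v = Rightwards" for v
    using that corners_Int_Suc[of 1 v] by (cases v) (auto simp: num_squares_def shared_def numeral_2_eq_2)
  have V: "corners_at (pos w i) \<subseteq> \<Union> (graph_of w)" if "1 \<le> i" "i \<le> num_squares w" for i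
    using that by (auto simp: vertices_eq)
  have "f ` vedge (1, 0) = vedge (1, 0)"
  proof -
    have inj: "inj_on f (\<Union> (graph_of w))" using f by (simp add: square_iso_def bij_betw_def)
    have im: "f ` corners_at (pos w i) = corners_at (pos w' i)" if "1 \<le> i" "i \<le> num_squares w" for i
      using f that by (simp add: square_iso_def corners_eq)
    have "f ` (corners_at (pos w 1) \<inter> corners_at (pos w 2)) =
        f ` corners_at (pos w 1) \<inter> f ` corners_at (pos w 2)"
      by (rule inj_on_image_Int[OF inj V V]) (use n2 in simp_all)
    thus ?thesis using im[of 1] im[of 2] n2 e[OF hd(1,3)] e[OF hd(2,4)] by simp
  qed
  moreover have "vedge (1, 0) = {lat (1, 0), lat (1, 1)}" by (simp add: vedge_def)
  ultimately consider "\<forall>z\<in>vedge (1, 0). f z = z"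
    | "f (lat (1, 0)) = lat (1, 1)" "f (lat (1, 1)) = lat (1, 0)"
    by (auto simp: doubleton_eq_iff)
  hence "w' = w \<or> map mirror w' = w"
  proof cases
    case 1
    thus ?thesis using square_iso_rigid[OF f n] by simp
  next
    case 2
    have "square_iso (reflect \<circ> f) w (map mirror w')"
      by (rule square_iso_comp[OF f square_iso_mirror n])
    moreover have "\<forall>z\<in>vedge (1, 0). (reflect \<circ> f) z = z" using 2 by (simp add: vedge_def reflect_lat)
    ultimately show ?thesis using square_iso_rigid[of "reflect \<circ> f" w "map mirror w'"] n by simp
  qed
  moreover have "w' = map mirror w" if "map mirror w' = w"
    using that by (auto simp: comp_def)
  ultimately show "general_polyomino_chain w \<and> general_polyomino_chain w' \<and> (w' = w \<or> w' = map mirror w)"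
    using c by blast
next
  assume c: "general_polyomino_chain w \<and> general_polyomino_chain w' \<and> (w' = w \<or> w' = map mirror w)"
  moreover have "square_iso id w w" by (simp add: square_iso_def)
  ultimately show "(w, w') \<in> chain_iso"
    using square_iso_mirror[of w] unfolding chain_iso_def square_iso_def by auto
qed

section \<open>Counting\<close>

text \<open>The last equation counts squares: the first run has \<open>2 + s\<close> letters, a
  U-turn item adds \<open>4 + t\<close>, any other item adds \<open>2 + t\<close>, and the total is
  \<open>k + 4 * m - 1\<close>.\<close>

definition codes :: "nat \<Rightarrow> nat \<Rightarrow> (nat \<times> items) set" where
  "codes m k = {(s, its). uturns_of its = m \<and> 2 * length its + s + slack its + 3 = k + 2 * m}"

definition code_word :: "orientation \<Rightarrow> nat \<times> items \<Rightarrow> chain_word" where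
  "code_word c x = word_of (enc Rightwards c (fst x) (snd x))"

lemma zigzag_iff: "zigzag its \<longleftrightarrow> length its = uturns_of its"
  by (metis filter_True list_all_iff length_filter_less less_irrefl)

text \<open>Beyond the shortest chain with \<open>m\<close> U-turns there are
  \<open>k - 3 \<le> 3\<close> letters, and an item that is not a U-turn takes two of them, so there
  is at most one such item.\<close>

lemma length_code:
  assumes "(s, its) \<in> codes m k" "k \<le> 6"
  shows "length its = m \<or> length its = Suc m"
proof -
  have "uturns_of its = m" "2 * length its \<le> 2 * m + 3" using assms by (auto simp: codes_def)
  moreover have "uturns_of its \<le> length its" by (rule length_filter_le)
  ultimately show ?thesis by arith
qed

lemma codes_cases:
  assumes "(s, its) \<in> codes m k" "k \<le> 6"
  obtains (zigzag) "zigzag its" "length its = m" "s + slack its + 3 = k"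
  | (two_zigzags) A t B where "its = A @ (False, t) # B" "zigzag A" "zigzag B" "length A + length B = m"
      "s + slack A + t + slack B + 5 = k"
proof -
  consider "length its = m" | "length its = Suc m" using length_code[OF assms] by blast
  thus ?thesis
  proof cases
    case 1
    thus ?thesis using assms zigzag by (simp add: codes_def zigzag_iff)
  next
    case 2
    hence "\<not> zigzag its" using assms by (simp add: codes_def zigzag_iff)
    then obtain t where "(False, t) \<in> set its" by (auto simp: list_all_iff)
    then obtain A B where its: "its = A @ (False, t) # B" by (meson split_list)
    have "uturns_of A \<le> length A" "uturns_of B \<le> length B" by (simp_all add: length_filter_le)
    moreover have "uturns_of A + uturns_of B = m" "length A + length B = m"
      using 2 assms its by (auto simp: codes_def)
    ultimately have "zigzag A" "zigzag B" unfolding zigzag_iff by linarith+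
    thus ?thesis using two_zigzags[OF its] 2 assms its by (auto simp: codes_def)
  qed
qed

lemma self_avoiding_code:
  assumes "(s, its) \<in> codes m k" "k \<le> 6" "perp d c"
  shows "self_avoiding (word_of (enc d c s its))"
  using assms(1,2)
proof (cases rule: codes_cases)
  case zigzag
  thus ?thesis using self_avoiding_zigzag assms(3) by blast
next
  case (two_zigzags A t B)
  thus ?thesis using self_avoiding_two_zigzags[OF _ _ assms(3)] assms(2) by simp
qed

lemma num_squares_code:
  assumes "(s, its) \<in> codes m k"
  shows "num_squares (word_of (enc d c s its)) = k + 4 * m"
  using assms length_word_of_enc[of d c s its] by (auto simp: codes_def num_squares_def)

abbreviation updown :: "orientation set" where
  "updown \<equiv> {Upwards, Downwards}"

lemma perp_updown: "c \<in> updown \<longleftrightarrow> perp Rightwards c"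
  by (cases c) (auto simp: perp_def horizontal_def)

lemma hd_word_of_enc: "hd (word_of (enc d c s its)) = d"
  using hd_enc[of d c s its] by auto

lemma word_of_eq_Nil_iff: "wf_runs rs \<Longrightarrow> word_of rs \<noteq> []"
  by (cases rs) (auto simp: wf_runs_def)

lemma code_word_chain:
  assumes "x \<in> codes m k" "k \<le> 6" "c \<in> updown"
  shows "code_word c x \<in> polyomino_chains (k + 4 * m)"
  using assms self_avoiding_code[of "fst x" "snd x" m k Rightwards c] num_squares_code[of "fst x" "snd x" m k]
    word_of_eq_Nil_iff[OF wf_enc]
  by (simp add: polyomino_chains_def general_polyomino_chain_iff code_word_def hd_word_of_enc
      perp_updown[of c, symmetric] flip: perp_updown)

lemma chain_runs:
  assumes "w \<in> polyomino_chains n"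
  obtains rs where "wf_runs rs" "word_of rs = w" "self_avoiding (word_of rs)" "rdir rs 0 = Rightwards"
    "num_squares (word_of rs) = n"
proof -
  have w: "self_avoiding w" "w \<noteq> []" "hd w = Rightwards" "num_squares w = n"
    using assms by (auto simp: polyomino_chains_def general_polyomino_chain_iff)
  obtain rs where rs: "wf_runs rs" "word_of rs = w" by (rule self_avoiding_ex_runs[OF w(1,2)])
  obtain p rs' where "rs = p # rs'" using rs(1) by (cases rs) (auto simp: wf_runs_def)
  hence "hd w = rdir rs 0" using rs wf_runs_len[OF rs(1), of 0] by auto
  thus ?thesis using that rs w by metis
qed

lemma R_chain_code:
  assumes "x \<in> codes m k" "3 \<le> k" "k \<le> 6" "c \<in> updown"
  shows "R_chain (code_word c x) = 11 / 18 + real k / 3 + 193 / 144 * real m"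
proof -
  have p: "perp Rightwards c" using assms(4) by (simp flip: perp_updown)
  obtain s its where x: "x = (s, its)" by force
  have "uturns_of its = m" using assms(1) by (auto simp: x codes_def)
  hence "tight (enc Rightwards c s its) m" using tight_enc by metis
  thus ?thesis
    using R_chain_bound(2)[OF wf_enc[OF p] self_avoiding_code num_squares_code, of s its m k m k] assms p
    by (simp add: code_word_def x)
qed

lemma code_exists: "3 \<le> k \<Longrightarrow> (k - 3, replicate m (True, 0)) \<in> codes m k"
  by (simp add: codes_def sum_list_replicate)

text \<open>The bound is attained by a coded chain, so the maximal chains are those with equality in
  \<open>R_chain_bound\<close>.\<close>

lemma maximal_iff_tight:
  assumes k: "3 \<le> k" "k \<le> 6" and n: "num_squares (word_of rs) = k + 4 * m"
    and wf: "wf_runs rs" and chain: "word_of rs \<in> polyomino_chains (k + 4 * m)"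
  shows "word_of rs \<in> maximal_chains (k + 4 * m) \<longleftrightarrow> tight rs m"
proof -
  let ?A = "11 / 18 + real k / 3 + 193 / 144 * real m"
  have le: "R_chain w \<le> ?A" if "w \<in> polyomino_chains (k + 4 * m)" for w
    using chain_runs[OF that] R_chain_bound(1)[OF _ _ _ k] by metis
  obtain w where w: "w \<in> polyomino_chains (k + 4 * m)" "R_chain w = ?A"
    using code_word_chain[OF code_exists[OF k(1)] k(2), of Upwards m]
      R_chain_code[OF code_exists[OF k(1)] k, of Upwards m] by blast
  have "word_of rs \<in> maximal_chains (k + 4 * m) \<longleftrightarrow> R_chain (word_of rs) = ?A"
  proof
    assume "word_of rs \<in> maximal_chains (k + 4 * m)"
    hence "R_chain w \<le> R_chain (word_of rs)" using w(1) by (simp add: maximal_chains_def)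
    thus "R_chain (word_of rs) = ?A" using le[OF chain] w(2) by linarith
  next
    assume "R_chain (word_of rs) = ?A"
    thus "word_of rs \<in> maximal_chains (k + 4 * m)" using chain le by (simp add: maximal_chains_def)
  qed
  also have "\<dots> \<longleftrightarrow> tight rs m"
    using chain n by (intro R_chain_bound(2) wf k) (auto simp: polyomino_chains_def general_polyomino_chain_iff)
  finally show ?thesis .
qed

lemma maximal_chains_code:
  assumes k: "3 \<le> k" "k \<le> 6"
  shows "maximal_chains (k + 4 * m) = (\<Union>c\<in>updown. code_word c ` codes m k)"
proof (intro equalityI subsetI)
  fix w assume w: "w \<in> maximal_chains (k + 4 * m)"
  hence "w \<in> polyomino_chains (k + 4 * m)" by (simp add: maximal_chains_def)
  then obtain rs where rs: "wf_runs rs" "word_of rs = w" "self_avoiding (word_of rs)"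
    "rdir rs 0 = Rightwards" "num_squares (word_of rs) = k + 4 * m"
    by (rule chain_runs)
  have t: "tight rs m"
    using maximal_iff_tight[OF k rs(5,1)] w rs(2) by (simp add: maximal_chains_def)
  \<comment> \<open>A chain with a single run never turns; any vertical direction serves as
    \<open>c\<close> then.\<close>
  define c where "c = (if 2 \<le> length rs then rdir rs 1 else Upwards)"
  have c: "c \<in> updown" using wf_runs_perp[OF rs(1), of 0] rs(4) unfolding c_def perp_updown
    by (auto simp: perp_def horizontal_def)
  obtain s its where enc: "rs = enc Rightwards c s its"
    using ex_enc[OF rs(1,3,5) k(2) t, of c] rs(4) by (auto simp: c_def)
  have u: "uturns_of its = m" using t tight_enc[of Rightwards c s its] by (simp add: enc tight_def)
  hence "(s, its) \<in> codes m k"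
    using length_word_of_enc[of Rightwards c s its] rs(5) k
    by (simp add: codes_def enc num_squares_def)
  thus "w \<in> (\<Union>c\<in>updown. code_word c ` codes m k)"
    using c rs(2) by (auto simp: code_word_def enc image_iff intro!: bexI[of _ "(s, its)"])
next
  fix w assume "w \<in> (\<Union>c\<in>updown. code_word c ` codes m k)"
  then obtain c x where x: "c \<in> updown" "x \<in> codes m k" "w = code_word c x" by blast
  have "uturns_of (snd x) = m" using x(2) by (auto simp: codes_def)
  hence "tight (enc Rightwards c (fst x) (snd x)) m" using tight_enc by metis
  thus "w \<in> maximal_chains (k + 4 * m)"
    using maximal_iff_tight[OF k _ wf_enc] code_word_chain[OF x(2) k(2) x(1)] x(1)
      num_squares_code[of "fst x" "snd x" m k] x(2)
    unfolding x(3) code_word_def perp_updown by simp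
qed

section \<open>Uniqueness of codes and isomorphism classes\<close>

lemma perp_neq: "perp a b \<Longrightarrow> a \<noteq> b"
  by auto

lemma word_of_inj: "wf_runs rs \<Longrightarrow> wf_runs rs' \<Longrightarrow> word_of rs = word_of rs' \<Longrightarrow> rs = rs'"
proof (induction rs arbitrary: rs')
  case (Cons p rs)
  \<comment> \<open>The first run can be read off the word, since the next run begins with a
    different letter.\<close>
  have tw: "takeWhile (\<lambda>x. x = fst q) (word_of (q # qs)) = replicate (snd q) (fst q) \<and> hd (word_of (q # qs)) = fst q \<and>
      (qs = [] \<or> wf_runs qs)" if "wf_runs (q # qs)" for q qs
  proof (cases qs)
    case Nil
    thus ?thesis using that by (cases "snd q") (auto simp: wf_runs_def takeWhile_eq_all_conv)
  next
    case (Cons q' qs')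
    have "1 \<le> snd q'" "perp (fst q) (fst q')" using that Cons by (auto simp: wf_runs_def)
    then obtain a where "snd q' = Suc a" "fst q \<noteq> fst q'" by (cases "snd q'") (auto dest: perp_neq)
    moreover from this have "word_of qs = fst q' # replicate a (fst q') @ word_of qs'" using Cons by simp
    moreover have "1 \<le> snd q" "wf_runs qs" using that Cons by (auto simp: wf_runs_def)
    moreover have "takeWhile (\<lambda>x. x = fst q) (replicate (snd q) (fst q) @ v) =
        replicate (snd q) (fst q) @ takeWhile (\<lambda>x. x = fst q) v" for v
      by (rule takeWhile_append2) auto
    ultimately show ?thesis by (simp add: hd_append)
  qed
  obtain p' rs'' where rs': "rs' = p' # rs''" using Cons.prems(2) by (cases rs') (auto simp: wf_runs_def)
  note 1 = tw[OF Cons.prems(1)] and 2 = tw[OF Cons.prems(2)[unfolded rs']]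
  have "fst p = fst p'" using 1 2 Cons.prems(3) rs' by metis
  moreover from this have "snd p = snd p'" using 1 2 Cons.prems(3) rs' by (metis length_replicate)
  ultimately have p: "p = p'" by (simp add: prod_eq_iff)
  hence eq: "word_of rs = word_of rs''" using Cons.prems(3) rs' by simp
  have "rs = rs''"
  proof (cases "rs = [] \<or> rs'' = []")
    case True
    thus ?thesis using eq 1 2 word_of_eq_Nil_iff by (metis word_of_simps(1))
  next
    case False
    thus ?thesis using Cons.IH[of rs''] eq 1 2 by blast
  qed
  thus ?case using p rs' by simp
qed (simp add: wf_runs_def)

text \<open>A U-turn item produces a third run in direction \<open>opp d\<close>, whereas a third
  run after a single-run item goes in direction \<open>d\<close>. The directions \<open>c\<close>
  and \<open>c'\<close> may differ because a single run does not show them.\<close>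

lemma enc_inj: "enc d c s its = enc d c' s' its' \<Longrightarrow> s = s' \<and> its = its'"
proof (induction d c s its arbitrary: c' s' its' rule: enc_induct)
  case (Nil d c s)
  thus ?case by (cases "(d, c', s', its')" rule: enc.cases) (auto simp: enc_nonempty[THEN not_sym])
next
  case (True d c s t its)
  show ?case
  proof (cases "(d, c', s', its')" rule: enc.cases)
    case (3 d1 c1 s1 t1 its1)
    hence eq: "enc d c' s' its' = (d, 2 + s') # enc c' d t1 its1" by simp
    have "enc c' d t1 its1 = (c, 2) # enc (opp d) c t its" using True.prems unfolding eq by simp
    moreover from this have "its1 \<noteq> []" by (cases its1) (auto simp: enc_nonempty[THEN not_sym])
    ultimately show ?thesis using snd_enc[of its1 c' d t1] hd_enc[of "opp d" c t its] by auto
  qed (use True in auto)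
next
  case (False d c s t its)
  show ?case
  proof (cases "(d, c', s', its')" rule: enc.cases)
    case (2 d1 c1 s1 t1 its1)
    hence eq: "enc d c' s' its' = (d, 2 + s') # (c', 2) # enc (opp d) c' t1 its1" by simp
    have "enc c d t its = (c', 2) # enc (opp d) c' t1 its1" using False.prems unfolding eq by simp
    moreover from this have "its \<noteq> []" by (cases its) (auto simp: enc_nonempty[THEN not_sym])
    ultimately show ?thesis using snd_enc[of its c d t] hd_enc[of "opp d" c' t1 its1] by auto
  next
    case (3 d1 c1 s1 t1 its1)
    hence eq: "enc d c' s' its' = (d, 2 + s') # enc c' d t1 its1" by simp
    have "s = s'" "enc c d t its = enc c' d t1 its1" using False.prems unfolding eq by simp_all
    moreover from this have "c = c'" using hd_enc[of c d t its] hd_enc[of c' d t1 its1] by auto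
    ultimately show ?thesis using False.IH[of d t1 its1] 3 by simp
  qed (use False.prems in auto)
qed

lemma code_word_inj: "c \<in> updown \<Longrightarrow> c' \<in> updown \<Longrightarrow> code_word c x = code_word c' y \<Longrightarrow> x = y"
  using word_of_inj[OF wf_enc wf_enc] enc_inj unfolding code_word_def perp_updown by (metis prod_eqI)

lemma mirror_enc: "map (apfst mirror) (enc d c s its) = enc (mirror d) (mirror c) s its"
proof -
  have "mirror (opp d) = opp (mirror d)" for d by (cases d) auto
  thus ?thesis by (induction d c s its rule: enc_induct) auto
qed

lemma mirror_code_word: "map mirror (code_word c x) = code_word (mirror c) x"
proof -
  have "map mirror (word_of rs) = word_of (map (apfst mirror) rs)" for rs
    by (induction rs) (auto simp: map_replicate)
  thus ?thesis by (simp add: code_word_def mirror_enc)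
qed

text \<open>An isomorphism class consists of the two mirror images of one code, which coincide for a
  chain without turns.\<close>

lemma number_maximal:
  assumes k: "3 \<le> k" "k \<le> 6"
  shows "number_upto_iso (maximal_chains (k + 4 * m)) = card (codes m k)"
proof -
  have cls: "chain_iso `` {code_word c x} = {code_word Upwards x, code_word Downwards x}"
    if "x \<in> codes m k" "c \<in> updown" for x c
  proof -
    have "general_polyomino_chain (code_word c' x)" if "c' \<in> updown" for c'
      using code_word_chain[OF \<open>x \<in> codes m k\<close> k(2) that] by (simp add: polyomino_chains_def)
    thus ?thesis using that(2) by (auto simp: Image_def chain_iso_iff mirror_code_word)
  qed
  have "maximal_chains (k + 4 * m) // chain_iso = (\<lambda>x. {code_word Upwards x, code_word Downwards x}) ` codes m k"
    unfolding maximal_chains_code[OF k] quotient_def using cls by fastforce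
  moreover have "inj_on (\<lambda>x. {code_word Upwards x, code_word Downwards x}) (codes m k)"
    using code_word_inj by (intro inj_onI) (metis doubleton_eq_iff insertI1 insertI2)
  ultimately show ?thesis by (simp add: number_upto_iso_def card_image)
qed

section \<open>The number of codes\<close>

lemma card_bool_lists: "card {bs. length bs = L \<and> length (filter (\<lambda>b. b) bs) = m} = L choose m"
proof (induction L arbitrary: m)
  case 0
  have "{bs :: bool list. length bs = 0 \<and> length (filter (\<lambda>b. b) bs) = m} = (if m = 0 then {[]} else {})" by auto
  thus ?case by (simp only:) simp
next
  case (Suc L)
  let ?S = "\<lambda>L m. {bs. length bs = L \<and> length (filter (\<lambda>b. b) bs) = m}"
  have fin: "finite (?S L m)" for m
    by (rule finite_subset[OF _ finite_lists_length_eq[of UNIV L]]) auto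
  have S: "?S (Suc L) m = Cons False ` ?S L m \<union> (case m of 0 \<Rightarrow> {} | Suc m' \<Rightarrow> Cons True ` ?S L m')"
  proof (rule set_eqI)
    fix bs :: "bool list"
    show "bs \<in> ?S (Suc L) m \<longleftrightarrow>
        bs \<in> Cons False ` ?S L m \<union> (case m of 0 \<Rightarrow> {} | Suc m' \<Rightarrow> Cons True ` ?S L m')"
      by (cases bs; cases m) (auto simp: image_iff)
  qed
  show ?case
  proof (cases m)
    case 0
    thus ?thesis unfolding S using Suc[of m] by (simp add: card_image)
  next
    case (Suc m')
    have "card (Cons False ` ?S L m \<union> Cons True ` ?S L m') = card (?S L m) + card (?S L m')"
      using fin by (subst card_Un_disjoint) (auto simp: card_image)
    thus ?thesis unfolding S using Suc.IH[of m] Suc.IH[of m'] Suc by simp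
  qed
qed

text \<open>Choose which items are U-turns, and distribute \<open>N\<close> extra steps over the
  first run and the \<open>L\<close> items by stars and bars.\<close>

lemma card_codes_length:
  "card {(s, its). length its = L \<and> uturns_of its = m \<and> s + slack its = N} = (L choose m) * ((N + L) choose N)"
    (is "card ?C = _")
proof -
  let ?B = "{bs. length bs = L \<and> length (filter (\<lambda>b. b) bs) = m}"
  let ?X = "{xs :: nat list. length xs = Suc L \<and> sum_list xs = N}"
  let ?f = "\<lambda>(s :: nat, its :: items). (map fst its, s # map snd its)"
  let ?g = "\<lambda>(bs, xs). (hd xs, zip bs (tl xs))"
  have "bij_betw ?f ?C (?B \<times> ?X)"
  proof (rule bij_betwI[where g = ?g])
    show "?f \<in> ?C \<rightarrow> ?B \<times> ?X" by (auto simp: filter_map comp_def)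
    show "?g \<in> ?B \<times> ?X \<rightarrow> ?C"
    proof
      fix x assume "x \<in> ?B \<times> ?X"
      then obtain bs a xs where x: "x = (bs, a # xs)" "length bs = L" "length (filter (\<lambda>b. b) bs) = m"
        "length xs = L" "a + sum_list xs = N"
        by (auto simp: length_Suc_conv)
      have "length (filter (\<lambda>b. b) (map fst (zip bs xs))) = m" using x by simp
      hence "uturns_of (zip bs xs) = m" by (simp add: filter_map comp_def del: map_fst_zip)
      thus "?g x \<in> ?C" using x by simp
    qed
  qed (auto simp: zip_map_fst_snd length_Suc_conv)
  hence "card ?C = card ?B * card ?X" by (simp add: bij_betw_same_card card_cartesian_product)
  thus ?thesis by (simp add: card_bool_lists card_length_sum_list)
qed

text \<open>The first summand counts single zigzags. In the second, \<open>m + 1\<close> is the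
  number of positions of the joint, and \<open>k - 5\<close> extra steps are left to
  distribute.\<close>

lemma card_codes:
  assumes "3 \<le> k" "k \<le> 6"
  shows "card (codes m k) = ((m + (k - 3)) choose (k - 3)) +
    (if 5 \<le> k then (m + 1) * ((m + 1 + (k - 5)) choose (k - 5)) else 0)"
proof -
  let ?C = "\<lambda>L N. {(s, its). length its = L \<and> uturns_of its = m \<and> s + slack its = N}"
  have eq: "codes m k = ?C m (k - 3) \<union> (if 5 \<le> k then ?C (Suc m) (k - 5) else {})"
  proof (rule set_eqI)
    fix x :: "nat \<times> items"
    obtain s its where x: "x = (s, its)" by force
    have "u = m \<and> 2 * L + s + t + 3 = k + 2 * m \<longleftrightarrow>
        L = m \<and> u = m \<and> s + t = k - 3 \<or> 5 \<le> k \<and> L = Suc m \<and> u = m \<and> s + t = k - 5"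
      if "u \<le> L" for u L t :: nat
      using that assms by (cases "L = m"; cases "L = Suc m") auto
    from this[of "uturns_of its" "length its" "slack its"]
    show "x \<in> codes m k \<longleftrightarrow> x \<in> ?C m (k - 3) \<union> (if 5 \<le> k then ?C (Suc m) (k - 5) else {})"
      unfolding x codes_def by (simp add: length_filter_le split del: if_split) simp
  qed
  have fin: "finite (?C L N)" for L N
  proof (rule finite_subset)
    show "?C L N \<subseteq> {..N} \<times> {its. set its \<subseteq> UNIV \<times> {..N} \<and> length its = L}"
    proof
      fix x assume "x \<in> ?C L N"
      then obtain s its where x: "x = (s, its)" "length its = L" "s + slack its = N" by blast
      have "snd p \<le> slack its" if "p \<in> set its" for p by (rule member_le_sum_list) (use that in auto)
      thus "x \<in> {..N} \<times> {its. set its \<subseteq> UNIV \<times> {..N} \<and> length its = L}" using x by fastforce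
    qed
    show "finite ({..N} \<times> {its :: items. set its \<subseteq> UNIV \<times> {..N} \<and> length its = L})"
      by (intro finite_cartesian_product finite_lists_length_eq) auto
  qed
  show ?thesis
  proof (cases "5 \<le> k")
    case True
    have "card (codes m k) = card (?C m (k - 3)) + card (?C (Suc m) (k - 5))"
      unfolding eq using True fin by (subst card_Un_disjoint[symmetric]) auto
    thus ?thesis using True by (simp add: card_codes_length add.commute)
  next
    case False
    thus ?thesis unfolding eq by (simp add: card_codes_length add.commute)
  qed
qed

section \<open>The maximal chains form the families\<close>

lemma zigzag_runs:
  assumes "zigzag its"
  shows "length (enc d c s its) = 2 * length its + 1"
    and "j \<le> 2 * length its \<Longrightarrow>
      rlen (enc d c s its) j = (if even j then 2 + (s # map snd its) ! (j div 2) else 2)"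
    and "odd j \<Longrightarrow> j \<le> 2 * length its \<Longrightarrow> rdir (enc d c s its) j = c"
    and "Suc (Suc j) \<le> 2 * length its \<Longrightarrow> rdir (enc d c s its) (Suc (Suc j)) =
      (if even j then opp (rdir (enc d c s its) j) else rdir (enc d c s its) j)"
proof -
  show "length (enc d c s its) = 2 * length its + 1"
    using assms by (induction d c s its rule: enc_induct) auto
  show "j \<le> 2 * length its \<Longrightarrow>
      rlen (enc d c s its) j = (if even j then 2 + (s # map snd its) ! (j div 2) else 2)"
    using assms
  proof (induction d c s its arbitrary: j rule: enc_induct)
    case (True d c s t its)
    consider "j = 0" | "j = 1" | i where "j = Suc (Suc i)" by (metis One_nat_def not0_implies_Suc)
    thus ?case using True by cases auto
  qed auto
  show rdir_odd: "odd j \<Longrightarrow> j \<le> 2 * length its \<Longrightarrow> rdir (enc d c s its) j = c" for j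
    using assms
  proof (induction d c s its arbitrary: j rule: enc_induct)
    case (True d c s t its)
    consider "j = 0" | "j = 1" | i where "j = Suc (Suc i)" by (metis One_nat_def not0_implies_Suc)
    thus ?case using True by cases auto
  qed auto
  have rdir_even: "even j \<Longrightarrow> Suc (Suc j) \<le> 2 * length its \<Longrightarrow>
      rdir (enc d c s its) (Suc (Suc j)) = opp (rdir (enc d c s its) j)"
    using assms
  proof (induction d c s its arbitrary: j rule: enc_induct)
    case (True d c s t its)
    consider "j = 0" | i where "j = Suc (Suc i)" using True.prems(1) by (cases j; cases "j - 1") auto
    thus ?case using True hd_enc[of "opp d" c t its] by cases auto
  qed auto
  show "Suc (Suc j) \<le> 2 * length its \<Longrightarrow> rdir (enc d c s its) (Suc (Suc j)) =
      (if even j then opp (rdir (enc d c s its) j) else rdir (enc d c s its) j)"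
    using rdir_even rdir_odd[of j] rdir_odd[of "Suc (Suc j)"] by simp
qed

lemma zigzag_C_family:
  assumes z: "zigzag its" and chain: "general_polyomino_chain (code_word c (s, its))" and c: "c \<in> updown"
    and ls: "\<forall>(l, \<alpha>)\<in>set ls. 3 \<le> l"
  shows "code_word c (s, its) \<in> C_family ls \<longleftrightarrow> int (length its) + 1 = sum_list (map snd ls) \<and>
    (\<forall>(l, \<alpha>)\<in>set ls. int (length (filter ((=) (l - 3)) (s # map snd its))) = \<alpha>)"
proof -
  let ?rs = "enc Rightwards c s its" and ?xs = "s # map snd its"
  have wf: "wf_runs ?rs" using c by (intro wf_enc) (simp flip: perp_updown)
  have hor: "horizontal (rdir ?rs 0)" using hd_enc[of Rightwards c s its] by (auto simp: horizontal_def)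
  note runs = zigzag_runs[OF z, where d = Rightwards and c = c and s = s]
  have odd: "\<forall>j<length ?rs. odd j \<longrightarrow> rlen ?rs j = 2" using runs(1,2) by auto
  have type: "\<forall>j. even j \<longrightarrow> Suc (Suc j) < length ?rs \<longrightarrow> rdir ?rs (Suc (Suc j)) \<noteq> rdir ?rs j"
    using runs(1,4) by auto
  have len: "int ((length ?rs + 1) div 2) = int (length its) + 1" using runs(1) by simp
  have card: "card {j. j < length ?rs \<and> even j \<and> rlen ?rs j = l - 1} = length (filter ((=) (l - 3)) ?xs)"
    if "3 \<le> l" for l
  proof -
    have "{j. j < length ?rs \<and> even j \<and> rlen ?rs j = l - 1} =
        (*) 2 ` {i. i < length ?xs \<and> l - 3 = ?xs ! i}" (is "?L = ?R")
    proof (intro equalityI subsetI)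
      fix j assume "j \<in> ?L"
      then obtain i where "j = 2 * i" "2 * i < length ?rs" "rlen ?rs (2 * i) = l - 1" by (auto elim: evenE)
      thus "j \<in> ?R" using runs(1) runs(2)[of "2 * i"] that by auto
    next
      fix j assume "j \<in> ?R"
      then obtain i where i: "j = 2 * i" "i < length ?xs" "l - 3 = ?xs ! i" by blast
      thus "j \<in> ?L" using runs(1) runs(2)[of "2 * i"] that by simp
    qed
    moreover have "inj_on ((*) 2) {i. i < length ?xs \<and> l - 3 = ?xs ! i}" by (simp add: inj_on_def)
    ultimately show ?thesis by (simp only: card_image length_filter_conv_card)
  qed
  have "(\<forall>(l, \<alpha>)\<in>set ls. int (card {j. j < length ?rs \<and> even j \<and> rlen ?rs j = l - 1}) = \<alpha>) \<longleftrightarrow>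
      (\<forall>(l, \<alpha>)\<in>set ls. int (length (filter ((=) (l - 3)) ?xs)) = \<alpha>)"
    using ls card by (intro ball_cong) auto
  moreover have "\<forall>(l, \<alpha>)\<in>set ls. 0 < l" using ls by fastforce
  ultimately show ?thesis
    using C_family_word_of[OF wf _ _ hor, of ls] chain odd type len unfolding code_word_def by simp
qed

text \<open>Applied to the extra steps of the horizontal segments, this sorts the segments by the
  lengths 3, 4, 5 and 6.\<close>

lemma small_sum:
  fixes xs :: "nat list"
  assumes "sum_list xs \<le> 3"
  defines "N v \<equiv> length (filter ((=) v) xs)"
  shows "length xs = N 0 + N 1 + N 2 + N 3" "sum_list xs = N 1 + 2 * N 2 + 3 * N 3"
proof -
  have "length xs = N 0 + N 1 + N 2 + N 3 \<and> sum_list xs = N 1 + 2 * N 2 + 3 * N 3"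
    using assms(1) unfolding N_def
  proof (induction xs)
    case (Cons x xs)
    hence "x = 0 \<or> x = 1 \<or> x = 2 \<or> x = 3" by auto
    thus ?case using Cons by auto
  qed simp
  thus "length xs = N 0 + N 1 + N 2 + N 3" "sum_list xs = N 1 + 2 * N 2 + 3 * N 3" by auto
qed

text \<open>The last two hypotheses give the numbers of horizontal segments and of horizontal
  letters. The other \<open>2 * m\<close> letters form \<open>m\<close> vertical runs, and the links
  of type 3 make each of them a U-turn.\<close>

lemma C_family_maximal:
  assumes k: "3 \<le> k" "k \<le> 6" and w: "w \<in> polyomino_chains (k + 4 * m)" "w \<in> C_family ls"
    and ls: "distinct (map fst ls)" "\<forall>(l, \<alpha>)\<in>set ls. 3 \<le> l" "sum_list (map snd ls) = int m + 1"
      "(\<Sum>(l, \<alpha>)\<leftarrow>ls. (int l - 1) * \<alpha>) = 2 * int m + int k - 1"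
  shows "w \<in> maximal_chains (k + 4 * m)"
proof -
  obtain rs where rs: "wf_runs rs" "word_of rs = w" "self_avoiding (word_of rs)" "rdir rs 0 = Rightwards"
    "num_squares (word_of rs) = k + 4 * m"
    by (rule chain_runs[OF w(1)])
  let ?r = "length rs"
  define E where "E = {j. j < ?r \<and> even j}"
  define D where "D = {j. j < ?r \<and> odd j}"
  define N where "N l = {j \<in> E. rlen rs j = l - 1}" for l
  have hor: "horizontal (rdir rs 0)" by (simp add: rs(4) horizontal_def)
  have chain: "general_polyomino_chain (word_of rs)" using w(1) rs(2) by (simp add: polyomino_chains_def)
  have "\<forall>(l, \<alpha>)\<in>set ls. 0 < l" using ls(2) by fastforce
  from C_family_word_of[OF rs(1) chain this hor] w(2) rs(2)
  have odd: "\<forall>j<?r. odd j \<longrightarrow> rlen rs j = 2"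
    and type: "\<forall>j. even j \<longrightarrow> Suc (Suc j) < ?r \<longrightarrow> rdir rs (Suc (Suc j)) \<noteq> rdir rs j"
    and len: "int ((?r + 1) div 2) = int m + 1"
    and card: "\<forall>(l, \<alpha>)\<in>set ls. int (card {j. j < ?r \<and> even j \<and> rlen rs j = l - 1}) = \<alpha>"
    using ls(3) by simp_all
  have card_N: "\<alpha> = int (card (N l))" if "(l, \<alpha>) \<in> set ls" for l \<alpha>
    using card that by (auto simp: N_def E_def conj_assoc)
  define L where "L = set (map fst ls)"
  have L: "l \<in> L \<Longrightarrow> 3 \<le> l" for l using ls(2) by (auto simp: L_def)
  have [simp]: "finite E" "finite D" "finite L" "finite (N l)" for l
    by (simp_all add: E_def D_def L_def N_def)
  have to_L: "(\<Sum>(l, \<alpha>)\<leftarrow>ls. f l * \<alpha>) = (\<Sum>l\<in>L. f l * int (card (N l)))" for f :: "nat \<Rightarrow> int"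
  proof -
    have "(\<Sum>(l, \<alpha>)\<leftarrow>ls. f l * \<alpha>) = (\<Sum>l\<leftarrow>map fst ls. f l * int (card (N l)))"
      using card_N by (auto simp: comp_def intro!: arg_cong[where f = sum_list])
    also have "\<dots> = (\<Sum>l\<in>L. f l * int (card (N l)))"
      unfolding L_def using ls(1) by (rule sum_list_distinct_conv_sum_set)
    finally show ?thesis .
  qed
  define E' where "E' = {j \<in> E. rlen rs j + 1 \<in> L}"
  have group: "(\<Sum>l\<in>L. f l * int (card (N l))) = (\<Sum>j\<in>E'. f (rlen rs j + 1))" for f :: "nat \<Rightarrow> int"
  proof -
    have "(\<Sum>l\<in>L. f l * int (card (N l))) = (\<Sum>l\<in>L. \<Sum>j | j \<in> E' \<and> rlen rs j + 1 = l. f (rlen rs j + 1))"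
    proof (rule sum.cong)
      fix l assume "l \<in> L"
      hence "{j. j \<in> E' \<and> rlen rs j + 1 = l} = N l" using L[of l] by (auto simp: E'_def N_def)
      moreover have "(\<Sum>j | j \<in> E' \<and> rlen rs j + 1 = l. f (rlen rs j + 1)) =
          (\<Sum>j | j \<in> E' \<and> rlen rs j + 1 = l. f l)"
        by (rule sum.cong) auto
      ultimately show "f l * int (card (N l)) = (\<Sum>j | j \<in> E' \<and> rlen rs j + 1 = l. f (rlen rs j + 1))"
        by simp
    qed simp
    also have "\<dots> = (\<Sum>j\<in>E'. f (rlen rs j + 1))"
      by (rule sum.group) (auto simp: E'_def)
    finally show ?thesis .
  qed
  have "(\<Sum>(l, \<alpha>)\<leftarrow>ls. 1 * \<alpha>) = int m + 1" using ls(3) by (simp add: case_prod_beta')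
  hence "int (card E') = int m + 1" using to_L[of "\<lambda>_. 1"] group[of "\<lambda>_. 1"] by simp
  moreover have "int (card E) = int m + 1" using len by (simp add: E_def card_even_odd)
  \<comment> \<open>The multiplicities add up to the number of horizontal segments, so no horizontal
    segment has a length that is not listed in \<open>ls\<close>.\<close>
  ultimately have "E' = E" by (intro card_subset_eq) (auto simp: E'_def)
  hence "\<forall>j\<in>E. rlen rs j + 1 \<in> L" by (auto simp: E'_def)
  hence two: "2 \<le> rlen rs j" if "j < ?r" for j using odd that L by (cases "even j") (fastforce simp: E_def)+
  have sum_E: "(\<Sum>j\<in>E. int (rlen rs j)) = 2 * int m + int k - 1"
    using ls(4) to_L[of "\<lambda>l. int l - 1"] group[of "\<lambda>l. int l - 1"] \<open>E' = E\<close> by simp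
  have "(\<Sum>j<?r. rlen rs j) = (\<Sum>j\<in>E \<union> D. rlen rs j)" by (rule sum.cong) (auto simp: E_def D_def)
  also have "\<dots> = (\<Sum>j\<in>E. rlen rs j) + (\<Sum>j\<in>D. rlen rs j)"
    by (rule sum.union_disjoint) (auto simp: E_def D_def)
  also have "(\<Sum>j\<in>D. rlen rs j) = (\<Sum>j\<in>D. 2)" using odd by (intro sum.cong) (auto simp: D_def)
  also have "\<dots> = 2 * (?r div 2)" by (simp add: D_def card_even_odd)
  finally have "k + 4 * m = (\<Sum>j\<in>E. rlen rs j) + 2 * (?r div 2) + 1"
    using rs(5) by (simp add: num_squares_def length_word_of_sum)
  hence "int (k + 4 * m) = int ((\<Sum>j\<in>E. rlen rs j) + 2 * (?r div 2) + 1)" by (rule arg_cong)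
  hence "int k + 4 * int m = (\<Sum>j\<in>E. int (rlen rs j)) + 2 * int (?r div 2) + 1"
    by (simp only: of_nat_add of_nat_mult of_nat_sum of_nat_numeral of_nat_1)
  \<comment> \<open>The family leaves open whether a vertical segment follows the last horizontal
    one; the number of squares excludes it.\<close>
  hence "?r div 2 = m" "(?r + 1) div 2 = m + 1" using sum_E len by linarith+
  hence r: "?r = 2 * m + 1" by presburger
  have "(\<lambda>a. 2 * a + 1) ` {..<m} \<subseteq> u_turns rs"
  proof
    fix j assume "j \<in> (\<lambda>a. 2 * a + 1) ` {..<m}"
    then obtain a where a: "j = Suc (2 * a)" "a < m" by auto
    have "rdir rs (Suc j) = opp (rdir rs (2 * a))"
      using type[rule_format, of "2 * a"] a r wf_runs_perp[OF rs(1), of "2 * a"] wf_runs_perp[OF rs(1), of j]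
        perp_perp by auto
    thus "j \<in> u_turns rs" using a r odd by (simp add: u_turns_def)
  qed
  hence "card ((\<lambda>a. 2 * a + 1) ` {..<m}) \<le> card (u_turns rs)" by (intro card_mono) auto
  hence "m \<le> card (u_turns rs)" by (simp add: card_image inj_on_def)
  moreover have "2 * card (u_turns rs) + 1 \<le> ?r" by (rule card_u_turns[OF rs(1,3)])
  ultimately have "tight rs m" using two r by (simp add: tight_def)
  thus ?thesis using maximal_iff_tight[OF k rs(5,1)] w(1) rs(2) by simp
qed

section \<open>Chains made of pairs of segments\<close>

text \<open>
  The shape of a chain of \<open>m + 1\<close> pairs of segments whose first \<open>i + 1\<close> pairs are generated by links of
  types 3 and 2. The last clause concerns the runs followed by a segment that a link of type 3 generates.
\<close>

definition pairs :: "nat \<Rightarrow> nat \<Rightarrow> runs \<Rightarrow> bool" where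
  "pairs m i rs \<longleftrightarrow> i \<le> m \<and> length rs = 2 * m + 2 \<and>
    (\<forall>j. Suc (Suc j) < length rs \<longrightarrow>
      (rdir rs (Suc (Suc j)) \<noteq> rdir rs j \<longleftrightarrow> (if even j then j < 2 * i else 2 * i < j))) \<and>
    (\<forall>j. Suc j < length rs \<longrightarrow> (if even j then 2 * i < j else j < 2 * i) \<longrightarrow> rlen rs j = 2)"

text \<open>The \<open>i\<close> odd runs before run \<open>2 * i\<close> and the
  \<open>m - i\<close> even runs after it are U-turns, and \<open>card_u_turns\<close> allows no
  more.\<close>

lemma pairs_tight:
  assumes wf: "wf_runs rs" and sa: "self_avoiding (word_of rs)" and p: "pairs m i rs"
    and two: "\<forall>j<length rs. 2 \<le> rlen rs j"
  shows "tight rs m"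
proof -
  have i: "i \<le> m" and r: "length rs = 2 * m + 2"
    and type: "\<And>j. Suc (Suc j) < length rs \<Longrightarrow>
      rdir rs (Suc (Suc j)) \<noteq> rdir rs j \<longleftrightarrow> (if even j then j < 2 * i else 2 * i < j)"
    and len: "\<And>j. Suc j < length rs \<Longrightarrow> (if even j then 2 * i < j else j < 2 * i) \<Longrightarrow> rlen rs j = 2"
    using p unfolding pairs_def by blast+
  let ?U = "(\<lambda>a. 2 * a + 1) ` {..<i} \<union> (\<lambda>a. 2 * a) ` {i + 1..m}"
  have "?U \<subseteq> u_turns rs"
  proof
    fix j assume "j \<in> ?U"
    hence j: "if even j then 2 * i < j else j < 2 * i" "1 \<le> j" "Suc j < length rs" using i r by auto
    then obtain l where l: "j = Suc l" by (cases j) auto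
    have "if even l then l < 2 * i else 2 * i < l" using j(1) l by (cases "even l") (auto, presburger)
    hence "rdir rs (Suc j) \<noteq> rdir rs l" using type[of l] j l by simp
    hence "rdir rs (Suc j) = opp (rdir rs l)"
      using perp_perp[of "rdir rs l" "rdir rs j" "rdir rs (Suc j)"] wf_runs_perp[OF wf, of l]
        wf_runs_perp[OF wf, of j] j l by auto
    thus "j \<in> u_turns rs" using len[OF j(3,1)] j l by (simp add: u_turns_def)
  qed
  hence "card ?U \<le> card (u_turns rs)" by (intro card_mono) auto
  moreover have "card ?U = m"
  proof -
    have "2 * a + 1 \<noteq> 2 * b" for a b :: nat by presburger
    hence "(\<lambda>a. 2 * a + 1) ` {..<i} \<inter> (\<lambda>a. 2 * a) ` {i + 1..m} = {}" by auto
    thus ?thesis using i by (subst card_Un_disjoint) (auto simp: card_image inj_on_def)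
  qed
  moreover have "2 * card (u_turns rs) + 1 \<le> length rs" by (rule card_u_turns[OF wf sa])
  ultimately show ?thesis using two r by (simp add: tight_def)
qed

text \<open>The first zigzag occupies the runs 0 to \<open>2 * length A\<close>, with its U-turns at
  odd places. The second begins at an odd place, so its U-turns are at even places: behind the
  joint, horizontal and vertical segments exchange their link types.\<close>

lemma two_zigzags_pairs:
  assumes A: "zigzag A" and B: "zigzag B" and m: "length A + length B = m"
  shows "pairs m (length A) (enc d c s (A @ (False, t) # B))"
proof -
  let ?i = "length A" and ?rs = "enc d c s (A @ (False, t) # B)"
  define e where "e = rdir (rev (enc d c s A)) 0"
  have rs: "?rs = enc d c s A @ enc c e t B" using enc_snoc[OF A] by (simp add: e_def)
  note a = zigzag_runs[OF A, where d = d and c = c and s = s]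
  note b = zigzag_runs[OF B, where d = c and c = e and s = t]
  have len: "length ?rs = 2 * m + 2" using m by (simp add: rs a(1) b(1))
  have nth_a: "?rs ! j = enc d c s A ! j" if "j \<le> 2 * ?i" for j using that by (simp add: rs nth_append a(1))
  have nth_b: "?rs ! (2 * ?i + 1 + j) = enc c e t B ! j" for j by (simp add: rs nth_append a(1))
  have last: "rdir ?rs (2 * ?i) = e"
    using nth_a[of "2 * ?i"] a(1) by (simp add: e_def rev_nth)
  have first: "rdir ?rs (2 * ?i + 1) = c" using nth_b[of 0] hd_enc[of c e t B] by auto
  show ?thesis
    unfolding pairs_def len
  proof (intro conjI allI impI)
    show "?i \<le> m" using m by simp
    show "2 * m + 2 = 2 * m + 2" ..
  next
    fix j assume j: "Suc (Suc j) < 2 * m + 2"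
    \<comment> \<open>In the second and third case runs \<open>j\<close> and \<open>j + 2\<close>
      lie on different sides of the joint; they agree in direction, as neither run next to the joint
      is a U-turn.\<close>
    have "Suc (Suc j) \<le> 2 * ?i \<or> Suc j = 2 * ?i \<or> j = 2 * ?i \<or> 2 * ?i + 1 \<le> j" by arith
    then consider "Suc (Suc j) \<le> 2 * ?i" | "Suc j = 2 * ?i" | "j = 2 * ?i" | l where "j = 2 * ?i + 1 + l"
      unfolding le_iff_add[of "2 * ?i + 1" j] by blast
    thus "rdir ?rs (Suc (Suc j)) \<noteq> rdir ?rs j \<longleftrightarrow> (if even j then j < 2 * ?i else 2 * ?i < j)"
    proof cases
      case 1
      thus ?thesis using nth_a[of j] nth_a[of "Suc (Suc j)"] a(4)[of j] by auto
    next
      case 2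
      hence "odd j" by presburger
      moreover have "Suc (Suc j) = 2 * ?i + 1" using 2 by simp
      ultimately show ?thesis using nth_a[of j] a(3)[of j] first 2 by simp
    next
      case 3
      hence "B \<noteq> []" using j m by auto
      hence "rdir (enc c e t B) 1 = e" using snd_enc[of B c e t] by auto
      thus ?thesis using nth_b[of 1] last 3 by simp
    next
      case (4 l)
      hence "Suc (Suc l) \<le> 2 * length B" using j m by simp
      thus ?thesis using nth_b[of l] nth_b[of "Suc (Suc l)"] b(4)[of l] 4 by auto
    qed
  next
    fix j assume j: "Suc j < 2 * m + 2" "if even j then 2 * ?i < j else j < 2 * ?i"
    show "rlen ?rs j = 2"
    proof (cases "even j")
      case False
      thus ?thesis using j nth_a[of j] a(2)[of j] by simp
    next
      case True
      then obtain l where l: "j = 2 * ?i + 1 + l" using j less_imp_Suc_add[of "2 * ?i" j] by auto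
      hence "odd l" using True by simp
      thus ?thesis using nth_b[of l] b(2)[of l] j l m by simp
    qed
  qed
qed

lemma sum_lens:
  fixes f :: "nat \<Rightarrow> nat"
  assumes "\<And>j. j < r \<Longrightarrow> 2 \<le> f j"
  shows "(\<Sum>j<r. f j) = 2 * r \<Longrightarrow> j < r \<Longrightarrow> f j = 2"
    and "(\<Sum>j<r. f j) = 2 * r + 1 \<Longrightarrow> \<exists>j0<r. f j0 = 3 \<and> (\<forall>j<r. j \<noteq> j0 \<longrightarrow> f j = 2)"
proof -
  have "(\<Sum>j<r. f j) = (\<Sum>j<r. 2 + (f j - 2))" by (intro sum.cong refl) (simp only: lessThan_iff le_add_diff_inverse assms)
  also have "\<dots> = 2 * r + (\<Sum>j<r. f j - 2)" by (subst sum.distrib) simp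
  finally have eq: "(\<Sum>j<r. f j) = 2 * r + (\<Sum>j<r. f j - 2)" .
  show "f j = 2" if "(\<Sum>j<r. f j) = 2 * r" "j < r"
  proof -
    have "(\<Sum>j<r. f j - 2) = 0" using eq that(1) by simp
    hence "f j - 2 = 0" using that(2) by (simp only: sum_eq_0_iff finite_lessThan) blast
    thus ?thesis using assms[OF that(2)] by simp
  qed
  assume "(\<Sum>j<r. f j) = 2 * r + 1"
  hence "(\<Sum>j<r. f j - 2) = 1" using eq by simp
  then obtain j0 where j0: "j0 < r" "f j0 - 2 = 1" "\<forall>j<r. j0 \<noteq> j \<longrightarrow> f j - 2 = 0"
    using sum_eq_1_iff[of "{..<r}" "\<lambda>j. f j - 2"] by auto
  have "f j = 2" if "j < r" "j \<noteq> j0" for j using j0(3) that assms[OF that(1)] by fastforce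
  thus "\<exists>j0<r. f j0 = 3 \<and> (\<forall>j<r. j \<noteq> j0 \<longrightarrow> f j = 2)" using j0 by (intro exI[of _ j0]) auto
qed

text \<open>The first vertical segment has no run two places before it and is of type 2 by
  convention; the bound \<open>2 * i + 2\<close> in the odd case covers this.\<close>

lemma pairs_generated:
  assumes wf: "wf_runs rs" and j: "1 \<le> j" "j < length rs"
    and type: "\<forall>j. Suc (Suc j) < length rs \<longrightarrow>
      (rdir rs (Suc (Suc j)) \<noteq> rdir rs j \<longleftrightarrow> (if even j then j < 2 * i else 2 * i < j))"
  shows "generated_by (word_of rs) (seg rs j) 3 \<longleftrightarrow> (if even j then j \<le> 2 * i else 2 * i + 2 < j)"
    and "generated_by (word_of rs) (seg rs j) 2 \<longleftrightarrow> (if even j then 2 * i < j else j < 2 * i + 2)"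
proof -
  have *: "generated_by (word_of rs) (seg rs j) t \<longleftrightarrow>
      t = (if if even j then j \<le> 2 * i else 2 * i + 2 < j then 3 else 2)" for t
  proof (cases "j = 1")
    case False
    then obtain l where l: "j = Suc (Suc l)" using j by (cases j; cases "j - 1") auto
    have "rdir rs j \<noteq> rdir rs l \<longleftrightarrow> (if even l then l < 2 * i else 2 * i < l)"
      using type j l by blast
    moreover have "l < 2 * i \<longleftrightarrow> j \<le> 2 * i" if "even l" using l that by presburger
    ultimately show ?thesis using generated_by_seg[OF wf j(2), of t] l by auto
  qed (use generated_by_seg[OF wf j(2), of t] in auto)
  show "generated_by (word_of rs) (seg rs j) 3 \<longleftrightarrow> (if even j then j \<le> 2 * i else 2 * i + 2 < j)"
    unfolding * by simp
  show "generated_by (word_of rs) (seg rs j) 2 \<longleftrightarrow> (if even j then 2 * i < j else j < 2 * i + 2)"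
    unfolding * by (cases "even j") (auto, presburger)
qed

lemma pairs_imp_paired_chain:
  assumes "wf_runs rs" "general_polyomino_chain (word_of rs)" "horizontal (rdir rs 0)" "pairs m i rs"
  shows "paired_chain m i (word_of rs)"
  using assms paired_chain_word_of[OF assms(1-3), of i m] by (simp add: pairs_def)

lemma segments_others:
  assumes "wf_runs rs" "j0 < length rs"
  shows "(\<forall>s'\<in>segments (word_of rs) - {seg rs j0}. seg_length s' = 3) \<longleftrightarrow>
    (\<forall>j<length rs. j \<noteq> j0 \<longrightarrow> rlen rs j = 2)"
proof -
  have "segments (word_of rs) - {seg rs j0} = seg rs ` ({..<length rs} - {j0})"
    using inj_on_image_set_diff[OF inj_on_seg[OF assms(1)], of "{..<length rs}" "{j0}"] assms(2)
    by (simp add: segments_word_of[OF assms(1)])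
  thus ?thesis by (auto simp: seg_length_seg)
qed

lemma pairs_in_families:
  assumes wf: "wf_runs rs" and chain: "general_polyomino_chain (word_of rs)" and hor: "horizontal (rdir rs 0)"
    and two: "\<forall>j<length rs. 2 \<le> rlen rs j" and p: "pairs m i rs"
  shows "num_squares (word_of rs) = 5 + 4 * m \<Longrightarrow> word_of rs \<in> Cbar_3 m"
    and "num_squares (word_of rs) = 6 + 4 * m \<Longrightarrow> word_of rs \<in> Cbar_34 m \<union> Cunder_34 m"
proof -
  let ?w = "word_of rs" and ?r = "length rs"
  have r: "?r = 2 * m + 2" and i: "i \<le> m" using p by (simp_all add: pairs_def)
  note pc = pairs_imp_paired_chain[OF wf chain hor p]
  note hv = h_segments_word_of[OF wf hor]
  have type: "\<forall>j. Suc (Suc j) < ?r \<longrightarrow>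
      (rdir rs (Suc (Suc j)) \<noteq> rdir rs j \<longleftrightarrow> (if even j then j < 2 * i else 2 * i < j))"
    using p unfolding pairs_def by blast
  show "?w \<in> Cbar_3 m" if "num_squares ?w = 5 + 4 * m"
  proof -
    have "(\<Sum>j<?r. rlen rs j) = 2 * ?r" using that r by (simp add: num_squares_def length_word_of_sum)
    hence "\<forall>j<?r. rlen rs j = 2" using sum_lens(1)[of ?r "rlen rs"] two by blast
    thus ?thesis using pc i unfolding Cbar_3_def by (auto simp: segments_word_of[OF wf] seg_length_seg)
  qed
  show "?w \<in> Cbar_34 m \<union> Cunder_34 m" if "num_squares ?w = 6 + 4 * m"
  proof -
    have "(\<Sum>j<?r. rlen rs j) = 2 * ?r + 1" using that r by (simp add: num_squares_def length_word_of_sum)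
    then obtain j0 where j0: "j0 < ?r" "rlen rs j0 = 3" "\<forall>j<?r. j \<noteq> j0 \<longrightarrow> rlen rs j = 2"
      using sum_lens(2)[of ?r "rlen rs"] two by blast
    have len: "seg_length (seg rs j0) = 4" using j0 by (simp add: seg_length_seg)
    note others = segments_others[OF wf j0(1), THEN iffD2, OF j0(3)]
    \<comment> \<open>The runs excluded here are the U-turns, and these have exactly two
      steps.\<close>
    have not_u: "if even j0 then j0 \<le> 2 * i else 2 * i < j0"
    proof (rule ccontr)
      assume *: "\<not> ?thesis"
      hence "Suc j0 < ?r" using j0(1) r i by (cases "even j0"; cases "Suc j0 = ?r") auto
      moreover have "if even j0 then 2 * i < j0 else j0 < 2 * i"
        using * by (cases "even j0"; cases "j0 = 2 * i") auto
      ultimately have "rlen rs j0 = 2" using p unfolding pairs_def by blast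
      thus False using j0 by simp
    qed
    show ?thesis
    proof (cases "even j0")
      case True
      have "fst (seg rs j0) = 1 \<or> generated_by ?w (seg rs j0) 3"
        using fst_seg_eq_1[OF wf j0(1)] pairs_generated(1)[OF wf _ j0(1) type] True not_u
        by (cases "j0 = 0") auto
      moreover have "seg rs j0 \<in> h_segments ?w" unfolding hv using True j0 by blast
      ultimately have "?w \<in> Cbar_34 m" using pc i len others unfolding Cbar_34_def by blast
      thus ?thesis ..
    next
      case False
      hence j1: "1 \<le> j0" by (cases j0) auto
      \<comment> \<open>The vertical segments of type 2 are the odd runs up to
        \<open>2 * i + 1\<close>, and the longer run \<open>j0\<close> does not come before that
        one.\<close>
      have last: "fst s' \<le> fst (seg rs j0)" if s': "s' \<in> v_segments ?w" "generated_by ?w s' 2" for s'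
      proof -
        obtain j where j: "j < ?r" "odd j" "s' = seg rs j" using s'(1) unfolding hv by blast
        have "1 \<le> j" using j(2) by (cases j) auto
        hence "j < 2 * i + 2" using pairs_generated(2)[OF wf _ j(1) type] s'(2) j by auto
        hence "j \<le> j0" using not_u False by auto
        thus ?thesis using start_mono[OF wf, of j j0] j j0 by (simp add: seg_def)
      qed
      have "generated_by ?w (seg rs j0) 2 \<or> generated_by ?w (seg rs j0) 3"
        using pairs_generated[OF wf j1 j0(1) type] False by (auto simp: not_less le_less)
      moreover have "seg rs j0 \<in> v_segments ?w" unfolding hv using False j0 by blast
      ultimately have "?w \<in> Cunder_34 m" using pc i len others last unfolding Cunder_34_def by blast
      thus ?thesis ..
    qed
  qed
qed

lemma paired_families_maximal:
  assumes k: "3 \<le> k" "k \<le> 6" and w: "w \<in> polyomino_chains (k + 4 * m)"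
    and fam: "w \<in> Cbar_3 m \<union> Cbar_34 m \<union> Cunder_34 m"
  shows "w \<in> maximal_chains (k + 4 * m)"
proof -
  obtain rs where rs: "wf_runs rs" "word_of rs = w" "self_avoiding (word_of rs)" "rdir rs 0 = Rightwards"
    "num_squares (word_of rs) = k + 4 * m"
    by (rule chain_runs[OF w])
  let ?r = "length rs"
  have hor: "horizontal (rdir rs 0)" by (simp add: rs(4) horizontal_def)
  have chain: "general_polyomino_chain (word_of rs)" using w rs(2) by (simp add: polyomino_chains_def)
  note wf = rs(1) and hv = h_segments_word_of[OF rs(1) hor]
  have type: "\<forall>j. Suc (Suc j) < ?r \<longrightarrow>
      (rdir rs (Suc (Suc j)) \<noteq> rdir rs j \<longleftrightarrow> (if even j then j < 2 * i else 2 * i < j))"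
    and r: "?r = 2 * m + 2" if "i \<le> m" "paired_chain m i w" for i
    using paired_chain_word_of[OF wf chain hor that(1)] that(2) rs(2) by simp_all
  have one_longer: "(\<forall>j<?r. 2 \<le> rlen rs j) \<and> (\<forall>j. Suc j < ?r \<longrightarrow> P j \<longrightarrow> rlen rs j = 2)"
    if "rlen rs j0 = 3" "\<forall>j<?r. j \<noteq> j0 \<longrightarrow> rlen rs j = 2" "\<not> P j0" for j0 P
  proof (intro conjI allI impI)
    fix j assume "j < ?r"
    thus "2 \<le> rlen rs j" using that(1,2) by (cases "j = j0") auto
  next
    fix j assume "Suc j < ?r" "P j"
    thus "rlen rs j = 2" using that(2,3) by (cases "j = j0") auto
  qed
  have "\<exists>i\<le>m. paired_chain m i w \<and> (\<forall>j<?r. 2 \<le> rlen rs j) \<and>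
      (\<forall>j. Suc j < ?r \<longrightarrow> (if even j then 2 * i < j else j < 2 * i) \<longrightarrow> rlen rs j = 2)"
    using fam
  proof (elim UnE)
    assume "w \<in> Cbar_3 m"
    then obtain i where i: "i \<le> m" "paired_chain m i w" "\<forall>s\<in>segments w. seg_length s = 3"
      unfolding Cbar_3_def by blast
    have "rlen rs j = 2" if "j < ?r" for j
      using i(3) that unfolding rs(2)[symmetric] segments_word_of[OF wf] by (auto simp: seg_length_seg)
    thus ?thesis using i(1,2) by (intro exI[of _ i]) auto
  next
    assume "w \<in> Cbar_34 m"
    then obtain i s where i: "i \<le> m" "paired_chain m i w" and s: "s \<in> h_segments w" "seg_length s = 4"
      "fst s = 1 \<or> generated_by w s 3" "\<forall>s'\<in>segments w - {s}. seg_length s' = 3"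
      unfolding Cbar_34_def by blast
    obtain j0 where j0: "j0 < ?r" "even j0" "s = seg rs j0"
      using s(1) unfolding rs(2)[symmetric] hv by blast
    have "rlen rs j0 = 3" using s(2) j0 by (simp add: seg_length_seg)
    moreover have "\<forall>j<?r. j \<noteq> j0 \<longrightarrow> rlen rs j = 2"
      using s(4) segments_others[OF wf j0(1)] by (simp add: rs(2) j0(3))
    moreover have "j0 \<le> 2 * i"
      using s(3) pairs_generated(1)[OF wf _ j0(1) type[OF i]] fst_seg_eq_1[OF wf j0(1)] j0 rs(2)
      by (cases "j0 = 0") auto
    ultimately show ?thesis using i j0(2) one_longer[of j0 "\<lambda>j. if even j then 2 * i < j else j < 2 * i"]
      by (intro exI[of _ i]) simp
  next
    assume "w \<in> Cunder_34 m"
    then obtain i s where i: "i \<le> m" "paired_chain m i w" and s: "s \<in> v_segments w" "seg_length s = 4"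
      "generated_by w s 2 \<and> (\<forall>s'\<in>v_segments w. generated_by w s' 2 \<longrightarrow> fst s' \<le> fst s) \<or> generated_by w s 3"
      "\<forall>s'\<in>segments w - {s}. seg_length s' = 3"
      unfolding Cunder_34_def by blast
    obtain j0 where j0: "j0 < ?r" "odd j0" "s = seg rs j0"
      using s(1) unfolding rs(2)[symmetric] hv by blast
    have j1: "1 \<le> j0" using j0(2) by (cases j0) auto
    have "rlen rs j0 = 3" using s(2) j0 by (simp add: seg_length_seg)
    moreover have "\<forall>j<?r. j \<noteq> j0 \<longrightarrow> rlen rs j = 2"
      using s(4) segments_others[OF wf j0(1)] by (simp add: rs(2) j0(3))
    moreover have "2 * i < j0"
      using s(3)
    proof
      assume *: "generated_by w s 2 \<and> (\<forall>s'\<in>v_segments w. generated_by w s' 2 \<longrightarrow> fst s' \<le> fst s)"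
      \<comment> \<open>Run \<open>2 * i + 1\<close> is generated by a link of type 2, so the last
        such vertical segment starts no earlier.\<close>
      have lt: "2 * i + 1 < ?r" using i r[OF i] by simp
      have "seg rs (2 * i + 1) \<in> v_segments w" unfolding rs(2)[symmetric] hv using lt by simp
      moreover have "generated_by w (seg rs (2 * i + 1)) 2"
        using pairs_generated(2)[OF wf _ lt type[OF i]] rs(2) by simp
      ultimately have "fst (seg rs (2 * i + 1)) \<le> fst (seg rs j0)" using * j0(3) by blast
      hence "start rs (2 * i + 1) \<le> start rs j0" by (simp add: seg_def)
      thus ?thesis using start_less_iff[OF wf, of j0 "2 * i + 1"] lt j0(1) by simp
    next
      assume "generated_by w s 3"
      thus ?thesis using pairs_generated(1)[OF wf j1 j0(1) type[OF i]] j0 rs(2) by simp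
    qed
    ultimately show ?thesis using i j0(2) one_longer[of j0 "\<lambda>j. if even j then 2 * i < j else j < 2 * i"]
      by (intro exI[of _ i]) simp
  qed
  then obtain i where i: "i \<le> m" "paired_chain m i w" and two: "\<forall>j<?r. 2 \<le> rlen rs j"
    and len: "\<forall>j. Suc j < ?r \<longrightarrow> (if even j then 2 * i < j else j < 2 * i) \<longrightarrow> rlen rs j = 2"
    by blast
  have "pairs m i rs"
    using paired_chain_word_of[OF wf chain hor i(1)] i len rs(2) by (simp add: pairs_def)
  hence "tight rs m" by (rule pairs_tight[OF wf rs(3) _ two])
  thus ?thesis using maximal_iff_tight[OF k rs(5) wf] w rs(2) by simp
qed

section \<open>Every maximal chain lies in one of the families\<close>

definition maximal_families :: "nat \<Rightarrow> nat \<Rightarrow> chain_word set" where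
  "maximal_families k m =
    (if k = 3 then C_family [(3, int m + 1)]
     else if k = 4 then C_family [(3, int m), (4, 1)]
     else if k = 5 then Cbar_3 m \<union> C_family [(3, int m), (5, 1)] \<union> C_family [(3, int m - 1), (4, 2)]
     else C_family [(3, int m), (6, 1)] \<union> Cbar_34 m \<union> Cunder_34 m \<union>
       C_family [(3, int m - 1), (4, 1), (5, 1)] \<union> C_family [(3, int m - 2), (4, 3)])"

text \<open>Here \<open>N v\<close> is the number of horizontal segments of length
  \<open>v + 3\<close>. Together they have \<open>k - 3\<close> extra steps, so the families of
  zigzags correspond to the partitions of \<open>k - 3\<close>.\<close>

lemma zigzag_code_in_families:
  assumes k: "3 \<le> k" "k \<le> 6" and z: "zigzag its" "length its = m" "s + slack its + 3 = k"
    and chain: "general_polyomino_chain (code_word c (s, its))" and c: "c \<in> updown"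
  shows "code_word c (s, its) \<in> maximal_families k m"
proof -
  define xs where "xs = s # map snd its"
  define N where "N v = int (length (filter ((=) v) xs))" for v
  have sum: "sum_list xs + 3 = k" "length xs = m + 1" using z by (simp_all add: xs_def)
  have "sum_list xs \<le> 3" using sum k by simp
  from small_sum[OF this] have N: "N 0 + N 1 + N 2 + N 3 = int m + 1" "N 1 + 2 * N 2 + 3 * N 3 + 3 = int k"
    using sum by (simp_all add: N_def)
  have nonneg: "0 \<le> N v" for v by (simp add: N_def)
  have fam: "code_word c (s, its) \<in> C_family ls \<longleftrightarrow> int m + 1 = sum_list (map snd ls) \<and>
      (\<forall>(l, \<alpha>)\<in>set ls. N (l - 3) = \<alpha>)" if "\<forall>(l, \<alpha>)\<in>set ls. 3 \<le> l" for ls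
    using zigzag_C_family[OF z(1) chain c that] z(2) by (simp add: N_def xs_def)
  have "k = 3 \<or> k = 4 \<or> k = 5 \<or> k = 6" using k by arith
  thus ?thesis
  proof (elim disjE)
    assume [simp]: "k = 3"
    show ?thesis using N nonneg[of 1] nonneg[of 2] nonneg[of 3] by (simp add: maximal_families_def fam)
  next
    assume [simp]: "k = 4"
    have "N 1 = 1 \<and> N 2 = 0 \<and> N 3 = 0"
      using N(2) nonneg[of 1] nonneg[of 2] nonneg[of 3] by simp presburger
    thus ?thesis using N(1) by (simp add: maximal_families_def fam)
  next
    assume [simp]: "k = 5"
    have "N 1 = 2 \<and> N 2 = 0 \<and> N 3 = 0 \<or> N 1 = 0 \<and> N 2 = 1 \<and> N 3 = 0"
      using N(2) nonneg[of 1] nonneg[of 2] nonneg[of 3] by simp presburger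
    thus ?thesis using N(1) by (auto simp: maximal_families_def fam)
  next
    assume [simp]: "k = 6"
    have "N 1 = 3 \<and> N 2 = 0 \<and> N 3 = 0 \<or> N 1 = 1 \<and> N 2 = 1 \<and> N 3 = 0 \<or> N 1 = 0 \<and> N 2 = 0 \<and> N 3 = 1"
      using N(2) nonneg[of 1] nonneg[of 2] nonneg[of 3] by simp presburger
    thus ?thesis using N(1) by (auto simp: maximal_families_def fam)
  qed
qed

lemma maximal_in_families:
  assumes k: "3 \<le> k" "k \<le> 6" and w: "w \<in> maximal_chains (k + 4 * m)"
  shows "w \<in> maximal_families k m"
proof -
  obtain c s its where c: "c \<in> updown" and x: "(s, its) \<in> codes m k" and w_eq: "w = code_word c (s, its)"
    using w unfolding maximal_chains_code[OF k] by auto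
  have chain: "general_polyomino_chain (code_word c (s, its))"
    using code_word_chain[OF x k(2) c] by (simp add: polyomino_chains_def)
  show ?thesis
    using x k(2)
  proof (cases rule: codes_cases)
    case zigzag
    thus ?thesis unfolding w_eq by (intro zigzag_code_in_families k chain c)
  next
    case (two_zigzags A t B)
    let ?rs = "enc Rightwards c s its"
    have wf: "wf_runs ?rs" using c by (intro wf_enc) (simp flip: perp_updown)
    have hor: "horizontal (rdir ?rs 0)" using hd_enc[of Rightwards c s its] by (auto simp: horizontal_def)
    have two: "\<forall>j<length ?rs. 2 \<le> rlen ?rs j" by (auto intro!: len_enc nth_mem)
    have pairs: "pairs m (length A) ?rs"
      using two_zigzags_pairs[OF two_zigzags(2-4)] two_zigzags(1) by simp
    have chain': "general_polyomino_chain (word_of ?rs)" using chain by (simp add: code_word_def)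
    have "k = 5 \<or> k = 6" using two_zigzags(5) k by arith
    thus ?thesis
      using pairs_in_families[OF wf chain' hor two pairs] num_squares_code[OF x, of Rightwards c]
      by (auto simp: w_eq code_word_def maximal_families_def)
  qed
qed

lemma real_choose:
  "real (m + 2 choose 2) = (real m + 2) * (real m + 1) / 2"
  "real (m + 3 choose 3) = (real m + 3) * (real m + 2) * (real m + 1) / 6"
proof -
  have 2: "2 * (m + 2 choose 2) = (m + 2) * (m + 1)"
    using Suc_times_binomial_eq[of "m + 1" 1] by (simp add: numeral_2_eq_2)
  have 3: "3 * (m + 3 choose 3) = (m + 3) * (m + 2 choose 2)"
    using Suc_times_binomial_eq[of "m + 2" 2] by (simp add: numeral_3_eq_3 numeral_2_eq_2)
  show *: "real (m + 2 choose 2) = (real m + 2) * (real m + 1) / 2"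
    using arg_cong[OF 2, of real] by (simp add: algebra_simps)
  have "3 * real (m + 3 choose 3) = (real m + 3) * real (m + 2 choose 2)"
    using arg_cong[OF 3, of real] by simp
  thus "real (m + 3 choose 3) = (real m + 3) * (real m + 2) * (real m + 1) / 6"
    unfolding * by simp
qed

theorem theorem6p1:
  fixes n k m :: nat
  assumes "n \<ge> 3" and "k \<in> {3, 4, 5, 6}" and "n = k + 4 * m"
  shows
    "(k = 3 \<longrightarrow>
        maximal_chains n = polyomino_chains n \<inter> C_family [(3, int m + 1)] \<and>
        number_upto_iso (maximal_chains n) = 1) \<and>
     (k = 4 \<longrightarrow>
        maximal_chains n = polyomino_chains n \<inter> C_family [(3, int m), (4, 1)] \<and>
        number_upto_iso (maximal_chains n) = m + 1) \<and>
     (k = 5 \<longrightarrow>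
        maximal_chains n = polyomino_chains n \<inter>
          (Cbar_3 m \<union> C_family [(3, int m), (5, 1)] \<union> C_family [(3, int m - 1), (4, 2)]) \<and>
        real (number_upto_iso (maximal_chains n)) = (real m + 1) * (real m + 4) / 2) \<and>
     (k = 6 \<longrightarrow>
        maximal_chains n = polyomino_chains n \<inter>
          (C_family [(3, int m), (6, 1)] \<union> Cbar_34 m \<union> Cunder_34 m \<union>
           C_family [(3, int m - 1), (4, 1), (5, 1)] \<union> C_family [(3, int m - 2), (4, 3)]) \<and>
        real (number_upto_iso (maximal_chains n)) =
          (real m + 1) * (real m + 2) * (2 * real m + 18) / 12) \<and>
     (\<exists>w\<in>polyomino_chains n. R_chain w = 11 / 18 + real k / 3 + 193 / 144 * real m) \<and>
     (\<forall>w\<in>polyomino_chains n. R_chain w \<le> 11 / 18 + real k / 3 + 193 / 144 * real m)"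
proof -
  have k: "3 \<le> k" "k \<le> 6" using assms(2) by auto
  let ?P = "polyomino_chains n" and ?M = "maximal_chains n"
  let ?A = "11 / 18 + real k / 3 + 193 / 144 * real m"
  have sub: "?M \<subseteq> ?P" by (auto simp: maximal_chains_def)
  have C: "?P \<inter> C_family ls \<subseteq> ?M"
    if "distinct (map fst ls)" "\<forall>(l, \<alpha>)\<in>set ls. 3 \<le> l" "sum_list (map snd ls) = int m + 1"
      "(\<Sum>(l, \<alpha>)\<leftarrow>ls. (int l - 1) * \<alpha>) = 2 * int m + int k - 1" for ls
    using C_family_maximal[OF k _ _ that] assms(3) by blast
  have P: "?P \<inter> (Cbar_3 m \<union> Cbar_34 m \<union> Cunder_34 m) \<subseteq> ?M"
    using paired_families_maximal[OF k] assms(3) by blast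
  have num: "number_upto_iso ?M = ((m + (k - 3)) choose (k - 3)) +
      (if 5 \<le> k then (m + 1) * ((m + 1 + (k - 5)) choose (k - 5)) else 0)"
    unfolding assms(3) number_maximal[OF k] card_codes[OF k] ..
  have fam: "w \<in> maximal_families k m" if "w \<in> ?M" for w
    using maximal_in_families[OF k] that assms(3) by blast
  have "k = 3 \<longrightarrow> ?M = ?P \<inter> C_family [(3, int m + 1)] \<and> number_upto_iso ?M = 1"
  proof
    assume k3: "k = 3"
    have "?M = ?P \<inter> C_family [(3, int m + 1)]"
      using sub fam C[of "[(3, int m + 1)]"] by (auto simp: k3 maximal_families_def)
    thus "?M = ?P \<inter> C_family [(3, int m + 1)] \<and> number_upto_iso ?M = 1"
      using num by (simp add: k3)
  qed
  moreover have "k = 4 \<longrightarrow> ?M = ?P \<inter> C_family [(3, int m), (4, 1)] \<and> number_upto_iso ?M = m + 1"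
  proof
    assume k4: "k = 4"
    have "?M = ?P \<inter> C_family [(3, int m), (4, 1)]"
      using sub fam C[of "[(3, int m), (4, 1)]"] by (auto simp: k4 maximal_families_def)
    thus "?M = ?P \<inter> C_family [(3, int m), (4, 1)] \<and> number_upto_iso ?M = m + 1"
      using num by (simp add: k4)
  qed
  moreover have "k = 5 \<longrightarrow> ?M = ?P \<inter>
        (Cbar_3 m \<union> C_family [(3, int m), (5, 1)] \<union> C_family [(3, int m - 1), (4, 2)]) \<and>
      real (number_upto_iso ?M) = (real m + 1) * (real m + 4) / 2"
  proof
    assume k5: "k = 5"
    have "?M = ?P \<inter> (Cbar_3 m \<union> C_family [(3, int m), (5, 1)] \<union> C_family [(3, int m - 1), (4, 2)])"
      using sub fam P C[of "[(3, int m), (5, 1)]"] C[of "[(3, int m - 1), (4, 2)]"]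
      by (auto simp: k5 maximal_families_def)
    \<comment> \<open>Two extra steps on the \<open>m + 1\<close> horizontal segments of a zigzag,
      or one of \<open>m + 1\<close> places for the joint of two zigzags.\<close>
    moreover have "number_upto_iso ?M = (m + 2 choose 2) + (m + 1)" using num by (simp add: k5)
    ultimately show "?M = ?P \<inter>
        (Cbar_3 m \<union> C_family [(3, int m), (5, 1)] \<union> C_family [(3, int m - 1), (4, 2)]) \<and>
        real (number_upto_iso ?M) = (real m + 1) * (real m + 4) / 2"
      using real_choose(1)[of m] by (simp add: field_simps)
  qed
  moreover have "k = 6 \<longrightarrow> ?M = ?P \<inter>
        (C_family [(3, int m), (6, 1)] \<union> Cbar_34 m \<union> Cunder_34 m \<union>
         C_family [(3, int m - 1), (4, 1), (5, 1)] \<union> C_family [(3, int m - 2), (4, 3)]) \<and>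
      real (number_upto_iso ?M) = (real m + 1) * (real m + 2) * (2 * real m + 18) / 12"
  proof
    assume k6: "k = 6"
    have "?M = ?P \<inter>
        (C_family [(3, int m), (6, 1)] \<union> Cbar_34 m \<union> Cunder_34 m \<union>
         C_family [(3, int m - 1), (4, 1), (5, 1)] \<union> C_family [(3, int m - 2), (4, 3)])"
      using sub fam P C[of "[(3, int m), (6, 1)]"] C[of "[(3, int m - 1), (4, 1), (5, 1)]"]
        C[of "[(3, int m - 2), (4, 3)]"]
      by (auto simp: k6 maximal_families_def)
    \<comment> \<open>Three extra steps on a zigzag; or \<open>m + 1\<close> places for the joint,
      times \<open>m + 2\<close> places for the single extra step, namely the first run and the
      \<open>m + 1\<close> items.\<close>
    moreover have "number_upto_iso ?M = (m + 3 choose 3) + (m + 1) * (m + 2)" using num by (simp add: k6)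
    ultimately show "?M = ?P \<inter>
        (C_family [(3, int m), (6, 1)] \<union> Cbar_34 m \<union> Cunder_34 m \<union>
         C_family [(3, int m - 1), (4, 1), (5, 1)] \<union> C_family [(3, int m - 2), (4, 3)]) \<and>
        real (number_upto_iso ?M) = (real m + 1) * (real m + 2) * (2 * real m + 18) / 12"
      using real_choose(2)[of m] by (simp add: field_simps)
  qed
  moreover have "\<exists>w\<in>?P. R_chain w = ?A"
    using code_word_chain[OF code_exists[OF k(1)] k(2), of Upwards m]
      R_chain_code[OF code_exists[OF k(1)] k, of Upwards m] assms(3) by blast
  moreover have "\<forall>w\<in>?P. R_chain w \<le> ?A"
  proof
    fix w assume "w \<in> ?P"
    then obtain rs where "wf_runs rs" "word_of rs = w" "self_avoiding (word_of rs)"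
      "num_squares (word_of rs) = n"
      by (rule chain_runs)
    thus "R_chain w \<le> ?A" using R_chain_bound(1)[of rs k m] k assms(3) by simp
  qed
  ultimately show ?thesis by blast
qed

end
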